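(* Let $N\ge3$, let $\Omega\subset\mathbb{R}^N$ be a bounded smooth domain, let $\lambda\in\mathbb{R}$, and put $2^*=\frac{2N}{N-2}$. If $\mu<0$ and $$-\frac{(N-2)\mu}{2}+\frac{(N-2)\mu}{2}\log\Big(-\frac{(N-2)\mu}{2}\Big)+\lambda-\lambda_1(\Omega)\ge0,$$ then the problem $$-\Delta u=|u|^{2^*-2}u+\lambda u+\mu u\log u^2\ \text{ in }\Omega,\qquad u=0\ \text{ on }\partial\Omega,$$ has no positive solutions.
   Context: A positive solution is a weak solution $u\in H^1_0(\Omega)$ with $u>0$ in $\Omega$. $\lambda_1(\Omega)$ is the first eigenvalue of $-\Delta$ on $\Omega$ with zero Dirichlet boundary condition, i.e. $\lambda_1(\Omega)=\inf_{u\in H^1_0(\Omega)\setminus\{0\}}\frac{\int_\Omega|\nabla u|^2dx}{\int_\Omega|u|^2dx}$. *)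

theory Defs
  imports "HOL-Analysis.Analysis"
begin

fun C_k :: "nat \<Rightarrow> ('a::euclidean_space \<Rightarrow> real) \<Rightarrow> bool" where
  "C_k 0 f \<longleftrightarrow> continuous_on UNIV f"
| "C_k (Suc k) f \<longleftrightarrow> (\<forall>x. f differentiable (at x)) \<and>
     (\<forall>b\<in>Basis. C_k k (\<lambda>x. frechet_derivative f (at x) b))"

definition smooth :: "('a::euclidean_space \<Rightarrow> real) \<Rightarrow> bool" where
  "smooth f \<longleftrightarrow> (\<forall>k. C_k k f)"

text \<open>Near each boundary point the domain is the region strictly above the graph of a smooth
  function, after a rotation of the coordinates. The unit vector \<open>e\<close> is the new last coordinate
  axis; \<open>\<gamma>\<close> is a function of the remaining coordinates, since it is only evaluated at points
  of the hyperplane orthogonal to \<open>e\<close>.\<close>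

definition smooth_boundary :: "'a::euclidean_space set \<Rightarrow> bool" where
  "smooth_boundary \<Omega> \<longleftrightarrow>
     (\<forall>p\<in>frontier \<Omega>. \<exists>r>0. \<exists>e \<gamma>. norm e = 1 \<and> smooth \<gamma> \<and>
        \<Omega> \<inter> ball p r = {x \<in> ball p r. x \<bullet> e > \<gamma> (x - (x \<bullet> e) *\<^sub>R e)})"

definition bounded_smooth_domain :: "'a::euclidean_space set \<Rightarrow> bool" where
  "bounded_smooth_domain \<Omega> \<longleftrightarrow>
     open \<Omega> \<and> connected \<Omega> \<and> \<Omega> \<noteq> {} \<and> bounded \<Omega> \<and> smooth_boundary \<Omega>"

text \<open>\<open>C\<^sub>c\<^sup>\<infinity>(\<Omega>)\<close>, each function being extended by zero to the whole space.\<close>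

definition test_functions :: "'a::euclidean_space set \<Rightarrow> ('a \<Rightarrow> real) set" where
  "test_functions \<Omega> = {\<phi>. smooth \<phi> \<and> compact (closure {x. \<phi> x \<noteq> 0}) \<and> closure {x. \<phi> x \<noteq> 0} \<subseteq> \<Omega>}"

text \<open>Elements of the Lebesgue and Sobolev spaces below are represented by functions on the whole
  space, of which only the values almost everywhere in \<open>\<Omega>\<close> matter.\<close>

definition locally_integrable ::
    "'a::euclidean_space set \<Rightarrow> ('a \<Rightarrow> 'b::euclidean_space) \<Rightarrow> bool" where
  "locally_integrable \<Omega> f \<longleftrightarrow>
     (\<forall>K. compact K \<and> K \<subseteq> \<Omega> \<longrightarrow> integrable (lebesgue_on K) f)"

definition square_integrable ::
    "'a::euclidean_space set \<Rightarrow> ('a \<Rightarrow> 'b::euclidean_space) \<Rightarrow> bool" where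
  "square_integrable \<Omega> f \<longleftrightarrow>
     f \<in> borel_measurable (lebesgue_on \<Omega>) \<and> integrable (lebesgue_on \<Omega>) (\<lambda>x. (norm (f x))\<^sup>2)"

definition has_weak_gradient ::
    "'a::euclidean_space set \<Rightarrow> ('a \<Rightarrow> real) \<Rightarrow> ('a \<Rightarrow> 'a) \<Rightarrow> bool" where
  "has_weak_gradient \<Omega> u G \<longleftrightarrow>
     locally_integrable \<Omega> u \<and> locally_integrable \<Omega> G \<and>
     (\<forall>\<phi>\<in>test_functions \<Omega>. \<forall>b\<in>Basis.
        (\<integral>x. u x * frechet_derivative \<phi> (at x) b \<partial>lebesgue_on \<Omega>) =
        - (\<integral>x. (G x \<bullet> b) * \<phi> x \<partial>lebesgue_on \<Omega>))"

text \<open>The weak gradient is unique up to null sets, so the choice does not affect the integrals in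
  which it occurs.\<close>

definition weak_gradient :: "'a::euclidean_space set \<Rightarrow> ('a \<Rightarrow> real) \<Rightarrow> ('a \<Rightarrow> 'a)" where
  "weak_gradient \<Omega> u = (SOME G. has_weak_gradient \<Omega> u G)"

definition H1 :: "'a::euclidean_space set \<Rightarrow> ('a \<Rightarrow> real) set" where
  "H1 \<Omega> = {u. square_integrable \<Omega> u \<and>
              (\<exists>G. has_weak_gradient \<Omega> u G \<and> square_integrable \<Omega> G)}"

definition H1_norm :: "'a::euclidean_space set \<Rightarrow> ('a \<Rightarrow> real) \<Rightarrow> real" where
  "H1_norm \<Omega> u =
     sqrt ((\<integral>x. (u x)\<^sup>2 \<partial>lebesgue_on \<Omega>) + (\<integral>x. (norm (weak_gradient \<Omega> u x))\<^sup>2 \<partial>lebesgue_on \<Omega>))"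

text \<open>The closure of \<open>C\<^sub>c\<^sup>\<infinity>(\<Omega>)\<close> in \<open>H\<^sup>1(\<Omega>)\<close>.\<close>

definition H1_0 :: "'a::euclidean_space set \<Rightarrow> ('a \<Rightarrow> real) set" where
  "H1_0 \<Omega> = {u \<in> H1 \<Omega>. \<forall>\<epsilon>>0. \<exists>\<phi>\<in>test_functions \<Omega>. H1_norm \<Omega> (\<lambda>x. u x - \<phi> x) < \<epsilon>}"

definition first_eigenvalue :: "'a::euclidean_space set \<Rightarrow> real" where
  "first_eigenvalue \<Omega> =
     (INF u \<in> {u \<in> H1_0 \<Omega>. \<not> (AE x in lebesgue_on \<Omega>. u x = 0)}.
        (\<integral>x. (norm (weak_gradient \<Omega> u x))\<^sup>2 \<partial>lebesgue_on \<Omega>) / (\<integral>x. (u x)\<^sup>2 \<partial>lebesgue_on \<Omega>))"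

text \<open>Weak solutions of \<open>-\<Delta>u = f(u)\<close> in \<open>\<Omega>\<close>, \<open>u = 0\<close> on \<open>\<partial>\<Omega>\<close>. Integrability is stated because the
  Bochner integral of a non-integrable function is 0 by convention; the integrand on the left is
  always integrable, being a product of square-integrable functions.\<close>

definition weak_solution ::
    "'a::euclidean_space set \<Rightarrow> (real \<Rightarrow> real) \<Rightarrow> ('a \<Rightarrow> real) \<Rightarrow> bool" where
  "weak_solution \<Omega> f u \<longleftrightarrow>
     u \<in> H1_0 \<Omega> \<and>
     (\<forall>v\<in>H1_0 \<Omega>. integrable (lebesgue_on \<Omega>) (\<lambda>x. f (u x) * v x) \<and>
        (\<integral>x. weak_gradient \<Omega> u x \<bullet> weak_gradient \<Omega> v x \<partial>lebesgue_on \<Omega>) =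
        (\<integral>x. f (u x) * v x \<partial>lebesgue_on \<Omega>))"

definition positive_solution ::
    "'a::euclidean_space set \<Rightarrow> (real \<Rightarrow> real) \<Rightarrow> ('a \<Rightarrow> real) \<Rightarrow> bool" where
  "positive_solution \<Omega> f u \<longleftrightarrow> weak_solution \<Omega> f u \<and> (AE x in lebesgue_on \<Omega>. u x > 0)"

definition critical_exponent :: "nat \<Rightarrow> real" where
  "critical_exponent N = 2 * real N / (real N - 2)"

text \<open>The value at \<open>s = 0\<close> is 0, the continuous extension of \<open>s log s\<^sup>2\<close>.\<close>

definition log_critical_nonlinearity :: "nat \<Rightarrow> real \<Rightarrow> real \<Rightarrow> real \<Rightarrow> real" where
  "log_critical_nonlinearity N \<Lambda> \<mu> s =
     \<bar>s\<bar> powr (critical_exponent N - 2) * s + \<Lambda> * s + \<mu> * s * ln (s\<^sup>2)"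

end

theory Submission
  imports Defs "HOL-Complex_Analysis.Great_Picard" "HOL-Library.Diagonal_Subsequence"
begin

text \<open>Write \<open>f\<close> for the nonlinearity and \<open>\<lambda>\<^sub>1\<close> for the first eigenvalue. The hypothesis says that
  \<open>f s \<ge> \<lambda>\<^sub>1 s\<close> for all \<open>s > 0\<close>, with equality for at most one value \<open>s = s\<^sub>0\<close>. Testing the equation
  of a positive solution \<open>u\<close> with a nonnegative first eigenfunction \<open>V\<close> gives
  \<open>\<integral> (f u - \<lambda>\<^sub>1 u) V = 0\<close>, hence \<open>u = s\<^sub>0\<close> almost everywhere on \<open>{V \<noteq> 0}\<close>. No maximum principle
  is needed to conclude: choose \<open>\<Phi>\<close> with \<open>\<Phi> 0 = 0\<close>, \<open>\<Phi> s\<^sub>0 > 0\<close> and bounded derivative \<open>\<psi>\<close>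
  such that \<open>\<psi>\<close> and \<open>\<psi>'\<close> vanish at \<open>s\<^sub>0\<close>. The eigenvalue equation tested with \<open>\<Phi> u\<close> gives
  \<open>\<integral> \<psi>(u) \<nabla>V \<bullet> \<nabla>u = \<lambda>\<^sub>1 \<Phi>(s\<^sub>0) \<integral> V > 0\<close>, while the equation of \<open>u\<close> tested with
  \<open>T(V) \<psi>(u)\<close>, for bounded truncations \<open>T\<close> tending to the identity, gives \<open>0\<close> for the left-hand side.

  The eigenfunction is the limit of a minimizing sequence of test functions \<open>v\<^sub>n \<ge> 0\<close>. All
  identities for \<open>V\<close> come from \<open>\<integral> \<nabla>v\<^sub>n \<bullet> \<nabla>w - \<lambda>\<^sub>1 \<integral> v\<^sub>n w \<rightarrow> 0\<close>, which is Cauchy-Schwarz for the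
  nonnegative form \<open>\<integral> |\<nabla>w|\<^sup>2 - \<lambda>\<^sub>1 \<integral> w\<^sup>2\<close>, so that \<open>u\<close> and \<open>V\<close> only ever occur as limits of test
  functions.\<close>

subsection \<open>Smooth functions\<close>

text \<open>If \<open>f s > \<lambda>\<^sub>1 s\<close> held for every \<open>s > 0\<close>, the
  identity from testing with \<open>V\<close> would force \<open>V = 0\<close> at once. The obstacle
  is the borderline value \<open>s\<^sub>0\<close>: there the identity only says that
  \<open>u\<close> is constant where \<open>V\<close> lives. The test function
  \<open>T(V) \<psi>(u)\<close> is made so that every term but one dies: where
  \<open>V \<noteq> 0\<close>, both \<open>\<psi>(u)\<close> and \<open>\<psi>'(u)\<close> vanish,
  and where \<open>V = 0\<close>, \<open>T(V)\<close> vanishes. What survives is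
  \<open>\<integral> \<psi>(u) T'(V) \<nabla>u \<bullet> \<nabla>V\<close>, which is therefore 0.
  Truncation is forced because \<open>f(u)\<close> is known to be integrable but not to be
  integrable against \<open>V\<close>, and because \<open>|\<nabla>u|\<^sup>2\<close> admits only
  bounded multipliers. Product and chain rules are applied to smooth functions only, and the results
  are carried to the limit by one notion of convergence: almost everywhere, with a common
  square-integrable majorant. This is why \<open>arctan\<close> is the source of both
  \<open>\<Phi>\<close> and \<open>T\<close>: it is smooth, bounded, and its derivatives are
  explicit.\<close>

lemma C_k_SucI:
  assumes "\<And>x. (f has_derivative f' x) (at x)"
    and "\<And>b. b \<in> Basis \<Longrightarrow> C_k k (\<lambda>x. f' x b)"
  shows "C_k (Suc k) f"
proof -
  have "frechet_derivative f (at x) = f' x" for x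
    using frechet_derivative_at[OF assms(1)] by metis
  with assms show ?thesis
    by (auto simp: differentiable_def)
qed

lemma C_k_SucD:
  assumes "C_k (Suc k) f"
  shows "(f has_derivative frechet_derivative f (at x)) (at x)"
    and "b \<in> Basis \<Longrightarrow> C_k k (\<lambda>x. frechet_derivative f (at x) b)"
  using assms by (auto simp: frechet_derivative_works)

lemma C_k_Suc_imp: "C_k (Suc k) f \<Longrightarrow> C_k k f"
proof (induction k arbitrary: f)
  case 0
  then show ?case
    by (auto intro!: differentiable_imp_continuous_on simp: differentiable_on_def
        intro: differentiable_at_withinI)
next
  case (Suc k)
  show ?case
    by (rule C_k_SucI[OF C_k_SucD(1)[OF Suc.prems]])
       (use Suc.IH C_k_SucD(2)[OF Suc.prems] in blast)
qed

lemma C_k_const: "C_k k (\<lambda>x. c)"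
proof (induction k arbitrary: c)
  case (Suc k)
  show ?case
    by (rule C_k_SucI[where f'="\<lambda>x h. 0"]) (use Suc in auto)
qed auto

lemma C_k_inner: "C_k k (\<lambda>x. x \<bullet> c)"
proof (cases k)
  case (Suc j)
  show ?thesis unfolding Suc
    by (rule C_k_SucI[where f'="\<lambda>x h. h \<bullet> c"])
       (auto intro!: derivative_eq_intros C_k_const)
qed (auto intro!: continuous_intros)

lemma C_k_add: "C_k k f \<Longrightarrow> C_k k g \<Longrightarrow> C_k k (\<lambda>x. f x + g x)"
proof (induction k arbitrary: f g)
  case 0 then show ?case by (auto intro!: continuous_intros)
next
  case (Suc k)
  show ?case
    by (rule C_k_SucI[OF has_derivative_add[OF C_k_SucD(1)[OF Suc.prems(1)] C_k_SucD(1)[OF Suc.prems(2)]]])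
       (use Suc.IH C_k_SucD(2)[OF Suc.prems(1)] C_k_SucD(2)[OF Suc.prems(2)] in blast)
qed

lemma C_k_mult: "C_k k f \<Longrightarrow> C_k k g \<Longrightarrow> C_k k (\<lambda>x. f x * g x)"
proof (induction k arbitrary: f g)
  case 0 then show ?case by (auto intro!: continuous_intros)
next
  case (Suc k)
  show ?case
    by (rule C_k_SucI[OF has_derivative_mult[OF C_k_SucD(1)[OF Suc.prems(1)] C_k_SucD(1)[OF Suc.prems(2)]]])
       (intro C_k_add Suc.IH C_k_SucD(2)[OF Suc.prems(1)] C_k_SucD(2)[OF Suc.prems(2)] 
          C_k_Suc_imp[OF Suc.prems(1)] C_k_Suc_imp[OF Suc.prems(2)])
qed

text \<open>The chain rule turns \<open>F j\<close> into \<open>F (Suc j)\<close>, so the induction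
  carries the whole sequence of successive derivatives and runs over all indices \<open>j\<close> at
  once.\<close>

lemma C_k_comp:
  assumes "\<And>j t. (F j has_real_derivative F (Suc j) t) (at t)" and "C_k k w"
  shows "C_k k (\<lambda>x. F j (w x))"
  using assms(2)
proof (induction k arbitrary: j w)
  case 0
  have "continuous_on UNIV (F j)"
    by (rule DERIV_continuous_on[where D="F (Suc j)"]) (use assms(1) has_field_derivative_at_within in blast)
  with 0 show ?case
    by (auto intro: continuous_on_compose2)
next
  case (Suc k)
  have d: "((\<lambda>x. F j (w x)) has_derivative (\<lambda>h. frechet_derivative w (at x) h * F (Suc j) (w x))) (at x)" for x
    by (rule DERIV_compose_FDERIV[OF assms(1) C_k_SucD(1)[OF Suc.prems]])
  show ?case
    by (rule C_k_SucI[OF d]) (intro C_k_mult Suc.IH C_k_SucD(2)[OF Suc.prems] C_k_Suc_imp[OF Suc.prems])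
qed

text \<open>\<open>C_k_comp\<close> asks for an outer function differentiable on the whole line,
  which \<open>1 / t\<close> is not. But the derivative is again a product of
  \<open>inverse (w x)\<close> with a derivative of \<open>w\<close>, so the induction closes by
  itself. The square root is treated in the same way, and the derivative of \<open>arctan\<close> is
  reduced to this case.\<close>

lemma C_k_inverse:
  assumes "C_k k w" and nz: "\<And>x. w x \<noteq> 0"
  shows "C_k k (\<lambda>x. inverse (w x))"
  using assms(1)
proof (induction k)
  case 0
  with nz show ?case by (auto intro!: continuous_intros)
next
  case (Suc k)
  have d: "((\<lambda>x. inverse (w x)) has_derivative
      (\<lambda>h. (- 1) * (inverse (w x) * frechet_derivative w (at x) h * inverse (w x)))) (at x)" for x
    using Deriv.has_derivative_inverse[OF nz C_k_SucD(1)[OF Suc.prems]] by simp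
  show ?case
    by (rule C_k_SucI[OF d])
       (intro C_k_mult C_k_const Suc.IH C_k_SucD(2)[OF Suc.prems] C_k_Suc_imp[OF Suc.prems])
qed

lemma C_k_arctan:
  assumes "C_k k w" shows "C_k k (\<lambda>x. arctan (w x))"
  using assms
proof (induction k)
  case 0
  then show ?case by (auto intro!: continuous_intros)
next
  case (Suc k)
  have d: "((\<lambda>x. arctan (w x)) has_derivative
      (\<lambda>h. frechet_derivative w (at x) h * inverse (1 + w x * w x))) (at x)" for x
    using DERIV_compose_FDERIV[OF DERIV_arctan C_k_SucD(1)[OF Suc.prems]] by (simp add: power2_eq_square)
  have "1 + w x * w x \<noteq> 0" for x
    using zero_le_square[of "w x"] by linarith
  then show ?case
    by (intro C_k_SucI[OF d] C_k_mult C_k_inverse C_k_add C_k_const C_k_SucD(2)[OF Suc.prems]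
        C_k_Suc_imp[OF Suc.prems])
qed

lemma C_k_sqrt:
  assumes "C_k k w" and pos: "\<And>x. w x > 0"
  shows "C_k k (\<lambda>x. sqrt (w x))"
  using assms(1)
proof (induction k)
  case 0
  with pos show ?case by (auto intro!: continuous_intros)
next
  case (Suc k)
  have d: "((\<lambda>x. sqrt (w x)) has_derivative
      (\<lambda>h. frechet_derivative w (at x) h * (inverse (sqrt (w x)) * (1 / 2)))) (at x)" for x
    using DERIV_compose_FDERIV[OF DERIV_real_sqrt[OF pos] C_k_SucD(1)[OF Suc.prems]] by simp
  have "sqrt (w x) \<noteq> 0" for x using pos[of x] by simp
  then show ?case
    by (intro C_k_SucI[OF d] C_k_mult C_k_inverse Suc.IH C_k_const C_k_SucD(2)[OF Suc.prems]
        C_k_Suc_imp[OF Suc.prems])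
qed

lemma smooth_const: "smooth (\<lambda>x. c)"
  and smooth_inner: "smooth (\<lambda>x. x \<bullet> a)"
  and smooth_add: "smooth f \<Longrightarrow> smooth g \<Longrightarrow> smooth (\<lambda>x. f x + g x)"
  and smooth_mult: "smooth f \<Longrightarrow> smooth g \<Longrightarrow> smooth (\<lambda>x. f x * g x)"
  and smooth_inverse: "smooth f \<Longrightarrow> (\<And>x. f x \<noteq> 0) \<Longrightarrow> smooth (\<lambda>x. inverse (f x))"
  and smooth_arctan: "smooth f \<Longrightarrow> smooth (\<lambda>x. arctan (f x))"
  and smooth_sqrt: "smooth f \<Longrightarrow> (\<And>x. f x > 0) \<Longrightarrow> smooth (\<lambda>x. sqrt (f x))"
  by (auto simp: smooth_def C_k_const C_k_inner C_k_add C_k_mult C_k_inverse C_k_arctan C_k_sqrt)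

lemma smooth_comp:
  assumes "\<And>j t. (F j has_real_derivative F (Suc j) t) (at t)" and "smooth w"
  shows "smooth (\<lambda>x. F j (w x))"
  using C_k_comp[of F, OF assms(1)] assms(2) by (auto simp: smooth_def)

lemma smooth_diff: "smooth f \<Longrightarrow> smooth g \<Longrightarrow> smooth (\<lambda>x. f x - g x)"
  using smooth_add[of f "\<lambda>x. (-1) * g x"] smooth_mult[OF smooth_const, of g "-1"] by simp

lemma smooth_prod:
  assumes "finite I" "\<And>i. i \<in> I \<Longrightarrow> smooth (f i)"
  shows "smooth (\<lambda>x. \<Prod>i\<in>I. f i x)"
  using assms
  by (induction rule: finite_induct) (auto intro: smooth_const smooth_mult)

definition grad :: "('a::euclidean_space \<Rightarrow> real) \<Rightarrow> 'a \<Rightarrow> 'a" where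
  "grad f x = (\<Sum>b\<in>Basis. frechet_derivative f (at x) b *\<^sub>R b)"

lemma grad_inner_Basis: "b \<in> Basis \<Longrightarrow> grad f x \<bullet> b = frechet_derivative f (at x) b"
  by (simp add: grad_def)

lemma smooth_has_derivative:
  assumes "smooth f"
  shows "(f has_derivative (\<lambda>h. grad f x \<bullet> h)) (at x)"
proof -
  have "C_k (Suc 0) f" using assms unfolding smooth_def by blast
  then have d: "(f has_derivative frechet_derivative f (at x)) (at x)" by (rule C_k_SucD)
  then have lin: "linear (frechet_derivative f (at x))"
    by (simp add: has_derivative_linear)
  have "frechet_derivative f (at x) h = grad f x \<bullet> h" for h
  proof -
    have "frechet_derivative f (at x) h = frechet_derivative f (at x) (\<Sum>b\<in>Basis. (h \<bullet> b) *\<^sub>R b)"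
      by (simp add: euclidean_representation)
    also have "\<dots> = (\<Sum>b\<in>Basis. (h \<bullet> b) * frechet_derivative f (at x) b)"
      using lin by (simp add: linear_sum linear_cmul)
    also have "\<dots> = grad f x \<bullet> h"
      unfolding grad_def inner_sum_left by (rule sum.cong) (auto simp: inner_commute)
    finally show ?thesis .
  qed
  with d show ?thesis by (metis (no_types, lifting) ext)
qed

lemma frechet_derivative_eq_grad:
  assumes "smooth f"
  shows "frechet_derivative f (at x) h = grad f x \<bullet> h"
  using frechet_derivative_at[OF smooth_has_derivative[OF assms]] by metis

lemma gradI:
  assumes "(f has_derivative (\<lambda>h. g \<bullet> h)) (at x)"
  shows "grad f x = g"
  using frechet_derivative_at[OF assms, symmetric] by (simp add: grad_def euclidean_representation)

lemma smooth_continuous: "smooth f \<Longrightarrow> continuous_on A f"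
  unfolding smooth_def using C_k.simps(1) continuous_on_subset by blast

lemma smooth_pd:
  assumes "smooth f" "b \<in> Basis"
  shows "smooth (\<lambda>x. grad f x \<bullet> b)"
proof -
  have "C_k k (\<lambda>x. frechet_derivative f (at x) b)" for k
    using assms C_k_SucD(2) unfolding smooth_def by blast
  then show ?thesis using assms by (simp add: smooth_def grad_inner_Basis)
qed

lemma continuous_grad:
  assumes "smooth f" shows "continuous_on A (grad f)"
  unfolding continuous_on_componentwise[of A "grad f"]
  using smooth_continuous smooth_pd assms by blast

text \<open>The derivatives of \<open>exp (- 1 / t)\<close> are of the form \<open>p (1 / t) * exp (- 1 / t)\<close>
  with polynomials \<open>p\<close>.\<close>

definition flat :: "real poly \<Rightarrow> real \<Rightarrow> real" where
  "flat p t = (if t > 0 then poly p (1 / t) * exp (- (1 / t)) else 0)"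

text \<open>With \<open>y = 1 / t\<close> one has \<open>dy/dt = - y\<^sup>2\<close>, so
  \<open>p y * exp (- y)\<close> has the derivative
  \<open>y\<^sup>2 * (p y - p' y) * exp (- y)\<close>.\<close>

primrec flat_poly :: "nat \<Rightarrow> real poly" where
  "flat_poly 0 = 1"
| "flat_poly (Suc j) = [:0, 0, 1:] * (flat_poly j - pderiv (flat_poly j))"

lemma poly_exp_tendsto_0: "((\<lambda>y. poly p y * exp (- y)) \<longlongrightarrow> (0::real)) at_top"
proof (induction p)
  case (pCons a p)
  have 1: "((\<lambda>y::real. a * exp (-y)) \<longlongrightarrow> a * 0) at_top"
    by (intro tendsto_intros filterlim_compose[OF exp_at_bot filterlim_uminus_at_bot_at_top])
  have 2: "((\<lambda>y. y * (poly p y * exp (- y))) \<longlongrightarrow> (0::real)) at_top"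
  proof -
    have "((\<lambda>y::real. poly p y * exp (- y)) \<longlongrightarrow> 0) at_top" by fact
    show ?thesis
    proof -
      have "((\<lambda>y. \<Sum>i\<le>degree (pCons 0 p). coeff (pCons 0 p) i * (y ^ i / exp y)) \<longlongrightarrow> (\<Sum>i\<le>degree (pCons 0 p). coeff (pCons 0 p) i * 0)) at_top"
        by (intro tendsto_intros tendsto_power_div_exp_0)
      moreover have "(\<Sum>i\<le>degree (pCons 0 p). coeff (pCons 0 p) i * (y ^ i / exp y)) = y * (poly p y * exp (- y))" for y :: real
      proof -
        have "y * (poly p y * exp (- y)) = poly (pCons 0 p) y / exp y" by (simp add: exp_minus field_simps)
        then show ?thesis by (simp only: poly_altdef sum_divide_distrib times_divide_eq_right)
      qed
      ultimately show ?thesis by simp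
    qed
  qed
  show ?case using tendsto_add[OF 1 2] by (simp add: algebra_simps)
qed auto

lemma has_derivative_flat:
  "(flat p has_real_derivative flat ([:0, 0, 1:] * (p - pderiv p)) t) (at t)"
proof -
  consider "t > 0" | "t < 0" | "t = 0" by linarith
  then show ?thesis
  proof cases
    case 1
    have "((\<lambda>t. poly p (1 / t) * exp (- (1 / t))) has_real_derivative
        flat ([:0, 0, 1:] * (p - pderiv p)) t) (at t)"
      using 1 unfolding flat_def
      by (auto intro!: derivative_eq_intros DERIV_chain2[OF poly_DERIV] simp: field_simps power2_eq_square)
    moreover have "eventually (\<lambda>s. flat p s = poly p (1 / s) * exp (- (1 / s))) (nhds t)"
      by (rule eventually_mono[OF eventually_nhds_in_open[of "{0<..}"]]) (use 1 in \<open>auto simp: flat_def\<close>)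
    ultimately show ?thesis by (subst DERIV_cong_ev[OF refl _ refl])
  next
    case 2
    have "((\<lambda>t. 0) has_real_derivative flat ([:0, 0, 1:] * (p - pderiv p)) t) (at t)"
      using 2 by (simp add: flat_def)
    moreover have "eventually (\<lambda>s. flat p s = 0) (nhds t)"
      by (rule eventually_mono[OF eventually_nhds_in_open[of "{..<0}"]]) (use 2 in \<open>auto simp: flat_def\<close>)
    ultimately show ?thesis by (subst DERIV_cong_ev[OF refl _ refl])
  next
    case 3
    have "((\<lambda>h. flat p h / h) \<longlongrightarrow> 0) (at_right 0)"
    proof -
      \<comment> \<open>In the variable \<open>y = 1 / h\<close>, dividing by \<open>h\<close> is
        multiplying by \<open>y\<close>, that is, passing from \<open>p\<close> to
        \<open>pCons 0 p\<close>.\<close>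
      have "((\<lambda>h. poly (pCons 0 p) (inverse h) * exp (- (inverse h))) \<longlongrightarrow> 0) (at_right (0::real))"
        by (rule filterlim_compose[OF poly_exp_tendsto_0 filterlim_inverse_at_top_right])
      moreover have "eventually (\<lambda>h. poly (pCons 0 p) (inverse h) * exp (- (inverse h)) = flat p h / h) (at_right 0)"
        unfolding eventually_at_right_field by (auto simp: flat_def field_simps intro!: exI[of _ 1])
      ultimately show ?thesis by (rule Lim_transform_eventually)
    qed
    moreover have "((\<lambda>h. flat p h / h) \<longlongrightarrow> 0) (at_left 0)"
      by (rule Lim_transform_eventually[OF tendsto_const])
         (auto simp: eventually_at_left_field flat_def intro!: exI[of _ "-1"])
    ultimately have "((\<lambda>h. flat p h / h) \<longlongrightarrow> 0) (at 0)" by (simp add: filterlim_split_at)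
    then show ?thesis using 3 by (simp add: DERIV_def flat_def)
  qed
qed

lemma smooth_flat:
  assumes "smooth w" shows "smooth (\<lambda>x. flat 1 (w x))"
  using smooth_comp[of "\<lambda>j. flat (flat_poly j)" w 0] has_derivative_flat assms by simp

subsection \<open>Functions with compact support\<close>

lemma test_functionsD:
  assumes "\<phi> \<in> test_functions \<Omega>"
  shows "smooth \<phi>"
    and "\<exists>K. compact K \<and> K \<subseteq> \<Omega> \<and> (\<forall>x. x \<notin> K \<longrightarrow> \<phi> x = 0)"
proof -
  show "smooth \<phi>" using assms by (simp add: test_functions_def)
  show "\<exists>K. compact K \<and> K \<subseteq> \<Omega> \<and> (\<forall>x. x \<notin> K \<longrightarrow> \<phi> x = 0)"
    by (rule exI[of _ "closure {x. \<phi> x \<noteq> 0}"])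
       (use assms closure_subset in \<open>force simp: test_functions_def\<close>)
qed

lemma test_functionsI:
  assumes "smooth \<phi>" "compact K" "K \<subseteq> \<Omega>" "\<And>x. x \<notin> K \<Longrightarrow> \<phi> x = 0"
  shows "\<phi> \<in> test_functions \<Omega>"
proof -
  have "closure {x. \<phi> x \<noteq> 0} \<subseteq> K"
    by (rule closure_minimal) (use assms in \<open>auto simp: compact_imp_closed\<close>)
  then show ?thesis
    using assms compact_closure bounded_subset compact_imp_bounded unfolding test_functions_def
    by (metis (mono_tags, lifting) closed_closure compact_eq_bounded_closed mem_Collect_eq subset_trans)
qed

lemma test_functions_mult:
  assumes "\<phi> \<in> test_functions \<Omega>" "smooth w"
  shows "(\<lambda>x. \<phi> x * w x) \<in> test_functions \<Omega>"
  using test_functionsD[OF assms(1)] assms(2)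
  by (elim exE) (rule test_functionsI, auto intro: smooth_mult)

lemma test_functions_add:
  assumes "\<phi> \<in> test_functions \<Omega>" "\<eta> \<in> test_functions \<Omega>"
  shows "(\<lambda>x. \<phi> x + \<eta> x) \<in> test_functions \<Omega>"
proof -
  obtain K L where K: "compact K" "K \<subseteq> \<Omega>" "\<And>x. x \<notin> K \<Longrightarrow> \<phi> x = 0"
    and L: "compact L" "L \<subseteq> \<Omega>" "\<And>x. x \<notin> L \<Longrightarrow> \<eta> x = 0"
    using test_functionsD(2)[OF assms(1)] test_functionsD(2)[OF assms(2)] by metis
  show ?thesis
    by (rule test_functionsI[of _ "K \<union> L"])
       (use K L test_functionsD(1)[OF assms(1)] test_functionsD(1)[OF assms(2)] in
        \<open>auto intro: smooth_add compact_Un\<close>)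
qed

lemma test_functions_diff:
  assumes "\<phi> \<in> test_functions \<Omega>" "\<eta> \<in> test_functions \<Omega>"
  shows "(\<lambda>x. \<phi> x - \<eta> x) \<in> test_functions \<Omega>"
  using test_functions_add[OF assms(1) test_functions_mult[OF assms(2) smooth_const, of "-1"]] by simp

lemma test_functions_support:
  assumes "\<phi> \<in> test_functions \<Omega>"
  obtains K where "compact K" "K \<subseteq> \<Omega>" "\<And>x. x \<notin> K \<Longrightarrow> \<phi> x = 0" "\<And>x. x \<notin> K \<Longrightarrow> grad \<phi> x = 0"
proof -
  obtain K where K: "compact K" "K \<subseteq> \<Omega>" "\<And>x. x \<notin> K \<Longrightarrow> \<phi> x = 0"
    using test_functionsD(2)[OF assms(1)] by metis
  have "grad \<phi> x = 0" if "x \<notin> K" for x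
  proof (rule gradI)
    have "((\<lambda>x. 0) has_derivative (\<lambda>h. 0 \<bullet> h)) (at x)" by simp
    then show "(\<phi> has_derivative (\<lambda>h. 0 \<bullet> h)) (at x)"
      by (rule has_derivative_transform_within_open[of _ _ _ _ "- K"])
         (use K that in \<open>auto simp: compact_imp_closed\<close>)
  qed
  with K that show ?thesis by blast
qed

lemma test_functions_pd:
  assumes "\<phi> \<in> test_functions \<Omega>" "b \<in> Basis"
  shows "(\<lambda>x. grad \<phi> x \<bullet> b) \<in> test_functions \<Omega>"
proof -
  obtain K where K: "compact K" "K \<subseteq> \<Omega>" "\<And>x. x \<notin> K \<Longrightarrow> grad \<phi> x = 0"
    using test_functions_support[OF assms(1)] by metis
  then show ?thesis
    by (intro test_functionsI[of _ K]) (use K smooth_pd[OF test_functionsD(1)[OF assms(1)] assms(2)] in auto)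
qed

lemma test_functions_eq_0: "\<phi> \<in> test_functions \<Omega> \<Longrightarrow> x \<notin> \<Omega> \<Longrightarrow> \<phi> x = 0"
  using test_functionsD(2) by blast

lemma grad_add:
  assumes "smooth f" "smooth g"
  shows "grad (\<lambda>x. f x + g x) x = grad f x + grad g x"
  by (rule gradI)
     (use has_derivative_add[OF smooth_has_derivative[OF assms(1)] smooth_has_derivative[OF assms(2)]]
      in \<open>simp add: inner_add_left\<close>)

lemma grad_diff:
  assumes "smooth f" "smooth g"
  shows "grad (\<lambda>x. f x - g x) x = grad f x - grad g x"
  by (rule gradI)
     (use has_derivative_diff[OF smooth_has_derivative[OF assms(1)] smooth_has_derivative[OF assms(2)]]
      in \<open>simp add: inner_diff_left\<close>)

lemma grad_mult:
  assumes "smooth f" "smooth g"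
  shows "grad (\<lambda>x. f x * g x) x = f x *\<^sub>R grad g x + g x *\<^sub>R grad f x"
  by (rule gradI)
     (use has_derivative_mult[OF smooth_has_derivative[OF assms(1)] smooth_has_derivative[OF assms(2)]]
      in \<open>simp add: inner_add_left algebra_simps\<close>)

lemma grad_cmult:
  assumes "smooth f"
  shows "grad (\<lambda>x. c * f x) x = c *\<^sub>R grad f x"
  by (rule gradI)
     (use has_derivative_mult_right[OF smooth_has_derivative[OF assms(1)], of c] in simp)

lemma grad_comp:
  assumes "smooth f" "(F has_real_derivative D) (at (f x))"
  shows "grad (\<lambda>x. F (f x)) x = D *\<^sub>R grad f x"
  by (rule gradI)
     (use DERIV_compose_FDERIV[OF assms(2) smooth_has_derivative[OF assms(1)]] in \<open>simp add: mult.commute\<close>)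

lemma test_functions_bounded:
  assumes "\<phi> \<in> test_functions \<Omega>"
  shows "\<exists>B. \<forall>x. \<bar>\<phi> x\<bar> \<le> B"
proof -
  obtain K where K: "compact K" "K \<subseteq> \<Omega>" "\<And>x. x \<notin> K \<Longrightarrow> \<phi> x = 0"
    using test_functionsD(2)[OF assms(1)] by metis
  have "bounded (\<phi> ` K)"
    using K test_functionsD(1)[OF assms] by (intro compact_imp_bounded compact_continuous_image smooth_continuous)
  then obtain B where "\<And>x. x \<in> K \<Longrightarrow> \<bar>\<phi> x\<bar> \<le> B" unfolding bounded_iff by auto
  then have "\<bar>\<phi> x\<bar> \<le> \<bar>B\<bar>" for x using K(3)[of x] by (cases "x \<in> K") force+
  then show ?thesis by blast
qed

lemma grad_bounded:
  assumes "\<phi> \<in> test_functions \<Omega>"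
  shows "\<exists>B. \<forall>x. norm (grad \<phi> x) \<le> B"
proof -
  have "\<forall>b\<in>Basis. \<exists>B. \<forall>x. \<bar>grad \<phi> x \<bullet> b\<bar> \<le> B"
    using test_functions_bounded[OF test_functions_pd[OF assms]] by blast
  then obtain B where B: "\<And>b x. b \<in> Basis \<Longrightarrow> \<bar>grad \<phi> x \<bullet> b\<bar> \<le> B b" by metis
  have "norm (grad \<phi> x) \<le> sum B Basis" for x
    using norm_le_l1[of "grad \<phi> x"] sum_mono[of Basis "\<lambda>b. \<bar>grad \<phi> x \<bullet> b\<bar>" B] B by fastforce
  then show ?thesis by blast
qed

section \<open>Integrals of test functions, difference quotients and integration by parts\<close>

lemma integrable_compact_support:
  fixes f :: "'a::euclidean_space \<Rightarrow> 'b::{banach, second_countable_topology}"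
  assumes "continuous_on UNIV f" "compact K" "\<And>x. x \<notin> K \<Longrightarrow> f x = 0"
  shows "integrable lborel f"
proof -
  have "integrable lborel (\<lambda>x. indicator K x *\<^sub>R f x)"
    by (rule borel_integrable_compact[OF assms(2) continuous_on_subset[OF assms(1)]]) simp
  also have "(\<lambda>x. indicator K x *\<^sub>R f x) = f"
    using assms(3) by (force simp: indicator_def)
  finally show ?thesis .
qed

text \<open>The definitions integrate over \<open>lebesgue_on \<Omega>\<close>, while translation
  invariance and Fubini are used for \<open>lborel\<close> on the whole space. Functions extended by
  zero pass from one to the other.\<close>

lemma lebesgue_on_eq_lborel:
  fixes f :: "'a::euclidean_space \<Rightarrow> 'b::{banach, second_countable_topology}"
  assumes "open \<Omega>" "f \<in> borel_measurable borel" "\<And>x. x \<notin> \<Omega> \<Longrightarrow> f x = 0"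
  shows "integrable (lebesgue_on \<Omega>) f \<longleftrightarrow> integrable lborel f"
    and "integral\<^sup>L (lebesgue_on \<Omega>) f = integral\<^sup>L lborel f"
proof -
  have \<Omega>: "\<Omega> \<inter> space lebesgue \<in> sets lebesgue" using assms(1) by auto
  have *: "(\<lambda>x. indicator \<Omega> x *\<^sub>R f x) = f" using assms(3) by (force simp: indicator_def)
  show "integrable (lebesgue_on \<Omega>) f \<longleftrightarrow> integrable lborel f"
    unfolding integrable_restrict_space[OF \<Omega>] * using assms(2) by (simp add: integrable_completion)
  show "integral\<^sup>L (lebesgue_on \<Omega>) f = integral\<^sup>L lborel f"
    unfolding integral_restrict_space[OF \<Omega>] * using assms(2) by (simp add: integral_completion)
qed

lemma continuous_lebesgue_on_measurable:
  fixes f :: "'a::euclidean_space \<Rightarrow> 'b::euclidean_space"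
  assumes "open \<Omega>" "continuous_on UNIV f"
  shows "f \<in> borel_measurable (lebesgue_on \<Omega>)"
  using assms by (intro continuous_imp_measurable_on_sets_lebesgue) (auto intro: continuous_on_subset)

lemma integrable_test:
  assumes "\<phi> \<in> test_functions \<Omega>"
  shows "integrable lborel \<phi>"
  using test_functionsD[OF assms] integrable_compact_support[OF smooth_continuous] by blast

lemma test_functions_lipschitz:
  assumes "smooth \<phi>" "\<And>x. norm (grad \<phi> x) \<le> B"
  shows "\<bar>\<phi> y - \<phi> x\<bar> \<le> B * norm (y - x)"
proof -
  have "norm (\<phi> y - \<phi> x) \<le> B * norm (y - x)"
  proof (rule differentiable_bound[of UNIV \<phi> "\<lambda>x h. grad \<phi> x \<bullet> h"])
    show "(\<phi> has_derivative (\<lambda>h. grad \<phi> x \<bullet> h)) (at x within UNIV)" for x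
      using smooth_has_derivative[OF assms(1)] by simp
    show "onorm (\<lambda>h. grad \<phi> x \<bullet> h) \<le> B" for x
    proof (rule onorm_le)
      fix h
      have "norm (grad \<phi> x \<bullet> h) \<le> norm (grad \<phi> x) * norm h" by (simp add: Cauchy_Schwarz_ineq2)
      also have "\<dots> \<le> B * norm h" by (rule mult_right_mono[OF assms(2)]) simp
      finally show "norm (grad \<phi> x \<bullet> h) \<le> B * norm h" .
    qed
  qed auto
  then show ?thesis by simp
qed

text \<open>The two ingredients of dominated convergence for difference quotients. The height of the
  majorant is the Lipschitz bound from the bounded gradient; its support is \<open>K\<close> widened
  by the ball of radius \<open>norm h\<close>, which contains every step.\<close>

lemma difference_quotient_dominated:
  assumes "\<phi> \<in> test_functions \<Omega>"
  shows "\<exists>B K. compact K \<and> B \<ge> 0 \<and>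
    (\<forall>m x. \<bar>(\<phi> (x + h /\<^sub>R real (Suc m)) - \<phi> x) * real (Suc m)\<bar> \<le> B * indicator K x)"
    and "(\<lambda>m. (\<phi> (x + h /\<^sub>R real (Suc m)) - \<phi> x) * real (Suc m)) \<longlonglongrightarrow> grad \<phi> x \<bullet> h"
proof -
  let ?q = "\<lambda>m x. (\<phi> (x + h /\<^sub>R real (Suc m)) - \<phi> x) * real (Suc m)"
  obtain K where K: "compact K" "K \<subseteq> \<Omega>" "\<And>x. x \<notin> K \<Longrightarrow> \<phi> x = 0"
    using test_functionsD(2)[OF assms(1)] by metis
  obtain B where B: "\<And>x. norm (grad \<phi> x) \<le> B" using grad_bounded[OF assms] by blast
  define L where "L = {x - y |x y. x \<in> K \<and> y \<in> cball 0 (norm h)}"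
  have L: "compact L" unfolding L_def by (intro compact_differences K compact_cball)
  have "\<bar>?q m x\<bar> \<le> (B * norm h) * indicator L x" for m x
  proof (cases "x \<in> L")
    case True
    have "\<bar>\<phi> (x + h /\<^sub>R real (Suc m)) - \<phi> x\<bar> \<le> B * norm (h /\<^sub>R real (Suc m))"
      using test_functions_lipschitz[OF test_functionsD(1)[OF assms] B, of "x + h /\<^sub>R real (Suc m)" x] by simp
    then have "\<bar>\<phi> (x + h /\<^sub>R real (Suc m)) - \<phi> x\<bar> * real (Suc m) \<le> B * norm (h /\<^sub>R real (Suc m)) * real (Suc m)"
      by (rule mult_right_mono) simp
    also have "\<dots> = B * norm h" by (simp add: field_simps)
    finally show ?thesis using True by (simp add: abs_mult)
  next
    case False
    have "x \<notin> K" using False by (auto simp: L_def intro!: exI[of _ x] exI[of _ 0])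
    moreover have "x + h /\<^sub>R real (Suc m) \<notin> K"
    proof
      assume "x + h /\<^sub>R real (Suc m) \<in> K"
      moreover have "norm (h /\<^sub>R real (Suc m)) \<le> norm h"
      proof -
        have "inverse (real (Suc m)) * norm h \<le> 1 * norm h"
          by (rule mult_right_mono) (simp_all add: inverse_le_1_iff)
        then show ?thesis by simp
      qed
      ultimately have "x \<in> L" unfolding L_def
        by (intro CollectI exI[of _ "x + h /\<^sub>R real (Suc m)"] exI[of _ "h /\<^sub>R real (Suc m)"]) auto
      with False show False by simp
    qed
    ultimately show ?thesis using K(3) False by simp
  qed
  moreover have "B * norm h \<ge> 0" using order_trans[OF norm_ge_zero B] by simp
  ultimately show "\<exists>B K. compact K \<and> B \<ge> 0 \<and>
    (\<forall>m x. \<bar>?q m x\<bar> \<le> B * indicator K x)"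
    using L by blast
  show "(\<lambda>m::nat. ?q m x) \<longlonglongrightarrow> grad \<phi> x \<bullet> h"
  proof -
    have "((\<lambda>t. \<phi> (x + t *\<^sub>R h)) has_derivative (\<lambda>t. grad \<phi> x \<bullet> (t *\<^sub>R h))) (at 0)"
    proof (rule has_derivative_compose[where f="\<lambda>t. x + t *\<^sub>R h" and g=\<phi> and g'="\<lambda>h. grad \<phi> x \<bullet> h"])
      show "((\<lambda>t. x + t *\<^sub>R h) has_derivative (\<lambda>t. t *\<^sub>R h)) (at 0)"
        by (auto intro!: derivative_eq_intros)
      show "(\<phi> has_derivative (\<bullet>) (grad \<phi> x)) (at (x + 0 *\<^sub>R h))"
        using smooth_has_derivative[OF test_functionsD(1)[OF assms]] by simp
    qed
    also have "(\<lambda>t. grad \<phi> x \<bullet> (t *\<^sub>R h)) = (*) (grad \<phi> x \<bullet> h)"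
      by (simp add: fun_eq_iff)
    finally have "((\<lambda>t. \<phi> (x + t *\<^sub>R h)) has_real_derivative (grad \<phi> x \<bullet> h)) (at 0)"
      unfolding has_field_derivative_def .
    then have *: "((\<lambda>t. (\<phi> (x + t *\<^sub>R h) - \<phi> x) / t) \<longlongrightarrow> grad \<phi> x \<bullet> h) (at 0)"
      by (simp add: DERIV_def)
    have "filterlim (\<lambda>m::nat. inverse (real (Suc m))) (at 0) sequentially"
      unfolding filterlim_at using LIMSEQ_inverse_real_of_nat by auto
    from filterlim_compose[OF * this] show ?thesis by (simp add: divide_inverse)
  qed
qed

lemma lborel_integral_translate:
  fixes f :: "'a::euclidean_space \<Rightarrow> 'b::{banach, second_countable_topology}"
  assumes "f \<in> borel_measurable borel"
  shows "integral\<^sup>L lborel (\<lambda>x. f (x + c)) = integral\<^sup>L lborel f"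
    and "integrable lborel f \<Longrightarrow> integrable lborel (\<lambda>x. f (x + c))"
proof -
  have "integral\<^sup>L (distr lborel borel ((+) c)) f = integral\<^sup>L lborel (\<lambda>x. f (c + x))"
    by (rule integral_distr) (use assms in auto)
  then show "integral\<^sup>L lborel (\<lambda>x. f (x + c)) = integral\<^sup>L lborel f"
    by (simp add: lborel_distr_plus add.commute)
  assume "integrable lborel f"
  then have "integrable (distr lborel borel ((+) c)) f" by (simp add: lborel_distr_plus)
  then show "integrable lborel (\<lambda>x. f (x + c))"
    using assms by (subst (asm) integrable_distr_eq) (auto simp: add.commute)
qed

text \<open>Each difference quotient has integral 0 by translation invariance, and dominated
  convergence hands this on to the derivative.\<close>

lemma integral_pd_test:
  assumes "\<phi> \<in> test_functions \<Omega>"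
  shows "(\<integral>x. grad \<phi> x \<bullet> h \<partial>lborel) = 0"
proof -
  let ?q = "\<lambda>m x. (\<phi> (x + h /\<^sub>R real (Suc m)) - \<phi> x) * real (Suc m)"
  obtain B K where BK: "compact K" "B \<ge> 0"
    "\<And>m x. \<bar>?q m x\<bar> \<le> B * indicator K x"
    using difference_quotient_dominated(1)[OF assms, of h] by blast
  have sm: "smooth \<phi>" by (rule test_functionsD(1)[OF assms])
  have m: "\<phi> \<in> borel_measurable borel"
    by (rule borel_measurable_continuous_onI[OF smooth_continuous[OF sm]])
  have "(\<lambda>m::nat. \<integral>x. ?q m x \<partial>lborel)
      \<longlonglongrightarrow> (\<integral>x. grad \<phi> x \<bullet> h \<partial>lborel)"
  proof (rule integral_dominated_convergence)
    show "(\<lambda>x. grad \<phi> x \<bullet> h) \<in> borel_measurable lborel"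
      by (simp add: borel_measurable_inner borel_measurable_continuous_onI[OF continuous_grad[OF sm]])
    show "(\<lambda>x. ?q m x) \<in> borel_measurable lborel" for m
      using m by measurable
    show "integrable lborel (\<lambda>x. B * indicator K x)"
      using borel_integrable_compact[OF BK(1), of "\<lambda>x. 1::real"] by simp
    show "AE x in lborel. norm (?q m x) \<le> B * indicator K x" for m
      using BK(3) by simp
  qed (use difference_quotient_dominated(2)[OF assms] in simp)
  moreover have "(\<integral>x. ?q m x \<partial>lborel) = 0" for m :: nat
    using lborel_integral_translate[OF m] integrable_test[OF assms] by simp
  ultimately show ?thesis by (simp add: LIMSEQ_const_iff)
qed

text \<open>The product of \<open>\<phi>\<close> with any smooth \<open>w\<close>, even a growing
  one, is a test function, so \<open>integral_pd_test\<close> applies to it. In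
  \<open>poincare\<close> the factor \<open>w\<close> is a coordinate.\<close>

lemma integration_by_parts:
  assumes "\<phi> \<in> test_functions \<Omega>" "smooth w"
  shows "(\<integral>x. w x * (grad \<phi> x \<bullet> h) \<partial>lborel) = - (\<integral>x. (grad w x \<bullet> h) * \<phi> x \<partial>lborel)"
proof -
  obtain K where K: "compact K" "\<And>x. x \<notin> K \<Longrightarrow> \<phi> x = 0" and K': "\<And>x. x \<notin> K \<Longrightarrow> grad \<phi> x = 0"
    using test_functions_support[OF assms(1)] by metis
  have sm: "smooth \<phi>" by (rule test_functionsD[OF assms(1)])
  have i: "integrable lborel (\<lambda>x. w x * (grad \<phi> x \<bullet> h))" "integrable lborel (\<lambda>x. (grad w x \<bullet> h) * \<phi> x)"
    by (rule integrable_compact_support[OF _ K(1)];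
        use K K' smooth_continuous[OF sm] smooth_continuous[OF assms(2)] continuous_grad[OF sm]
          continuous_grad[OF assms(2)] in \<open>auto intro!: continuous_intros\<close>)+
  have "(\<integral>x. grad (\<lambda>x. \<phi> x * w x) x \<bullet> h \<partial>lborel) = 0"
    by (rule integral_pd_test[OF test_functions_mult[OF assms]])
  also have "(\<lambda>x. grad (\<lambda>x. \<phi> x * w x) x \<bullet> h) = (\<lambda>x. w x * (grad \<phi> x \<bullet> h) + (grad w x \<bullet> h) * \<phi> x)"
    by (auto simp: grad_mult[OF sm assms(2)] inner_add_left)
  finally show ?thesis using i by simp
qed

subsection \<open>The fundamental lemma of the calculus of variations\<close>

text \<open>Each coordinate contributes two factors \<open>exp (- 1 / t)\<close>, one for each face,
  with \<open>t\<close> the distance to that face scaled by \<open>n + 1\<close>. Scaling lets every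
  factor rise to 1 inside the box while it stays 0 outside. Strict positivity inside serves
  \<open>exists_nonzero_test\<close>.\<close>

lemma box_test_approx:
  fixes a b :: "'a::euclidean_space"
  obtains \<phi> :: "nat \<Rightarrow> 'a \<Rightarrow> real" where
    "\<And>n. smooth (\<phi> n)" "\<And>n x. 0 \<le> \<phi> n x \<and> \<phi> n x \<le> 1" "\<And>n x. x \<notin> box a b \<Longrightarrow> \<phi> n x = 0"
    "\<And>n x. x \<in> box a b \<Longrightarrow> \<phi> n x > 0"
    "\<And>x. (\<lambda>n. \<phi> n x) \<longlonglongrightarrow> indicator (box a b) x"
proof
  define \<phi> :: "nat \<Rightarrow> 'a \<Rightarrow> real" where "\<phi> n x = (\<Prod>i\<in>Basis.
      flat 1 ((x \<bullet> i - a \<bullet> i) * real (Suc n)) * flat 1 ((b \<bullet> i - x \<bullet> i) * real (Suc n)))" for n x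
  have f: "0 \<le> flat 1 t" "flat 1 t \<le> 1" "t \<le> 0 \<Longrightarrow> flat 1 t = 0" for t
    by (auto simp: flat_def)
  show "smooth (\<phi> n)" for n unfolding \<phi>_def
    by (intro smooth_prod smooth_mult smooth_flat smooth_diff smooth_inner smooth_const) simp
  show "0 \<le> \<phi> n x \<and> \<phi> n x \<le> 1" for n x
    unfolding \<phi>_def by (auto intro!: prod_nonneg prod_le_1 mult_le_one f mult_nonneg_nonneg)
  show z: "\<phi> n x = 0" if "x \<notin> box a b" for n x
  proof -
    obtain i where i: "i \<in> Basis" "x \<bullet> i \<le> a \<bullet> i \<or> b \<bullet> i \<le> x \<bullet> i"
      using \<open>x \<notin> box a b\<close> by (force simp: mem_box)
    then have "flat 1 ((x \<bullet> i - a \<bullet> i) * real (Suc n)) * flat 1 ((b \<bullet> i - x \<bullet> i) * real (Suc n)) = 0"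
      by (auto simp: f(3) mult_nonpos_nonneg)
    with i show ?thesis unfolding \<phi>_def by (intro prod_zero) auto
  qed
  have p: "flat 1 t > 0" if "t > 0" for t using that by (simp add: flat_def)
  show "\<phi> n x > 0" if "x \<in> box a b" for n x
    unfolding \<phi>_def using that by (intro prod_pos mult_pos_pos p) (auto simp: mem_box)
  have l: "(\<lambda>n. flat 1 (t * real (Suc n))) \<longlonglongrightarrow> 1" if "t > 0" for t
  proof -
    have "(\<lambda>n. exp (- (inverse t * inverse (real (Suc n))))) \<longlonglongrightarrow> exp (- (inverse t * 0))"
      by (intro tendsto_intros LIMSEQ_inverse_real_of_nat)
    moreover have "exp (- (inverse t * inverse (real (Suc n)))) = flat 1 (t * real (Suc n))" for n
      using that by (simp add: flat_def divide_inverse)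
    ultimately show ?thesis by simp
  qed
  show "(\<lambda>n. \<phi> n x) \<longlonglongrightarrow> indicator (box a b) x" for x
  proof (cases "x \<in> box a b")
    case True
    have "(\<lambda>n. \<phi> n x) \<longlonglongrightarrow> (\<Prod>i\<in>(Basis::'a set). 1 * 1)"
      unfolding \<phi>_def by (intro tendsto_intros l) (use True in \<open>auto simp: mem_box\<close>)
    then show ?thesis using True by simp
  qed (use z in simp)
qed

text \<open>Inside a closed box contained in \<Omega>, test functions converging boundedly to
  indicators of boxes show that \<open>g\<close> has integral 0 over all smaller boxes. Boxes
  generate the Borel sets, so the same holds for every Borel set, in particular for the sets where
  the function is positive or negative, which must then be null. Countably many boxes cover
  \<Omega>.\<close>

lemma fundamental_lemma:
  fixes g :: "'a::euclidean_space \<Rightarrow> real"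
  assumes "open \<Omega>" and li: "locally_integrable \<Omega> g"
    and orth: "\<And>\<phi>. \<phi> \<in> test_functions \<Omega> \<Longrightarrow> (\<integral>x. g x * \<phi> x \<partial>lebesgue_on \<Omega>) = 0"
  shows "AE x in lebesgue_on \<Omega>. g x = 0"
proof -
  have \<Omega>: "\<Omega> \<inter> space lebesgue \<in> sets lebesgue" using assms(1) by auto
  have loc: "AE x in lborel. x \<in> box c d \<longrightarrow> g x = 0" if cd: "cbox c d \<subseteq> \<Omega>" for c d
  proof -
    define k where "k x = indicator (box c d) x *\<^sub>R g x" for x
    have intC: "integrable lebesgue (\<lambda>x. indicator (cbox c d) x *\<^sub>R g x)"
      using li cd unfolding locally_integrable_def
      by (subst integrable_restrict_space[symmetric]) auto
    have intk: "integrable lebesgue k"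
    proof -
      have "k = (\<lambda>x. indicator (box c d) x *\<^sub>R (indicator (cbox c d) x *\<^sub>R g x))"
        using box_subset_cbox[of c d] by (auto simp: k_def indicator_def fun_eq_iff)
      then show ?thesis using integrable_mult_indicator[OF _ intC, of "box c d"] by auto
    qed
    have box0: "(\<integral>x. indicator (box a b) x * k x \<partial>lebesgue) = 0" for a b
    proof -
      obtain a' b' where ab: "box a b \<inter> box c d = box a' b'" using box_Int_box by blast
      obtain \<phi> :: "nat \<Rightarrow> 'a \<Rightarrow> real" where \<phi>:
        "\<And>n. smooth (\<phi> n)" "\<And>n x. 0 \<le> \<phi> n x \<and> \<phi> n x \<le> 1" "\<And>n x. x \<notin> box a' b' \<Longrightarrow> \<phi> n x = 0"
        "\<And>n x. x \<in> box a' b' \<Longrightarrow> \<phi> n x > 0"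
        "\<And>x. (\<lambda>n. \<phi> n x) \<longlonglongrightarrow> indicator (box a' b') x"
        by (rule box_test_approx[of a' b']) blast
      have sub: "box a' b' \<subseteq> box c d" using ab by auto
      have \<phi>t: "\<phi> n \<in> test_functions \<Omega>" for n
        by (rule test_functionsI[of _ "cbox c d"]) (use \<phi>(1) \<phi>(3)[of _ n] cd sub box_subset_cbox[of c d] in \<open>auto simp: subset_eq\<close>)
      have eq: "\<phi> n x * k x = indicator \<Omega> x *\<^sub>R (g x * \<phi> n x)" for n x
        using \<phi>(3)[of x n] sub cd box_subset_cbox[of c d] unfolding k_def indicator_def by auto
      have "(\<integral>x. \<phi> n x * k x \<partial>lebesgue) = 0" for n
        unfolding eq using orth[OF \<phi>t] by (subst integral_restrict_space[OF \<Omega>, symmetric])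
      moreover have "(\<lambda>n. \<integral>x. \<phi> n x * k x \<partial>lebesgue) \<longlonglongrightarrow> (\<integral>x. indicator (box a' b') x * k x \<partial>lebesgue)"
      proof (rule integral_dominated_convergence)
        show "(\<lambda>x. indicator (box a' b') x * k x) \<in> borel_measurable lebesgue"
          using integrable_mult_indicator[OF _ intk, of "box a' b'"] by auto
        have "\<phi> n \<in> borel_measurable lebesgue" for n
          using borel_measurable_continuous_onI[OF smooth_continuous[OF \<phi>(1)]]
          by (intro measurable_completion) simp
        then show "(\<lambda>x. \<phi> n x * k x) \<in> borel_measurable lebesgue" for n
          using intk by auto
        show "integrable lebesgue (\<lambda>x. norm (k x))" using intk by auto
        show "AE x in lebesgue. (\<lambda>n. \<phi> n x * k x) \<longlonglongrightarrow> indicator (box a' b') x * k x"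
          by (auto intro!: tendsto_intros \<phi>)
        show "AE x in lebesgue. norm (\<phi> n x * k x) \<le> norm (k x)" for n
          using \<phi>(2) by (auto simp: abs_mult intro!: mult_left_le_one_le)
      qed
      ultimately have "(\<integral>x. indicator (box a' b') x * k x \<partial>lebesgue) = 0"
        by (simp add: LIMSEQ_const_iff)
      also have "(\<lambda>x. indicator (box a' b') x * k x) = (\<lambda>x. indicator (box a b) x * k x)"
        unfolding ab[symmetric] k_def by (auto simp: indicator_def)
      finally show ?thesis .
    qed
    \<comment> \<open>\<open>k\<close> is only Lebesgue measurable, while the induction that starts
      from boxes reaches Borel sets only.\<close>
    obtain k' where k': "k' \<in> borel_measurable lborel" "AE x in lborel. k x = k' x"
      using completion_ex_borel_measurable_real[of k lborel] intk by auto
    have AEk: "AE x in lebesgue. k x = k' x" using k'(2) by (rule AE_completion)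
    have intk': "integrable lborel k'"
    proof -
      have "integrable lebesgue k'"
        by (rule integrable_cong_AE_imp[OF intk measurable_completion[OF k'(1)] AEk])
      then show ?thesis using k'(1) by (simp add: integrable_completion)
    qed
    have eq: "(\<integral>x. indicator A x * k x \<partial>lebesgue) = (LINT x:A|lborel. k' x)" if "A \<in> sets borel" for A
    proof -
      have "(\<integral>x. indicator A x * k x \<partial>lebesgue) = (\<integral>x. indicator A x * k' x \<partial>lebesgue)"
      proof (rule integral_cong_AE)
        have "(indicator A :: 'a \<Rightarrow> real) \<in> borel_measurable lebesgue"
          using that by (intro borel_measurable_indicator) auto
        then show "(\<lambda>x. indicator A x * k x) \<in> borel_measurable lebesgue"
          "(\<lambda>x. indicator A x * k' x) \<in> borel_measurable lebesgue"
          using borel_measurable_integrable[OF intk] measurable_completion[OF k'(1)] by auto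
      qed (use AEk in auto)
      also have "\<dots> = (\<integral>x. indicator A x * k' x \<partial>lborel)"
        using that k' by (intro integral_completion) auto
      finally show ?thesis by (simp add: set_lebesgue_integral_def)
    qed
    have si: "set_integrable lborel A k'" if "A \<in> sets borel" for A
      using integrable_mult_indicator[OF _ intk'] that by (simp add: set_integrable_def)
    \<comment> \<open>The vanishing total integral is what the complement case of the set induction
      needs.\<close>
    have tot: "(LINT x:UNIV|lborel. k' x) = 0"
    proof -
      have "(\<integral>x. indicator UNIV x * k x \<partial>lebesgue) = (\<integral>x. indicator (box c d) x * k x \<partial>lebesgue)"
        by (rule Bochner_Integration.integral_cong) (auto simp: k_def indicator_def)
      then show ?thesis unfolding box0 by (subst (asm) eq) simp_all
    qed
    have zero: "(LINT x:A|lborel. k' x) = 0" if A: "A \<in> sets borel" for A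
    proof -
      let ?G = "range (\<lambda>(a, b). box a b :: 'a set)"
      have gen: "sets borel = sigma_sets UNIV ?G" unfolding borel_eq_box by (rule sets_measure_of) auto
      have "Int_stable ?G"
      proof (rule Int_stableI)
        fix X Y assume "X \<in> ?G" "Y \<in> ?G"
        then obtain a b c d where "X = box a b" "Y = box c d" by auto
        moreover have "box u v \<in> ?G" for u v by (rule image_eqI[of _ _ "(u, v)"]) auto
        ultimately show "X \<inter> Y \<in> ?G" by (simp only: box_Int_box)
      qed
      moreover have "?G \<subseteq> Pow UNIV" by auto
      moreover have "A \<in> sigma_sets UNIV ?G" using A gen by simp
      ultimately show ?thesis
      proof (induction rule: sigma_sets_induct_disjoint)
        case (basic A)
        then obtain a b where A: "A = box a b" by auto
        show ?case unfolding A by (subst eq[symmetric]) (auto simp: box0)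
      next
        case empty
        show ?case by (simp add: set_lebesgue_integral_def)
      next
        case (compl A)
        have "A \<in> sets borel" unfolding gen by (rule compl(1))
        moreover from this have "UNIV - A \<in> sets borel" by (metis sets.compl_sets space_borel)
        ultimately have "(LINT x:A \<union> (UNIV - A)|lborel. k' x) = (LINT x:A|lborel. k' x) + (LINT x:UNIV - A|lborel. k' x)"
          by (intro set_integral_Un si) auto
        moreover have "A \<union> (UNIV - A) = UNIV" by auto
        ultimately have "(LINT x:UNIV|lborel. k' x) = (LINT x:A|lborel. k' x) + (LINT x:UNIV - A|lborel. k' x)" by metis
        then show ?case unfolding compl(2) tot by linarith
      next
        case (union A)
        have "A i \<in> sets borel" for i unfolding gen using union(2) by (rule range_subsetD)
        then have "(LINT x:(\<Union>i. A i)|lborel. k' x) = (\<Sum>i. (LINT x:(A i)|lborel. k' x))"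
          using union(1) by (intro lebesgue_integral_countable_add si) (auto simp: disjoint_family_on_def)
        then show ?case by (simp only: union(3) suminf_zero)
      qed
    qed
    \<comment> \<open>The function \<open>s * k'\<close> has integral 0 over the very set where it
      is positive, so this set is null. The values 1 and -1 of \<open>s\<close> treat the two
      signs.\<close>
    have sgn: "AE x in lborel. \<not> s * k' x > 0" for s :: real
    proof -
      let ?A = "{x. s * k' x > 0}"
      have A: "?A \<in> sets borel" using k'(1) by measurable
      have "(\<integral>x. indicator ?A x * (s * k' x) \<partial>lborel) = s * (LINT x:?A|lborel. k' x)"
      proof -
        have "(\<lambda>x. indicator ?A x * (s * k' x)) = (\<lambda>x. s * (indicator ?A x *\<^sub>R k' x))"
          by (simp add: fun_eq_iff mult.left_commute)
        then show ?thesis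
          by (simp only: set_lebesgue_integral_def Bochner_Integration.integral_mult_right_zero)
      qed
      then have "(\<integral>x. indicator ?A x * (s * k' x) \<partial>lborel) = 0" using zero[OF A] by simp
      moreover have "integrable lborel (\<lambda>x. indicator ?A x * (s * k' x))"
        using integrable_mult_right[OF si[OF A, unfolded set_integrable_def], of s] by (simp add: mult.left_commute)
      ultimately have "AE x in lborel. indicator ?A x * (s * k' x) = 0"
        by (subst integral_nonneg_eq_0_iff_AE[symmetric]) (auto simp: indicator_def)
      then show ?thesis by eventually_elim (auto simp: indicator_def split: if_splits)
    qed
    show ?thesis using sgn[of 1] sgn[of "-1"] k'(2)
      by eventually_elim (auto simp: k_def indicator_def)
  qed
  obtain \<D> where \<D>: "countable \<D>" "\<D> \<subseteq> Pow \<Omega>" "\<And>X. X \<in> \<D> \<Longrightarrow> \<exists>a b. X = cbox a b" "\<Union>\<D> = \<Omega>"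
    by (rule open_countable_Union_open_cbox[OF assms(1)]) blast
  have "AE x in lebesgue. x \<in> X \<longrightarrow> g x = 0" if X: "X \<in> \<D>" for X
  proof -
    obtain a b where ab: "X = cbox a b" "cbox a b \<subseteq> \<Omega>" using \<D> X by blast
    \<comment> \<open>\<open>loc\<close> controls open boxes but the cover consists of closed ones;
      the faces form a null set.\<close>
    have "cbox a b - box a b \<in> null_sets lebesgue"
      using negligible_frontier_interval[of a b] by (simp add: negligible_iff_null_sets)
    from AE_not_in[OF this] AE_completion[OF loc[OF ab(2)]] show ?thesis
      by eventually_elim (auto simp: ab)
  qed
  then have "AE x in lebesgue. \<forall>X\<in>\<D>. x \<in> X \<longrightarrow> g x = 0"
    by (subst AE_ball_countable[OF \<D>(1)]) blast
  then have "AE x in lebesgue. x \<in> \<Omega> \<longrightarrow> g x = 0"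
    by eventually_elim (use \<D>(4) in auto)
  then show ?thesis using \<Omega> by (simp add: AE_restrict_space_iff)
qed

lemma locally_integrable_mult_test:
  fixes f :: "'a::euclidean_space \<Rightarrow> real"
  assumes "open \<Omega>" "locally_integrable \<Omega> f" and \<phi>: "\<phi> \<in> test_functions \<Omega>"
  shows "integrable (lebesgue_on \<Omega>) (\<lambda>x. f x * \<phi> x)"
proof -
  obtain K where K: "compact K" "K \<subseteq> \<Omega>" "\<And>x. x \<notin> K \<Longrightarrow> \<phi> x = 0"
    using test_functionsD(2)[OF \<phi>] by metis
  obtain B where B: "\<And>x. \<bar>\<phi> x\<bar> \<le> B" using test_functions_bounded[OF \<phi>] by blast
  have "integrable (lebesgue_on K) f"
    using assms K unfolding locally_integrable_def by auto
  then have *: "integrable lebesgue (\<lambda>x. indicator K x *\<^sub>R f x)"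
    using lmeasurable_compact[OF K(1)] by (subst (asm) integrable_restrict_space) auto
  then have "integrable lebesgue (\<lambda>x. \<phi> x *\<^sub>R (indicator K x *\<^sub>R f x))"
  proof (rule Bochner_Integration.integrable_bound[OF integrable_mult_right[where c=B]])
    show "(\<lambda>x. \<phi> x *\<^sub>R (indicator K x *\<^sub>R f x)) \<in> borel_measurable lebesgue"
      using borel_measurable_continuous_onI[OF smooth_continuous[OF test_functionsD(1)[OF \<phi>]]]
      by (intro borel_measurable_scaleR[of \<phi>] borel_measurable_integrable[OF *] measurable_completion) simp
    show "AE x in lebesgue. norm (\<phi> x *\<^sub>R (indicator K x *\<^sub>R f x)) \<le> norm (B * (indicator K x *\<^sub>R f x))"
      by (rule AE_I2) (use B in \<open>auto simp: abs_mult intro!: mult_right_mono intro: order_trans[OF B]\<close>)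
  qed
  also have "(\<lambda>x. \<phi> x *\<^sub>R (indicator K x *\<^sub>R f x)) = (\<lambda>x. indicator \<Omega> x *\<^sub>R (f x * \<phi> x))"
    using K by (force simp: indicator_def)
  finally show ?thesis using assms(1) by (subst integrable_restrict_space) auto
qed

text \<open>Each component of \<open>G - G'\<close> is orthogonal to all test functions. Through
  this, whatever is known of one weak gradient, such as the classical one of a test function,
  carries over to the chosen \<open>weak_gradient\<close>.\<close>

lemma has_weak_gradient_unique:
  assumes "open \<Omega>" "has_weak_gradient \<Omega> u G" "has_weak_gradient \<Omega> u G'"
  shows "AE x in lebesgue_on \<Omega>. G x = G' x"
proof -
  have int: "integrable (lebesgue_on \<Omega>) (\<lambda>x. (G x \<bullet> b) * \<phi> x)"
    if "has_weak_gradient \<Omega> u G" "\<phi> \<in> test_functions \<Omega>" for \<phi> b and G :: "'a \<Rightarrow> 'a"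
    by (rule locally_integrable_mult_test[OF assms(1) _ that(2)])
       (use that(1) in \<open>auto simp: has_weak_gradient_def locally_integrable_def\<close>)
  have wgD: "\<forall>\<phi>\<in>test_functions \<Omega>. \<forall>b\<in>Basis.
        (\<integral>x. u x * frechet_derivative \<phi> (at x) b \<partial>lebesgue_on \<Omega>) =
        - (\<integral>x. (G x \<bullet> b) * \<phi> x \<partial>lebesgue_on \<Omega>)" if "has_weak_gradient \<Omega> u G" for G
    using that by (simp add: has_weak_gradient_def)
  have "AE x in lebesgue_on \<Omega>. (G x - G' x) \<bullet> b = 0" if b: "b \<in> Basis" for b
  proof (rule fundamental_lemma[OF assms(1)])
    show "locally_integrable \<Omega> (\<lambda>x. (G x - G' x) \<bullet> b)"
      using assms(2,3) unfolding has_weak_gradient_def locally_integrable_def by auto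
    show "(\<integral>x. (G x - G' x) \<bullet> b * \<phi> x \<partial>lebesgue_on \<Omega>) = 0" if "\<phi> \<in> test_functions \<Omega>" for \<phi>
    proof -
      have "(\<integral>x. (G x \<bullet> b) * \<phi> x \<partial>lebesgue_on \<Omega>) = (\<integral>x. (G' x \<bullet> b) * \<phi> x \<partial>lebesgue_on \<Omega>)"
        using bspec[OF bspec[OF wgD[OF assms(2)] that] b] bspec[OF bspec[OF wgD[OF assms(3)] that] b]
        by simp
      then show ?thesis using int[OF assms(2) that, of b] int[OF assms(3) that, of b]
        by (simp add: inner_diff_left left_diff_distrib)
    qed
  qed
  then have "AE x in lebesgue_on \<Omega>. \<forall>b\<in>Basis. (G x - G' x) \<bullet> b = 0"
    by (subst AE_finite_all) auto
  then show ?thesis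
    by eventually_elim (simp add: euclidean_all_zero_iff)
qed

subsection \<open>Estimates for test functions\<close>

lemma test_continuous:
  assumes "\<phi> \<in> test_functions \<Omega>"
  shows "continuous_on A \<phi>" "continuous_on A (grad \<phi>)"
  using assms smooth_continuous continuous_grad test_functionsD(1) by blast+

lemma test_measurable:
  assumes "\<phi> \<in> test_functions \<Omega>"
  shows "\<phi> \<in> borel_measurable borel" "grad \<phi> \<in> borel_measurable borel"
  using test_continuous[OF assms] borel_measurable_continuous_onI by blast+

lemma grad_eq_0: "\<phi> \<in> test_functions \<Omega> \<Longrightarrow> x \<notin> \<Omega> \<Longrightarrow> grad \<phi> x = 0"
  using test_functions_support by blast

lemma test_square_integrable:
  assumes "\<phi> \<in> test_functions \<Omega>"
  shows "integrable lborel (\<lambda>x. (\<phi> x)\<^sup>2)" "integrable lborel (\<lambda>x. (norm (grad \<phi> x))\<^sup>2)"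
proof -
  obtain K where K: "compact K" "\<And>x. x \<notin> K \<Longrightarrow> \<phi> x = 0" "\<And>x. x \<notin> K \<Longrightarrow> grad \<phi> x = 0"
    using test_functions_support[OF assms] by metis
  show "integrable lborel (\<lambda>x. (\<phi> x)\<^sup>2)"
    by (rule integrable_compact_support[OF _ K(1)])
       (use K test_continuous[OF assms] in \<open>auto intro!: continuous_intros\<close>)
  show "integrable lborel (\<lambda>x. (norm (grad \<phi> x))\<^sup>2)"
    by (rule integrable_compact_support[OF _ K(1)])
       (use K test_continuous[OF assms] in \<open>auto intro!: continuous_intros\<close>)
qed

lemma locally_integrable_continuous:
  fixes f :: "'a::euclidean_space \<Rightarrow> 'b::euclidean_space"
  assumes "continuous_on UNIV f"
  shows "locally_integrable \<Omega> f"
  unfolding locally_integrable_def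
proof (intro allI impI)
  fix K :: "'a set" assume K: "compact K \<and> K \<subseteq> \<Omega>"
  have "integrable lborel (\<lambda>x. indicator K x *\<^sub>R f x)"
    by (rule borel_integrable_compact) (use K assms continuous_on_subset in blast)+
  then have "integrable lebesgue (\<lambda>x. indicator K x *\<^sub>R f x)"
    by (subst integrable_completion) auto
  then show "integrable (lebesgue_on K) f"
    using lmeasurable_compact[of K] K by (subst integrable_restrict_space) auto
qed

lemma has_weak_gradient_test:
  assumes "open \<Omega>" "\<phi> \<in> test_functions \<Omega>"
  shows "has_weak_gradient \<Omega> \<phi> (grad \<phi>)"
  unfolding has_weak_gradient_def
proof (intro conjI ballI)
  show "locally_integrable \<Omega> \<phi>" "locally_integrable \<Omega> (grad \<phi>)"
    by (intro locally_integrable_continuous test_continuous[OF assms(2)])+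
next
  fix \<eta> b :: 'a assume "b \<in> Basis"
  fix \<eta> assume \<eta>: "\<eta> \<in> test_functions \<Omega>"
  have m: "(\<lambda>x. \<phi> x * (grad \<eta> x \<bullet> b)) \<in> borel_measurable borel" "(\<lambda>x. (grad \<phi> x \<bullet> b) * \<eta> x) \<in> borel_measurable borel"
    using test_measurable[OF assms(2)] test_measurable[OF \<eta>] by auto
  show "(\<integral>x. \<phi> x * frechet_derivative \<eta> (at x) b \<partial>lebesgue_on \<Omega>) =
        - (\<integral>x. (grad \<phi> x \<bullet> b) * \<eta> x \<partial>lebesgue_on \<Omega>)"
    unfolding frechet_derivative_eq_grad[OF test_functionsD(1)[OF \<eta>]]
    using integration_by_parts[OF \<eta> test_functionsD(1)[OF assms(2)], of b]
      lebesgue_on_eq_lborel(2)[OF assms(1) m(1)] lebesgue_on_eq_lborel(2)[OF assms(1) m(2)]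
      test_functions_eq_0[OF assms(2)] test_functions_eq_0[OF \<eta>] by simp
qed

text \<open>The common core of the Cauchy-Schwarz inequalities for integrals and for
  \<open>eigen_form\<close>. Both forms are only semidefinite, so \<open>c = 0\<close> is a genuine
  case.\<close>

lemma nonneg_quadratic_form:
  fixes a b c :: real
  assumes "\<And>s t. 0 \<le> s\<^sup>2 * a + 2 * s * t * b + t\<^sup>2 * c"
  shows "b\<^sup>2 \<le> a * c"
proof (cases "c = 0")
  case True
  show ?thesis
  proof (cases "b = 0")
    case False
    \<comment> \<open>For \<open>c = 0\<close> the form is affine in \<open>t\<close> at
      \<open>s = 1\<close>; this \<open>t\<close> would give it the value -1.\<close>
    have "0 \<le> 1\<^sup>2 * a + 2 * 1 * (- (a + 1) / (2 * b)) * b + (- (a + 1) / (2 * b))\<^sup>2 * c" by (rule assms)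
    then show ?thesis using False True by (simp add: field_simps)
  qed (simp add: True)
next
  case False
  have "0 \<le> c" using assms[of 0 1] by simp
  have "0 \<le> c\<^sup>2 * a + 2 * c * (- b) * b + (- b)\<^sup>2 * c" by (rule assms)
  also have "\<dots> = c * (a * c - b\<^sup>2)" by (simp add: power2_eq_square algebra_simps)
  finally show ?thesis using False \<open>0 \<le> c\<close> by (simp add: zero_le_mult_iff)
qed

lemma integral_Cauchy_Schwarz:
  fixes f g :: "'a \<Rightarrow> real"
  assumes [measurable]: "f \<in> borel_measurable M" "g \<in> borel_measurable M"
    and f: "integrable M (\<lambda>x. (f x)\<^sup>2)" and g: "integrable M (\<lambda>x. (g x)\<^sup>2)"
  shows "integrable M (\<lambda>x. f x * g x)"
    and "(\<integral>x. f x * g x \<partial>M)\<^sup>2 \<le> (\<integral>x. (f x)\<^sup>2 \<partial>M) * (\<integral>x. (g x)\<^sup>2 \<partial>M)"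
proof -
  show i: "integrable M (\<lambda>x. f x * g x)"
  proof (rule Bochner_Integration.integrable_bound[OF Bochner_Integration.integrable_add[OF f g]])
    show "AE x in M. norm (f x * g x) \<le> norm ((f x)\<^sup>2 + (g x)\<^sup>2)"
    proof (rule AE_I2)
      fix x
      have "2 * (\<bar>f x\<bar> * \<bar>g x\<bar>) \<le> (f x)\<^sup>2 + (g x)\<^sup>2"
        using sum_squares_bound[of "\<bar>f x\<bar>" "\<bar>g x\<bar>"] by simp
      moreover have "0 \<le> \<bar>f x\<bar> * \<bar>g x\<bar>" by simp
      ultimately have "\<bar>f x\<bar> * \<bar>g x\<bar> \<le> (f x)\<^sup>2 + (g x)\<^sup>2" by linarith
      then show "norm (f x * g x) \<le> norm ((f x)\<^sup>2 + (g x)\<^sup>2)" by (simp add: abs_mult)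
    qed
  qed simp
  show "(\<integral>x. f x * g x \<partial>M)\<^sup>2 \<le> (\<integral>x. (f x)\<^sup>2 \<partial>M) * (\<integral>x. (g x)\<^sup>2 \<partial>M)"
  proof (rule nonneg_quadratic_form)
    fix s t :: real
    have "0 \<le> (\<integral>x. (s * f x + t * g x)\<^sup>2 \<partial>M)" by simp
    also have "(\<lambda>x. (s * f x + t * g x)\<^sup>2) = (\<lambda>x. s\<^sup>2 * (f x)\<^sup>2 + 2 * s * t * (f x * g x) + t\<^sup>2 * (g x)\<^sup>2)"
      by (simp add: fun_eq_iff power2_eq_square algebra_simps)
    also have "(\<integral>x. s\<^sup>2 * (f x)\<^sup>2 + 2 * s * t * (f x * g x) + t\<^sup>2 * (g x)\<^sup>2 \<partial>M) =
        s\<^sup>2 * (\<integral>x. (f x)\<^sup>2 \<partial>M) + 2 * s * t * (\<integral>x. f x * g x \<partial>M) + t\<^sup>2 * (\<integral>x. (g x)\<^sup>2 \<partial>M)"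
      using i f g by simp
    finally show "0 \<le> s\<^sup>2 * (\<integral>x. (f x)\<^sup>2 \<partial>M) + 2 * s * t * (\<integral>x. f x * g x \<partial>M) + t\<^sup>2 * (\<integral>x. (g x)\<^sup>2 \<partial>M)" .
  qed
qed

lemma norm_diff_square_le:
  fixes a b :: "'a::real_inner"
  shows "(norm (a - b))\<^sup>2 \<le> 2 * (norm a)\<^sup>2 + 2 * (norm b)\<^sup>2"
proof -
  have "(norm (a - b))\<^sup>2 + (norm (a + b))\<^sup>2 = 2 * (norm a)\<^sup>2 + 2 * (norm b)\<^sup>2"
    by (simp add: power2_norm_eq_inner inner_diff_left inner_diff_right inner_add_left inner_add_right)
  moreover have "0 \<le> (norm (a + b))\<^sup>2" by simp
  ultimately show ?thesis by linarith
qed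

lemma integrable_norm_diff_square:
  fixes f g :: "'a \<Rightarrow> 'b::euclidean_space"
  assumes "f \<in> borel_measurable M" "g \<in> borel_measurable M"
    and "integrable M (\<lambda>x. (norm (f x))\<^sup>2)" "integrable M (\<lambda>x. (norm (g x))\<^sup>2)"
  shows "integrable M (\<lambda>x. (norm (f x - g x))\<^sup>2)"
proof (rule Bochner_Integration.integrable_bound)
  show "integrable M (\<lambda>x. 2 * (norm (f x))\<^sup>2 + 2 * (norm (g x))\<^sup>2)" using assms by simp
  show "(\<lambda>x. (norm (f x - g x))\<^sup>2) \<in> borel_measurable M" using assms by simp
  show "AE x in M. norm ((norm (f x - g x))\<^sup>2) \<le> norm (2 * (norm (f x))\<^sup>2 + 2 * (norm (g x))\<^sup>2)"
    by (rule AE_I2) (use norm_diff_square_le in simp)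
qed

section \<open>Translations and the Poincare inequality\<close>

text \<open>Split the translation by \<open>h\<close> into \<open>m + 1\<close> steps
  \<open>g = h / (m + 1)\<close>. The telescoping sum, Cauchy-Schwarz for sums and translation
  invariance bound the integral by \<open>(m + 1)\<^sup>2\<close> times the one for a single step.
  That is the squared norm of a difference quotient, which tends to the squared norm of the
  directional derivative.\<close>

lemma translation_estimate:
  assumes "\<phi> \<in> test_functions \<Omega>"
  shows "integrable lborel (\<lambda>x. (\<phi> (x + h) - \<phi> x)\<^sup>2)"
    and "(\<integral>x. (\<phi> (x + h) - \<phi> x)\<^sup>2 \<partial>lborel) \<le> (norm h)\<^sup>2 * (\<integral>x. (norm (grad \<phi> x))\<^sup>2 \<partial>lborel)"
proof -
  let ?q = "\<lambda>m x. (\<phi> (x + h /\<^sub>R real (Suc m)) - \<phi> x) * real (Suc m)"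
  note [measurable] = test_measurable[OF assms]
  have int: "integrable lborel (\<lambda>x. (\<phi> (x + h) - \<phi> x)\<^sup>2)" for h
  proof -
    have "integrable lborel (\<lambda>x. (\<phi> (x + h))\<^sup>2)"
      by (rule lborel_integral_translate(2)[of "\<lambda>x. (\<phi> x)\<^sup>2", OF _ test_square_integrable(1)[OF assms]]) measurable
    then have "integrable lborel (\<lambda>x. (norm (\<phi> (x + h) - \<phi> x))\<^sup>2)"
      using test_square_integrable(1)[OF assms] by (intro integrable_norm_diff_square) simp_all
    then show ?thesis by simp
  qed
  show "integrable lborel (\<lambda>x. (\<phi> (x + h) - \<phi> x)\<^sup>2)" by (rule int)
  define I where "I = (\<integral>x. (\<phi> (x + h) - \<phi> x)\<^sup>2 \<partial>lborel)"
  define J where "J m = (\<integral>x. (?q m x)\<^sup>2 \<partial>lborel)" for m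
  have IJ: "I \<le> J m" for m
  proof -
    define g where "g = h /\<^sub>R real (Suc m)"
    define D where "D x = \<phi> (x + g) - \<phi> x" for x
    have mD [measurable]: "D \<in> borel_measurable borel" unfolding D_def by measurable
    have hg: "h = real (Suc m) *\<^sub>R g" unfolding g_def by simp
    have tel: "\<phi> (x + h) - \<phi> x = (\<Sum>i<Suc m. D (x + real i *\<^sub>R g))" for x
    proof -
      have "(\<Sum>i<Suc m. D (x + real i *\<^sub>R g)) = (\<Sum>i<Suc m. \<phi> (x + real (Suc i) *\<^sub>R g) - \<phi> (x + real i *\<^sub>R g))"
        unfolding D_def by (intro sum.cong) (auto simp: algebra_simps)
      also have "\<dots> = \<phi> (x + real (Suc m) *\<^sub>R g) - \<phi> (x + real 0 *\<^sub>R g)" by (rule sum_lessThan_telescope)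
      finally show ?thesis unfolding hg by simp
    qed
    have iD: "integrable lborel (\<lambda>x. (D x)\<^sup>2)" unfolding D_def by (rule int)
    have iDi: "integrable lborel (\<lambda>x. (D (x + real i *\<^sub>R g))\<^sup>2)" for i
      by (rule lborel_integral_translate(2)[of "\<lambda>x. (D x)\<^sup>2", OF _ iD]) measurable
    have eDi: "(\<integral>x. (D (x + real i *\<^sub>R g))\<^sup>2 \<partial>lborel) = (\<integral>x. (D x)\<^sup>2 \<partial>lborel)" for i
      by (rule lborel_integral_translate(1)[of "\<lambda>x. (D x)\<^sup>2"]) measurable
    have "I \<le> (\<integral>x. real (Suc m) * (\<Sum>i<Suc m. (D (x + real i *\<^sub>R g))\<^sup>2) \<partial>lborel)"
      unfolding I_def
    proof (rule integral_mono)
      show "integrable lborel (\<lambda>x. (\<phi> (x + h) - \<phi> x)\<^sup>2)" by (rule int)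
      show "integrable lborel (\<lambda>x. real (Suc m) * (\<Sum>i<Suc m. (D (x + real i *\<^sub>R g))\<^sup>2))"
        by (intro integrable_mult_right Bochner_Integration.integrable_sum iDi)
      show "(\<phi> (x + h) - \<phi> x)\<^sup>2 \<le> real (Suc m) * (\<Sum>i<Suc m. (D (x + real i *\<^sub>R g))\<^sup>2)" for x
        unfolding tel using sum_squared_le_sum_of_squares[of "\<lambda>i. D (x + real i *\<^sub>R g)" "{..<Suc m}"]
        by (simp add: mult.commute)
    qed
    also have "\<dots> = real (Suc m) * (\<Sum>i<Suc m. \<integral>x. (D x)\<^sup>2 \<partial>lborel)"
      using iDi eDi by (simp del: of_nat_Suc sum.lessThan_Suc)
    also have "\<dots> = (real (Suc m))\<^sup>2 * (\<integral>x. (D x)\<^sup>2 \<partial>lborel)" by (simp add: power2_eq_square)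
    also have "\<dots> = J m" unfolding J_def D_def g_def power_mult_distrib by (simp add: mult.commute)
    finally show ?thesis .
  qed
  have "J \<longlonglongrightarrow> (\<integral>x. (grad \<phi> x \<bullet> h)\<^sup>2 \<partial>lborel)"
    unfolding J_def
  proof -
    obtain B K where BK: "compact K" "B \<ge> 0"
      "\<And>m x. \<bar>?q m x\<bar> \<le> B * indicator K x"
      using difference_quotient_dominated(1)[OF assms, of h] by blast
    show "(\<lambda>m. \<integral>x. (?q m x)\<^sup>2 \<partial>lborel)
       \<longlonglongrightarrow> (\<integral>x. (grad \<phi> x \<bullet> h)\<^sup>2 \<partial>lborel)"
    proof (rule integral_dominated_convergence)
      show "integrable lborel (\<lambda>x. B\<^sup>2 * indicator K x)"
        using borel_integrable_compact[OF BK(1), of "\<lambda>x. 1::real"] by simp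
      show "AE x in lborel. norm ((?q m x)\<^sup>2) \<le> B\<^sup>2 * indicator K x" for m
      proof (rule AE_I2)
        fix x
        have "\<bar>?q m x\<bar>\<^sup>2 \<le> (B * indicator K x)\<^sup>2"
          by (rule power_mono[OF BK(3)]) simp
        also have "(B * indicator K x)\<^sup>2 = B\<^sup>2 * indicator K x" by (simp add: indicator_def)
        finally show "norm ((?q m x)\<^sup>2) \<le> B\<^sup>2 * indicator K x"
          by simp
      qed
      show "AE x in lborel. (\<lambda>m. (?q m x)\<^sup>2) \<longlonglongrightarrow> (grad \<phi> x \<bullet> h)\<^sup>2"
        by (intro AE_I2 tendsto_power difference_quotient_dominated(2)[OF assms])
    qed measurable
  qed
  then have "I \<le> (\<integral>x. (grad \<phi> x \<bullet> h)\<^sup>2 \<partial>lborel)"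
    by (rule LIMSEQ_le_const) (use IJ in blast)
  also have "\<dots> \<le> (\<integral>x. (norm h)\<^sup>2 * (norm (grad \<phi> x))\<^sup>2 \<partial>lborel)"
  proof (rule integral_mono')
    show "(grad \<phi> x \<bullet> h)\<^sup>2 \<le> (norm h)\<^sup>2 * (norm (grad \<phi> x))\<^sup>2" for x
      using power_mono[OF Cauchy_Schwarz_ineq2[of "grad \<phi> x" h], of 2]
      by (simp add: power_mult_distrib mult.commute)
  qed (use test_square_integrable[OF assms] in simp_all)
  finally show "(\<integral>x. (\<phi> (x + h) - \<phi> x)\<^sup>2 \<partial>lborel) \<le> (norm h)\<^sup>2 * (\<integral>x. (norm (grad \<phi> x))\<^sup>2 \<partial>lborel)"
    by (simp add: I_def)
qed

text \<open>Since the coordinate \<open>x \<bullet> b\<close> has gradient \<open>b\<close>,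
  integration by parts against the square of \<phi> turns the left side into \<open>- \<integral> (x
  \<bullet> b) * 2 * \<phi> * (grad \<phi> \<bullet> b)\<close>. Young's inequality bounds this by
  half of the left side plus \<open>2 * R\<^sup>2\<close> times the gradient integral; absorbing the
  half doubles the constant.\<close>

lemma poincare:
  assumes "\<phi> \<in> test_functions \<Omega>" "\<And>x. x \<in> \<Omega> \<Longrightarrow> norm x \<le> R"
  shows "(\<integral>x. (\<phi> x)\<^sup>2 \<partial>lborel) \<le> 4 * R\<^sup>2 * (\<integral>x. (norm (grad \<phi> x))\<^sup>2 \<partial>lborel)"
proof -
  obtain b :: 'a where b: "b \<in> Basis" using nonempty_Basis by blast
  have sm: "smooth \<phi>" by (rule test_functionsD(1)[OF assms(1)])
  have sb: "smooth (\<lambda>x. x \<bullet> b)" by (rule smooth_inner)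
  have gb: "grad (\<lambda>x. x \<bullet> b) x = b" for x
    by (rule gradI) (auto intro!: derivative_eq_intros simp: inner_commute)
  have pt: "(\<lambda>x. \<phi> x * \<phi> x) \<in> test_functions \<Omega>" by (rule test_functions_mult[OF assms(1) sm])
  have "(\<integral>x. (\<phi> x)\<^sup>2 \<partial>lborel) = - (\<integral>x. (x \<bullet> b) * (2 * \<phi> x * (grad \<phi> x \<bullet> b)) \<partial>lborel)"
    using integration_by_parts[OF pt sb, of b] b
    by (simp add: gb grad_mult[OF sm sm] inner_add_left power2_eq_square algebra_simps)
  also have "\<dots> = (\<integral>x. - ((x \<bullet> b) * (2 * \<phi> x * (grad \<phi> x \<bullet> b))) \<partial>lborel)" by simp
  also have "\<dots> \<le> (\<integral>x. (1/2) * (\<phi> x)\<^sup>2 + 2 * R\<^sup>2 * (norm (grad \<phi> x))\<^sup>2 \<partial>lborel)"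
  proof (rule integral_mono')
    show "integrable lborel (\<lambda>x. (1/2) * (\<phi> x)\<^sup>2 + 2 * R\<^sup>2 * (norm (grad \<phi> x))\<^sup>2)"
      using test_square_integrable[OF assms(1)] by simp
    show "0 \<le> (1/2) * (\<phi> x)\<^sup>2 + 2 * R\<^sup>2 * (norm (grad \<phi> x))\<^sup>2" for x by simp
    show "- ((x \<bullet> b) * (2 * \<phi> x * (grad \<phi> x \<bullet> b))) \<le> (1/2) * (\<phi> x)\<^sup>2 + 2 * R\<^sup>2 * (norm (grad \<phi> x))\<^sup>2" for x
    proof (cases "x \<in> \<Omega>")
      case True
      define p q where "p = (x \<bullet> b) * (grad \<phi> x \<bullet> b)" and "q = \<phi> x"
      have "\<bar>x \<bullet> b\<bar> \<le> R" using Basis_le_norm[OF b, of x] assms(2)[OF True] by simp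
      moreover have "\<bar>grad \<phi> x \<bullet> b\<bar> \<le> norm (grad \<phi> x)" by (rule Basis_le_norm[OF b])
      ultimately have "\<bar>p\<bar> \<le> R * norm (grad \<phi> x)"
        unfolding p_def abs_mult by (intro mult_mono) auto
      then have "p\<^sup>2 \<le> R\<^sup>2 * (norm (grad \<phi> x))\<^sup>2"
        using power_mono[of "\<bar>p\<bar>" "R * norm (grad \<phi> x)" 2] by (simp add: power_mult_distrib)
      moreover have "0 \<le> (q + 2 * p)\<^sup>2" by simp
      then have "- (2 * p * q) \<le> (1/2) * q\<^sup>2 + 2 * p\<^sup>2" by (simp add: power2_eq_square algebra_simps)
      ultimately show ?thesis unfolding p_def q_def by (simp add: algebra_simps)
    next
      case False
      then show ?thesis using test_functions_eq_0[OF assms(1)] by simp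
    qed
  qed
  also have "\<dots> = (1/2) * (\<integral>x. (\<phi> x)\<^sup>2 \<partial>lborel) + 2 * R\<^sup>2 * (\<integral>x. (norm (grad \<phi> x))\<^sup>2 \<partial>lborel)"
    using test_square_integrable[OF assms(1)] by simp
  finally show ?thesis by simp
qed

subsection \<open>The Rellich compactness theorem for test functions\<close>

text \<open>Convolution with the normalised indicator of a ball. The averages are merely Lipschitz,
  not smooth, but that is what Arzela-Ascoli asks for, and the bounds follow from Cauchy-Schwarz and
  \<open>translation_estimate\<close>.\<close>

definition avg :: "real \<Rightarrow> ('a::euclidean_space \<Rightarrow> real) \<Rightarrow> 'a \<Rightarrow> real" where
  "avg \<delta> f x = (\<integral>h. indicator (cball 0 \<delta>) h * f (x + h) \<partial>lborel) / measure lborel (cball 0 \<delta> :: 'a set)"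

lemma integrable_indicator_cball_mult:
  fixes f :: "'a::euclidean_space \<Rightarrow> real"
  assumes "continuous_on UNIV f"
  shows "integrable lborel (\<lambda>h. indicator (cball 0 \<delta>) h * f (x + h))"
proof -
  have "continuous_on (cball 0 \<delta>) (\<lambda>h. f (x + h))"
    by (rule continuous_on_compose2[OF assms]) (auto intro!: continuous_intros)
  from borel_integrable_compact[OF compact_cball this] show ?thesis by simp
qed

text \<open>Jensen's inequality for the uniform probability on the ball, obtained by Cauchy-Schwarz
  against the indicator.\<close>

lemma avg_square_le:
  fixes f :: "'a::euclidean_space \<Rightarrow> real"
  assumes "continuous_on UNIV f" "\<delta> > 0"
  shows "(avg \<delta> f x)\<^sup>2 \<le> (\<integral>h. indicator (cball 0 \<delta>) h * (f (x + h))\<^sup>2 \<partial>lborel) / measure lborel (cball 0 \<delta> :: 'a set)"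
proof -
  let ?C = "cball 0 \<delta> :: 'a set" let ?c = "measure lborel ?C"
  have c: "?c > 0" using assms(2) by (simp add: content_cball_pos)
  have [measurable]: "?C \<in> sets borel" by simp
  note [measurable] = borel_measurable_continuous_onI[OF assms(1)]
  have sq: "(\<lambda>h. (indicator ?C h * f (x + h))\<^sup>2) = (\<lambda>h. indicator ?C h * (f (x + h))\<^sup>2)"
    by (auto simp: indicator_def fun_eq_iff)
  have sq1: "(\<lambda>h. (indicator ?C h :: real)\<^sup>2) = indicator ?C"
    by (auto simp: indicator_def fun_eq_iff)
  have i1: "integrable lborel (indicator ?C :: 'a \<Rightarrow> real)"
    using borel_integrable_compact[of ?C "\<lambda>x. 1::real"] by simp
  have "(\<integral>h. indicator ?C h * (indicator ?C h * f (x + h)) \<partial>lborel)\<^sup>2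
      \<le> (\<integral>h. (indicator ?C h)\<^sup>2 \<partial>lborel) * (\<integral>h. (indicator ?C h * f (x + h))\<^sup>2 \<partial>lborel)"
  proof (rule integral_Cauchy_Schwarz(2))
    show "integrable lborel (\<lambda>h. (indicator ?C h :: real)\<^sup>2)" unfolding sq1 by (rule i1)
    show "integrable lborel (\<lambda>h. (indicator ?C h * f (x + h))\<^sup>2)" unfolding sq
      by (rule integrable_indicator_cball_mult[of "\<lambda>x. (f x)\<^sup>2"]) (intro continuous_intros assms)
  qed measurable
  also have "(\<lambda>h. indicator ?C h * (indicator ?C h * f (x + h))) = (\<lambda>h. indicator ?C h * f (x + h))"
    by (auto simp: indicator_def fun_eq_iff)
  finally have "(\<integral>h. indicator ?C h * f (x + h) \<partial>lborel)\<^sup>2 \<le> ?c * (\<integral>h. indicator ?C h * (f (x + h))\<^sup>2 \<partial>lborel)"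
    unfolding sq sq1 by simp
  then have "(\<integral>h. indicator ?C h * f (x + h) \<partial>lborel)\<^sup>2 / ?c\<^sup>2 \<le> ?c * (\<integral>h. indicator ?C h * (f (x + h))\<^sup>2 \<partial>lborel) / ?c\<^sup>2"
    by (rule divide_right_mono) simp
  also have "\<dots> = (\<integral>h. indicator ?C h * (f (x + h))\<^sup>2 \<partial>lborel) / ?c"
    using c by (simp add: power2_eq_square)
  finally show ?thesis by (simp add: avg_def power_divide)
qed

lemma avg_diff:
  fixes f :: "'a::euclidean_space \<Rightarrow> real"
  assumes "continuous_on UNIV f" "continuous_on UNIV g"
  shows "avg \<delta> (\<lambda>x. f x - g x) x = avg \<delta> f x - avg \<delta> g x"
  using integrable_indicator_cball_mult[OF assms(1)] integrable_indicator_cball_mult[OF assms(2)]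
  by (simp add: avg_def right_diff_distrib diff_divide_distrib)

lemma avg_translate:
  "avg \<delta> (\<lambda>x. f (x + a)) x = avg \<delta> f (x + a)"
  by (simp add: avg_def add.assoc add.commute[of a])

lemma indicator_integral_le:
  fixes f :: "'a::euclidean_space \<Rightarrow> real"
  assumes "f \<in> borel_measurable borel" "integrable lborel f" "\<And>x. f x \<ge> 0"
  shows "(\<integral>h. indicator (cball 0 \<delta>) h * f (x + h) \<partial>lborel) \<le> (\<integral>x. f x \<partial>lborel)"
proof -
  have "(\<integral>h. indicator (cball 0 \<delta>) h * f (x + h) \<partial>lborel) \<le> (\<integral>h. f (h + x) \<partial>lborel)"
    by (rule integral_mono')
       (use assms lborel_integral_translate(2)[OF assms(1,2), of x] in \<open>auto simp: indicator_def add.commute\<close>)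
  then show ?thesis using lborel_integral_translate(1)[OF assms(1)] by simp
qed

lemma avg_bound:
  fixes \<phi> :: "'a::euclidean_space \<Rightarrow> real"
  assumes "\<phi> \<in> test_functions \<Omega>" "\<delta> > 0"
  shows "(avg \<delta> \<phi> x)\<^sup>2 \<le> (\<integral>x. (\<phi> x)\<^sup>2 \<partial>lborel) / measure lborel (cball 0 \<delta> :: 'a set)"
proof -
  note [measurable] = test_measurable[OF assms(1)]
  have "(\<integral>h. indicator (cball 0 \<delta>) h * (\<phi> (x + h))\<^sup>2 \<partial>lborel) \<le> (\<integral>x. (\<phi> x)\<^sup>2 \<partial>lborel)"
    by (rule indicator_integral_le[of "\<lambda>x. (\<phi> x)\<^sup>2"]) (use test_square_integrable[OF assms(1)] in auto)
  then show ?thesis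
    using avg_square_le[OF test_continuous(1)[OF assms(1)] assms(2), of x]
    by (meson divide_right_mono measure_nonneg order_trans)
qed

text \<open>The difference of two averages is the average at \<open>y\<close> of the single function
  \<open>D\<close>, the change of \<open>\<phi>\<close> under translation by \<open>x - y\<close>;
  \<open>translation_estimate\<close> bounds its mean square.\<close>

lemma avg_lipschitz:
  fixes \<phi> :: "'a::euclidean_space \<Rightarrow> real"
  assumes "\<phi> \<in> test_functions \<Omega>" "\<delta> > 0"
  shows "(avg \<delta> \<phi> x - avg \<delta> \<phi> y)\<^sup>2 \<le> (norm (x - y))\<^sup>2 *
    (\<integral>x. (norm (grad \<phi> x))\<^sup>2 \<partial>lborel) / measure lborel (cball 0 \<delta> :: 'a set)"
proof -
  note [measurable] = test_measurable[OF assms(1)]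
  define D where "D z = \<phi> (z + (x - y)) - \<phi> z" for z
  have c: "continuous_on UNIV (\<lambda>z. \<phi> (z + (x - y)))"
    by (rule continuous_on_compose2[OF test_continuous(1)[OF assms(1)]]) (auto intro!: continuous_intros)
  have cD: "continuous_on UNIV D" unfolding D_def
    by (intro continuous_on_diff c test_continuous(1)[OF assms(1)])
  have [measurable]: "D \<in> borel_measurable borel" by (rule borel_measurable_continuous_onI[OF cD])
  have "avg \<delta> D y = avg \<delta> \<phi> x - avg \<delta> \<phi> y"
    unfolding D_def avg_diff[OF c test_continuous(1)[OF assms(1)]] avg_translate by simp
  moreover have "(avg \<delta> D y)\<^sup>2 \<le> (\<integral>h. indicator (cball 0 \<delta>) h * (D (y + h))\<^sup>2 \<partial>lborel) / measure lborel (cball 0 \<delta> :: 'a set)"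
    by (rule avg_square_le[OF cD assms(2)])
  moreover have "(\<integral>h. indicator (cball 0 \<delta>) h * (D (y + h))\<^sup>2 \<partial>lborel) \<le> (\<integral>x. (D x)\<^sup>2 \<partial>lborel)"
    by (rule indicator_integral_le[of "\<lambda>x. (D x)\<^sup>2"])
       (use translation_estimate(1)[OF assms(1), of "x - y"] in \<open>auto simp: D_def\<close>)
  moreover have "(\<integral>x. (D x)\<^sup>2 \<partial>lborel) \<le> (norm (x - y))\<^sup>2 * (\<integral>x. (norm (grad \<phi> x))\<^sup>2 \<partial>lborel)"
    unfolding D_def by (rule translation_estimate(2)[OF assms(1)])
  ultimately show ?thesis
    by (smt (verit, ccfv_threshold) divide_right_mono measure_nonneg)
qed

lemma avg_continuous:
  fixes \<phi> :: "'a::euclidean_space \<Rightarrow> real"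
  assumes "\<phi> \<in> test_functions \<Omega>" "\<delta> > 0"
  shows "continuous_on UNIV (avg \<delta> \<phi>)"
proof -
  define L where "L = (\<integral>x. (norm (grad \<phi> x))\<^sup>2 \<partial>lborel) / measure lborel (cball 0 \<delta> :: 'a set)"
  have "\<bar>avg \<delta> \<phi> x - avg \<delta> \<phi> y\<bar> \<le> sqrt L * norm (x - y)" for x y
  proof -
    have "sqrt ((avg \<delta> \<phi> x - avg \<delta> \<phi> y)\<^sup>2) \<le> sqrt ((norm (x - y))\<^sup>2 * L)"
      by (rule real_sqrt_le_mono) (use avg_lipschitz[OF assms, of x y] in \<open>simp add: L_def\<close>)
    then show ?thesis by (simp add: real_sqrt_mult mult.commute)
  qed
  then have "(sqrt L)-lipschitz_on UNIV (avg \<delta> \<phi>)"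
    by (intro lipschitz_onI) (auto simp: dist_norm L_def)
  then show ?thesis by (rule lipschitz_on_continuous_on)
qed

text \<open>By Jensen the squared error at \<open>x\<close> is at most the mean over
  \<open>h\<close> of the squared change of \<open>\<phi>\<close> from \<open>x\<close> to
  \<open>x + h\<close>. Exchanging the integrals leaves, for each \<open>h\<close> in the ball, the
  left side of \<open>translation_estimate\<close> with
  \<open>norm h \<le> \<delta>\<close>.\<close>

lemma avg_approx:
  fixes \<phi> :: "'a::euclidean_space \<Rightarrow> real"
  assumes "\<phi> \<in> test_functions \<Omega>" "\<delta> > 0"
  shows "integrable lborel (\<lambda>x. (avg \<delta> \<phi> x - \<phi> x)\<^sup>2)"
    and "(\<integral>x. (avg \<delta> \<phi> x - \<phi> x)\<^sup>2 \<partial>lborel) \<le> \<delta>\<^sup>2 * (\<integral>x. (norm (grad \<phi> x))\<^sup>2 \<partial>lborel)"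
proof -
  note [measurable] = test_measurable[OF assms(1)]
  have [measurable]: "avg \<delta> \<phi> \<in> borel_measurable borel"
    by (rule borel_measurable_continuous_onI[OF avg_continuous[OF assms]])
  let ?C = "cball 0 \<delta> :: 'a set" let ?c = "measure lborel ?C"
  have c: "?c > 0" using assms(2) by (simp add: content_cball_pos)
  have [measurable]: "?C \<in> sets borel" by simp
  let ?K = "\<integral>x. (norm (grad \<phi> x))\<^sup>2 \<partial>lborel"
  define F :: "'a \<Rightarrow> 'a \<Rightarrow> real" where "F x h = indicator ?C h * (\<phi> (x + h) - \<phi> x)\<^sup>2 / ?c" for x h
  have F0: "F x h \<ge> 0" for x h using c by (simp add: F_def)
  have iF: "integrable lborel (F x)" for x
  proof -
    have "integrable lborel (\<lambda>h. indicator ?C h * (\<phi> (x + h) - \<phi> x)\<^sup>2)"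
      by (rule integrable_indicator_cball_mult[of "\<lambda>y. (\<phi> y - \<phi> x)\<^sup>2"])
         (intro continuous_intros test_continuous(1)[OF assms(1)])
    then show ?thesis unfolding F_def by simp
  qed
  have p: "(avg \<delta> \<phi> x - \<phi> x)\<^sup>2 \<le> (\<integral>h. F x h \<partial>lborel)" for x
  proof -
    have cc: "continuous_on UNIV (\<lambda>y. \<phi> y - \<phi> x)" by (intro continuous_intros test_continuous(1)[OF assms(1)])
    have "avg \<delta> (\<lambda>y. \<phi> x) x = \<phi> x" using c by (simp add: avg_def)
    then have "avg \<delta> (\<lambda>y. \<phi> y - \<phi> x) x = avg \<delta> \<phi> x - \<phi> x"
      using avg_diff[OF test_continuous(1)[OF assms(1)], of "\<lambda>y. \<phi> x" \<delta> x] by simp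
    then show ?thesis using avg_square_le[OF cc assms(2), of x] by (simp add: F_def)
  qed
  have nn: "(\<integral>\<^sup>+x. ennreal ((avg \<delta> \<phi> x - \<phi> x)\<^sup>2) \<partial>lborel) \<le> ennreal (\<delta>\<^sup>2 * ?K)"
  proof -
    have "(\<integral>\<^sup>+x. ennreal ((avg \<delta> \<phi> x - \<phi> x)\<^sup>2) \<partial>lborel) \<le> (\<integral>\<^sup>+x. (\<integral>\<^sup>+h. ennreal (F x h) \<partial>lborel) \<partial>lborel)"
      by (rule nn_integral_mono) (use p iF F0 in \<open>simp add: nn_integral_eq_integral ennreal_leI\<close>)
    also have "\<dots> = (\<integral>\<^sup>+h. (\<integral>\<^sup>+x. ennreal (F x h) \<partial>lborel) \<partial>lborel)"
    proof (rule lborel_pair.Fubini'[symmetric])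
      have "(\<lambda>p::'a \<times> 'a. indicator ?C (snd p) * (\<phi> (fst p + snd p) - \<phi> (fst p))\<^sup>2 / ?c) \<in> borel_measurable (lborel \<Otimes>\<^sub>M lborel)"
        by measurable
      then show "(\<lambda>(x, h). ennreal (F x h)) \<in> borel_measurable (lborel \<Otimes>\<^sub>M lborel)"
        unfolding F_def case_prod_beta by measurable
    qed
    also have "\<dots> \<le> (\<integral>\<^sup>+h. ennreal (\<delta>\<^sup>2 * ?K / ?c) * indicator ?C h \<partial>lborel)"
    proof (rule nn_integral_mono)
      fix h :: 'a
      show "(\<integral>\<^sup>+x. ennreal (F x h) \<partial>lborel) \<le> ennreal (\<delta>\<^sup>2 * ?K / ?c) * indicator ?C h"
      proof (cases "h \<in> ?C")
        case True
        have "(\<integral>\<^sup>+x. ennreal (F x h) \<partial>lborel) = ennreal (\<integral>x. F x h \<partial>lborel)"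
          using translation_estimate(1)[OF assms(1)] True F0
          by (intro nn_integral_eq_integral) (auto simp: F_def)
        also have "(\<integral>x. F x h \<partial>lborel) = (\<integral>x. (\<phi> (x + h) - \<phi> x)\<^sup>2 \<partial>lborel) / ?c"
          using True by (simp add: F_def)
        also have "\<dots> \<le> \<delta>\<^sup>2 * ?K / ?c"
        proof (rule divide_right_mono)
          have "(norm h)\<^sup>2 \<le> \<delta>\<^sup>2" using True by (intro power_mono) auto
          then have "(norm h)\<^sup>2 * ?K \<le> \<delta>\<^sup>2 * ?K" by (rule mult_right_mono) simp
          then show "(\<integral>x. (\<phi> (x + h) - \<phi> x)\<^sup>2 \<partial>lborel) \<le> \<delta>\<^sup>2 * ?K"
            using translation_estimate(2)[OF assms(1), of h] by linarith
        qed (use c in simp)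
        finally show ?thesis using True by (simp add: ennreal_leI)
      qed (simp add: F_def)
    qed
    also have "\<dots> = ennreal (\<delta>\<^sup>2 * ?K / ?c) * emeasure lborel ?C"
      by (rule nn_integral_cmult_indicator) simp
    also have "emeasure lborel ?C = ennreal ?c"
      by (rule emeasure_eq_ennreal_measure) (metis emeasure_lborel_cball_finite infinity_ennreal_def less_irrefl)
    also have "ennreal (\<delta>\<^sup>2 * ?K / ?c) * ennreal ?c = ennreal (\<delta>\<^sup>2 * ?K)"
      using c by (subst ennreal_mult[symmetric]) auto
    finally show ?thesis .
  qed
  show i: "integrable lborel (\<lambda>x. (avg \<delta> \<phi> x - \<phi> x)\<^sup>2)"
    by (rule integrableI_bounded) (use nn in \<open>auto intro: le_less_trans\<close>)
  show "(\<integral>x. (avg \<delta> \<phi> x - \<phi> x)\<^sup>2 \<partial>lborel) \<le> \<delta>\<^sup>2 * ?K"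
    using nn by (subst (asm) nn_integral_eq_integral[OF i]) auto
qed

text \<open>At a fixed scale \<delta> the averages of all \<open>v n\<close> are bounded and
  Lipschitz with one constant, so Arzela-Ascoli makes a subsequence of them uniformly convergent on
  the closure of \<Omega>. The averages differ from the functions by a small amount in mean square,
  uniformly in \<open>n\<close>. As \<delta> depends on \<open>e\<close>, so does the
  subsequence.\<close>

lemma rellich_step:
  fixes v :: "nat \<Rightarrow> 'a::euclidean_space \<Rightarrow> real"
  assumes "open \<Omega>" "bounded \<Omega>" and v: "\<And>n. v n \<in> test_functions \<Omega>"
    and L2: "\<And>n. (\<integral>x. (v n x)\<^sup>2 \<partial>lborel) \<le> K"
    and H1: "\<And>n. (\<integral>x. (norm (grad (v n) x))\<^sup>2 \<partial>lborel) \<le> K"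
    and "e > 0"
  shows "\<exists>r::nat \<Rightarrow> nat. strict_mono r \<and> (\<exists>N. \<forall>m\<ge>N. \<forall>n\<ge>N. (\<integral>x. (v (r m) x - v (r n) x)\<^sup>2 \<partial>lborel) < e)"
proof -
  let ?E = "\<lambda>w. \<integral>x. (norm (grad w x))\<^sup>2 \<partial>lborel" and ?I = "\<lambda>w. \<integral>x. (w x)\<^sup>2 \<partial>lborel"
  have "0 \<le> ?I (v 0)" by simp
  with L2[of 0] have K: "K \<ge> 0" by linarith
  \<comment> \<open>The final bound is
    \<open>8 * K * \<delta>\<^sup>2 + 8 * w * \<eta>\<^sup>2\<close>, with \<open>w\<close> the
    volume of \<Omega>. The constants 16 here and in \<eta> keep each summand below
    \<open>e / 2\<close>; adding 1 to \<open>K\<close> and \<open>w\<close> avoids division by zero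
    and makes the inequality strict.\<close>
  define \<delta> where "\<delta> = sqrt (e / (16 * (K + 1)))"
  have \<delta>: "\<delta> > 0" and \<delta>2: "\<delta>\<^sup>2 = e / (16 * (K + 1))" using K assms(6) by (simp_all add: \<delta>_def)
  define c where "c = measure lborel (cball 0 \<delta> :: 'a set)"
  have c: "c > 0" using \<delta> by (simp add: c_def content_cball_pos)
  define w where "w = measure lborel \<Omega>"
  have w: "w \<ge> 0" by (simp add: w_def)
  define L where "L = sqrt (K / c)"
  have L: "L \<ge> 0" using K c by (simp add: L_def)
  define S where "S = closure \<Omega>"
  have lip: "\<bar>avg \<delta> (v n) x - avg \<delta> (v n) y\<bar> \<le> L * norm (x - y)" for n x y
  proof -
    have "(avg \<delta> (v n) x - avg \<delta> (v n) y)\<^sup>2 \<le> (norm (x - y))\<^sup>2 * ?E (v n) / c"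
      unfolding c_def by (rule avg_lipschitz[OF v \<delta>])
    also have "\<dots> \<le> (norm (x - y))\<^sup>2 * K / c"
      by (intro divide_right_mono mult_left_mono H1) (use c in auto)
    finally have "sqrt ((avg \<delta> (v n) x - avg \<delta> (v n) y)\<^sup>2) \<le> sqrt ((norm (x - y))\<^sup>2 * (K / c))"
      by (intro real_sqrt_le_mono) simp
    also have "sqrt ((norm (x - y))\<^sup>2 * (K / c)) = L * norm (x - y)"
      unfolding L_def real_sqrt_mult by simp
    finally show ?thesis by simp
  qed
  have bd: "norm (avg \<delta> (v n) x) \<le> L" for n x
  proof -
    have "(avg \<delta> (v n) x)\<^sup>2 \<le> ?I (v n) / c"
      unfolding c_def by (rule avg_bound[OF v \<delta>])
    also have "\<dots> \<le> K / c" by (rule divide_right_mono[OF L2]) (use c in simp)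
    finally have "sqrt ((avg \<delta> (v n) x)\<^sup>2) \<le> L" unfolding L_def by (rule real_sqrt_le_mono)
    then show ?thesis by simp
  qed
  have "compact S" unfolding S_def using assms(2) by simp
  then obtain g r where gr: "strict_mono (r :: nat \<Rightarrow> nat)"
    "\<And>e. 0 < e \<Longrightarrow> \<exists>N. \<forall>n x. n \<ge> N \<and> x \<in> S \<longrightarrow> norm (avg \<delta> (v (r n)) x - g x) < e"
  proof (rule Arzela_Ascoli[of S "\<lambda>n. avg \<delta> (v n)" L])
    show "norm (avg \<delta> (v n) x) \<le> L" for n x by (rule bd)
    show "\<exists>d. 0 < d \<and> (\<forall>n y. y \<in> S \<and> norm (x - y) < d \<longrightarrow> norm (avg \<delta> (v n) x - avg \<delta> (v n) y) < e)"
      if "0 < e" for x :: 'a and e :: real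
    proof (intro exI conjI allI impI)
      show "0 < e / (L + 1)" using that L by simp
      fix n y assume "y \<in> S \<and> norm (x - y) < e / (L + 1)"
      then have "(L + 1) * norm (x - y) < e" using L by (simp add: field_simps)
      moreover have "L * norm (x - y) \<le> (L + 1) * norm (x - y)" by (rule mult_right_mono) auto
      ultimately show "norm (avg \<delta> (v n) x - avg \<delta> (v n) y) < e"
        using lip[of n x y] by simp
    qed
  qed blast
  define \<eta> where "\<eta> = sqrt (e / (16 * (w + 1)))"
  have \<eta>: "\<eta> > 0" and \<eta>2: "\<eta>\<^sup>2 = e / (16 * (w + 1))" using w assms(6) by (simp_all add: \<eta>_def)
  obtain N where N: "\<And>n x. n \<ge> N \<Longrightarrow> x \<in> S \<Longrightarrow> norm (avg \<delta> (v (r n)) x - g x) < \<eta>"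
    using gr(2)[OF \<eta>] by blast
  have "(\<integral>x. (v (r m) x - v (r n) x)\<^sup>2 \<partial>lborel) < e" if mn: "m \<ge> N" "n \<ge> N" for m n
  proof -
    define d where "d = (\<lambda>x. v (r m) x - v (r n) x)"
    have dt: "d \<in> test_functions \<Omega>" unfolding d_def by (rule test_functions_diff[OF v v])
    have ad: "avg \<delta> d x = avg \<delta> (v (r m)) x - avg \<delta> (v (r n)) x" for x
      unfolding d_def by (rule avg_diff[OF test_continuous(1)[OF v] test_continuous(1)[OF v]])
    have gd: "?E d \<le> 4 * K"
    proof -
      have "?E d \<le>
          (\<integral>x. 2 * (norm (grad (v (r m)) x))\<^sup>2 + 2 * (norm (grad (v (r n)) x))\<^sup>2 \<partial>lborel)"
      proof (rule integral_mono)
        show "integrable lborel (\<lambda>x. (norm (grad d x))\<^sup>2)" by (rule test_square_integrable[OF dt])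
        show "integrable lborel (\<lambda>x. 2 * (norm (grad (v (r m)) x))\<^sup>2 + 2 * (norm (grad (v (r n)) x))\<^sup>2)"
          using test_square_integrable(2)[OF v] by simp
        fix x
        show "(norm (grad d x))\<^sup>2 \<le> 2 * (norm (grad (v (r m)) x))\<^sup>2 + 2 * (norm (grad (v (r n)) x))\<^sup>2"
          unfolding d_def grad_diff[OF test_functionsD(1)[OF v] test_functionsD(1)[OF v]]
          by (rule norm_diff_square_le)
      qed
      also have "\<dots> = 2 * ?E (v (r m)) + 2 * ?E (v (r n))"
        using test_square_integrable(2)[OF v] by simp
      also have "\<dots> \<le> 4 * K" using H1[of "r m"] H1[of "r n"] by linarith
      finally show ?thesis .
    qed
    have ind: "integrable lborel (indicator \<Omega> :: 'a \<Rightarrow> real)"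
      using assms(1,2) emeasure_bounded_finite[OF assms(2)] by (intro integrable_real_indicator) (auto simp: less_top)
    have "?I d \<le> (\<integral>x. 2 * (avg \<delta> d x - d x)\<^sup>2 + 8 * \<eta>\<^sup>2 * indicator \<Omega> x \<partial>lborel)"
    proof (rule integral_mono)
      show "integrable lborel (\<lambda>x. (d x)\<^sup>2)" by (rule test_square_integrable[OF dt])
      show "integrable lborel (\<lambda>x. 2 * (avg \<delta> d x - d x)\<^sup>2 + 8 * \<eta>\<^sup>2 * indicator \<Omega> x)"
        using avg_approx(1)[OF dt \<delta>] ind by simp
      fix x
      show "(d x)\<^sup>2 \<le> 2 * (avg \<delta> d x - d x)\<^sup>2 + 8 * \<eta>\<^sup>2 * indicator \<Omega> x"
      proof (cases "x \<in> \<Omega>")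
        case True
        then have "x \<in> S" using closure_subset by (auto simp: S_def)
        then have "\<bar>avg \<delta> d x\<bar> \<le> 2 * \<eta>"
          using N[OF mn(1), of x] N[OF mn(2), of x] unfolding ad by simp
        then have "(avg \<delta> d x)\<^sup>2 \<le> (2 * \<eta>)\<^sup>2" using \<eta> by (intro power2_le_iff_abs_le[THEN iffD2]) auto
        \<comment> \<open>This square is
          \<open>2 * (avg - d)\<^sup>2 + 2 * avg\<^sup>2 - d\<^sup>2\<close>; the bound
          \<open>2 * \<eta>\<close> on the average then yields the constant 8.\<close>
        moreover have "0 \<le> (2 * avg \<delta> d x - d x)\<^sup>2" by simp
        ultimately show ?thesis using True by (simp add: power2_eq_square algebra_simps)
      next
        case False
        then show ?thesis using test_functions_eq_0[OF dt] by simp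
      qed
    qed
    also have "\<dots> = 2 * (\<integral>x. (avg \<delta> d x - d x)\<^sup>2 \<partial>lborel) + 8 * \<eta>\<^sup>2 * w"
      using avg_approx(1)[OF dt \<delta>] ind by (simp add: w_def)
    also have "\<dots> \<le> 2 * (\<delta>\<^sup>2 * (4 * K)) + 8 * \<eta>\<^sup>2 * w"
      using order_trans[OF avg_approx(2)[OF dt \<delta>] mult_left_mono[OF gd, of "\<delta>\<^sup>2"]]
      by (simp add: mult.commute mult.left_commute)
    also have "\<dots> = e / 2 * (K / (K + 1)) + e / 2 * (w / (w + 1))"
      unfolding \<delta>2 \<eta>2 using K w by (simp add: divide_simps) (simp add: algebra_simps)
    also have "\<dots> < e / 2 * 1 + e / 2 * 1"
      using K w assms(6) by (intro add_strict_mono mult_strict_left_mono) auto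
    finally show ?thesis by (simp add: d_def)
  qed
  with gr(1) show ?thesis by blast
qed

text \<open>A diagonal sequence over the tolerances \<open>1 / (k + 1)\<close> makes the choice of
  subsequence independent of \<open>e\<close>. The conclusion is the Cauchy property rather than a
  limit, which suits the later step from functions to gradients.\<close>

theorem rellich:
  fixes v :: "nat \<Rightarrow> 'a::euclidean_space \<Rightarrow> real"
  assumes "open \<Omega>" "bounded \<Omega>" and v: "\<And>n. v n \<in> test_functions \<Omega>"
    and L2: "\<And>n. (\<integral>x. (v n x)\<^sup>2 \<partial>lborel) \<le> K"
    and H1: "\<And>n. (\<integral>x. (norm (grad (v n) x))\<^sup>2 \<partial>lborel) \<le> K"
  shows "\<exists>r::nat \<Rightarrow> nat. strict_mono r \<and>
    (\<forall>e>0. \<exists>N. \<forall>m\<ge>N. \<forall>n\<ge>N. (\<integral>x. (v (r m) x - v (r n) x)\<^sup>2 \<partial>lborel) < e)"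
proof -
  define P where "P k s \<longleftrightarrow> (\<exists>N. \<forall>m\<ge>N. \<forall>n\<ge>N.
      (\<integral>x. (v (s m) x - v (s n) x)\<^sup>2 \<partial>lborel) < inverse (real (Suc k)))" for k and s :: "nat \<Rightarrow> nat"
  interpret subseqs P
  proof
    fix k and s :: "nat \<Rightarrow> nat" assume "strict_mono s"
    show "\<exists>r. strict_mono r \<and> P k (s \<circ> r)"
      unfolding P_def comp_def
      by (rule rellich_step[OF assms(1,2), of "\<lambda>n. v (s n)"]) (use v L2 H1 in auto)
  qed
  \<comment> \<open>The diagonal sequence is a subsequence of the \<open>k\<close>-th one only from
    index \<open>Suc k\<close> on, hence the shift. The property itself survives passage to
    subsequences.\<close>
  have P: "P k (diagseq \<circ> ((+) (Suc k)))" for k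
  proof (rule diagseq_holds)
    fix r s :: "nat \<Rightarrow> nat" and n assume r: "strict_mono r" and "P n s"
    then obtain N where N: "\<And>m k. m \<ge> N \<Longrightarrow> k \<ge> N \<Longrightarrow>
        (\<integral>x. (v (s m) x - v (s k) x)\<^sup>2 \<partial>lborel) < inverse (real (Suc n))"
      unfolding P_def by blast
    have "r m \<ge> N" if "m \<ge> N" for m using seq_suble[OF r, of m] that by simp
    with N show "P n (s \<circ> r)" unfolding P_def comp_def by blast
  qed
  show ?thesis
  proof (intro exI[of _ diagseq] conjI subseq_diagseq allI impI)
    fix e :: real assume "e > 0"
    then obtain k where k: "inverse (real (Suc k)) < e" using reals_Archimedean by blast
    obtain N where N: "\<And>m n. m \<ge> N \<Longrightarrow> n \<ge> N \<Longrightarrow>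
        (\<integral>x. (v (diagseq (Suc k + m)) x - v (diagseq (Suc k + n)) x)\<^sup>2 \<partial>lborel) < inverse (real (Suc k))"
      using P[of k] unfolding P_def comp_def by blast
    show "\<exists>N. \<forall>m\<ge>N. \<forall>n\<ge>N. (\<integral>x. (v (diagseq m) x - v (diagseq n) x)\<^sup>2 \<partial>lborel) < e"
    proof (intro exI[of _ "Suc k + N"] allI impI)
      fix m n assume "Suc k + N \<le> m" "Suc k + N \<le> n"
      then have "N \<le> m - Suc k" "N \<le> n - Suc k" "Suc k + (m - Suc k) = m" "Suc k + (n - Suc k) = n"
        by auto
      with N[of "m - Suc k" "n - Suc k"] k
      show "(\<integral>x. (v (diagseq m) x - v (diagseq n) x)\<^sup>2 \<partial>lborel) < e"
        by (metis order_less_trans)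
    qed
  qed
qed

subsection \<open>Dominated convergence in mean square\<close>

text \<open>Convergence almost everywhere under a common square-integrable bound, which every sequence
  converging fast enough in \<open>L\<^sup>2\<close> satisfies.\<close>

definition dominated_L2_limit ::
    "'a measure \<Rightarrow> (nat \<Rightarrow> 'a \<Rightarrow> 'b::euclidean_space) \<Rightarrow> ('a \<Rightarrow> 'b) \<Rightarrow> bool" where
  "dominated_L2_limit M f F \<longleftrightarrow>
     (\<forall>n. f n \<in> borel_measurable M) \<and> F \<in> borel_measurable M \<and>
     (\<exists>g. g \<in> borel_measurable M \<and> integrable M (\<lambda>x. (g x)\<^sup>2) \<and>
        (AE x in M. (\<lambda>n. f n x) \<longlonglongrightarrow> F x) \<and> (\<forall>n. AE x in M. norm (f n x) \<le> g x))"

lemma dominated_L2_limitE: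
  assumes "dominated_L2_limit M f F"
  obtains g where "g \<in> borel_measurable M" "integrable M (\<lambda>x. (g x)\<^sup>2)"
    "AE x in M. (\<lambda>n. f n x) \<longlonglongrightarrow> F x" "\<And>n. AE x in M. norm (f n x) \<le> g x"
    "AE x in M. norm (F x) \<le> g x" "\<And>n. f n \<in> borel_measurable M" "F \<in> borel_measurable M"
proof -
  from assms obtain g where g: "g \<in> borel_measurable M" "integrable M (\<lambda>x. (g x)\<^sup>2)"
    "AE x in M. (\<lambda>n. f n x) \<longlonglongrightarrow> F x" "\<And>n. AE x in M. norm (f n x) \<le> g x"
    and m: "\<And>n. f n \<in> borel_measurable M" "F \<in> borel_measurable M"
    unfolding dominated_L2_limit_def by blast
  have "AE x in M. \<forall>n. norm (f n x) \<le> g x" using g(4) by (simp add: AE_all_countable)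
  with g(3) have "AE x in M. norm (F x) \<le> g x"
  proof eventually_elim
    case (elim x)
    show ?case by (rule LIMSEQ_le_const2[OF tendsto_norm[OF elim(1)]]) (use elim(2) in blast)
  qed
  with g m that show ?thesis by blast
qed

lemma dominated_L2_limit_const:
  assumes "F \<in> borel_measurable M" "integrable M (\<lambda>x. (norm (F x))\<^sup>2)"
  shows "dominated_L2_limit M (\<lambda>n. F) F"
  unfolding dominated_L2_limit_def
  using assms by (auto intro!: exI[of _ "\<lambda>x. norm (F x)"])

text \<open>The product of the two majorants is integrable by Cauchy-Schwarz, so ordinary dominated
  convergence applies. All limits of bilinear expressions below come from here, with constant
  sequences standing for fixed factors.\<close>

lemma dominated_L2_limit_inner:
  assumes "dominated_L2_limit M f F" "dominated_L2_limit M f' F'"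
  shows "integrable M (\<lambda>x. F x \<bullet> F' x)"
    and "(\<lambda>n. \<integral>x. f n x \<bullet> f' n x \<partial>M) \<longlonglongrightarrow> (\<integral>x. F x \<bullet> F' x \<partial>M)"
proof -
  obtain g where g: "g \<in> borel_measurable M" "integrable M (\<lambda>x. (g x)\<^sup>2)"
    "AE x in M. (\<lambda>n. f n x) \<longlonglongrightarrow> F x" "\<And>n. AE x in M. norm (f n x) \<le> g x"
    "AE x in M. norm (F x) \<le> g x" "\<And>n. f n \<in> borel_measurable M" "F \<in> borel_measurable M"
    by (rule dominated_L2_limitE[OF assms(1)]) blast
  obtain g' where g': "g' \<in> borel_measurable M" "integrable M (\<lambda>x. (g' x)\<^sup>2)"
    "AE x in M. (\<lambda>n. f' n x) \<longlonglongrightarrow> F' x" "\<And>n. AE x in M. norm (f' n x) \<le> g' x"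
    "AE x in M. norm (F' x) \<le> g' x" "\<And>n. f' n \<in> borel_measurable M" "F' \<in> borel_measurable M"
    by (rule dominated_L2_limitE[OF assms(2)]) blast
  note [measurable] = g(1,6,7) g'(1,6,7)
  have i: "integrable M (\<lambda>x. g x * g' x)"
    by (rule integral_Cauchy_Schwarz(1)[OF g(1) g'(1) g(2) g'(2)])
  have b: "norm (a \<bullet> b) \<le> c * d" if "norm a \<le> c" "norm b \<le> d" for a b :: 'b and c d
  proof -
    have "norm (a \<bullet> b) \<le> norm a * norm b" by (simp add: Cauchy_Schwarz_ineq2)
    also have "\<dots> \<le> c * d" using that by (intro mult_mono) (auto intro: order_trans[OF norm_ge_zero])
    finally show ?thesis .
  qed
  show "(\<lambda>n. \<integral>x. f n x \<bullet> f' n x \<partial>M) \<longlonglongrightarrow> (\<integral>x. F x \<bullet> F' x \<partial>M)"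
  proof (rule integral_dominated_convergence[OF _ _ i])
    show "AE x in M. (\<lambda>n. f n x \<bullet> f' n x) \<longlonglongrightarrow> F x \<bullet> F' x"
      using g(3) g'(3) by eventually_elim (rule tendsto_inner)
    show "AE x in M. norm (f n x \<bullet> f' n x) \<le> g x * g' x" for n
      using g(4)[of n] g'(4)[of n] by eventually_elim (rule b)
  qed (measurable)
  show "integrable M (\<lambda>x. F x \<bullet> F' x)"
  proof (rule Bochner_Integration.integrable_bound[OF i])
    show "AE x in M. norm (F x \<bullet> F' x) \<le> norm (g x * g' x)"
      using g(5) g'(5)
    proof eventually_elim
      case (elim x)
      show ?case by (rule order_trans[OF b[OF elim]]) simp
    qed
  qed measurable
qed

lemma dominated_L2_limit_norm:
  assumes "dominated_L2_limit M f F"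
  shows "integrable M (\<lambda>x. (norm (F x))\<^sup>2)"
    and "(\<lambda>n. \<integral>x. (norm (f n x))\<^sup>2 \<partial>M) \<longlonglongrightarrow> (\<integral>x. (norm (F x))\<^sup>2 \<partial>M)"
  using dominated_L2_limit_inner[OF assms assms] by (simp_all add: power2_norm_eq_inner)

text \<open>Carries the chain-rule factors, such as \<open>\<psi> (\<phi> n x)\<close>, to the limit
  together with the gradients that they multiply.\<close>

lemma dominated_L2_limit_scaleR:
  fixes c :: "nat \<Rightarrow> 'a \<Rightarrow> real"
  assumes "dominated_L2_limit M f F" "\<And>n. c n \<in> borel_measurable M" "C \<in> borel_measurable M"
    "AE x in M. (\<lambda>n. c n x) \<longlonglongrightarrow> C x" "\<And>n x. \<bar>c n x\<bar> \<le> B"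
  shows "dominated_L2_limit M (\<lambda>n x. c n x *\<^sub>R f n x) (\<lambda>x. C x *\<^sub>R F x)"
proof -
  obtain g where g: "g \<in> borel_measurable M" "integrable M (\<lambda>x. (g x)\<^sup>2)"
    "AE x in M. (\<lambda>n. f n x) \<longlonglongrightarrow> F x" "\<And>n. AE x in M. norm (f n x) \<le> g x"
    "AE x in M. norm (F x) \<le> g x" "\<And>n. f n \<in> borel_measurable M" "F \<in> borel_measurable M"
    by (rule dominated_L2_limitE[OF assms(1)]) blast
  show ?thesis unfolding dominated_L2_limit_def
  proof (intro conjI allI exI[of _ "\<lambda>x. B * g x"])
    show "integrable M (\<lambda>x. (B * g x)\<^sup>2)" using g(2) by (simp add: power_mult_distrib)
    show "AE x in M. (\<lambda>n. c n x *\<^sub>R f n x) \<longlonglongrightarrow> C x *\<^sub>R F x"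
      using assms(4) g(3) by eventually_elim (rule tendsto_scaleR)
    show "AE x in M. norm (c n x *\<^sub>R f n x) \<le> B * g x" for n
      using g(4)[of n]
    proof eventually_elim
      case (elim x)
      have "B \<ge> 0" using order_trans[OF abs_ge_zero assms(5)] .
      then have "\<bar>c n x\<bar> * norm (f n x) \<le> B * g x" by (intro mult_mono assms(5) elim) auto
      then show ?case by simp
    qed
  qed (use assms g in auto)
qed

lemma dominated_L2_limit_compose:
  fixes T :: "real \<Rightarrow> real"
  assumes "dominated_L2_limit M f F" "continuous_on UNIV T" "\<And>s. \<bar>T s\<bar> \<le> \<bar>s\<bar>"
  shows "dominated_L2_limit M (\<lambda>n x. T (f n x)) (\<lambda>x. T (F x))"
proof -
  obtain g where g: "g \<in> borel_measurable M" "integrable M (\<lambda>x. (g x)\<^sup>2)"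
    "AE x in M. (\<lambda>n. f n x) \<longlonglongrightarrow> F x" "\<And>n. AE x in M. norm (f n x) \<le> g x"
    "AE x in M. norm (F x) \<le> g x" "\<And>n. f n \<in> borel_measurable M" "F \<in> borel_measurable M"
    by (rule dominated_L2_limitE[OF assms(1)]) blast
  note T = borel_measurable_continuous_onI[OF assms(2)]
  show ?thesis unfolding dominated_L2_limit_def
  proof (intro conjI allI exI[of _ g])
    show "AE x in M. (\<lambda>n. T (f n x)) \<longlonglongrightarrow> T (F x)"
      using g(3)
    proof eventually_elim
      case (elim x)
      have "isCont T (F x)" using assms(2) by (simp add: continuous_on_eq_continuous_at)
      then show ?case using elim by (rule isCont_tendsto_compose)
    qed
    show "AE x in M. norm (T (f n x)) \<le> g x" for n
      using g(4)[of n] by eventually_elim (use assms(3) in \<open>auto intro: order_trans\<close>)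
  qed (use g T in \<open>auto intro: measurable_compose[OF _ T]\<close>)
qed

text \<open>The rate \<open>(1 / 8) ^ n\<close> is split in two. Weighting the squares by
  \<open>4 ^ n\<close> still leaves summable integrals \<open>(1 / 2) ^ n\<close>, so the weighted
  sum \<open>H\<close> is finite almost everywhere; and each weighted square is at most
  \<open>H\<close>, which after taking roots is pointwise decay at rate \<open>(1 / 2) ^ n\<close>
  with \<open>g = sqrt H\<close>.\<close>

lemma fast_L2_bound:
  fixes d :: "nat \<Rightarrow> 'a \<Rightarrow> 'b::euclidean_space"
  assumes [measurable]: "\<And>n. d n \<in> borel_measurable M"
    and int: "\<And>n. integrable M (\<lambda>x. (norm (d n x))\<^sup>2)"
    and le: "\<And>n. (\<integral>x. (norm (d n x))\<^sup>2 \<partial>M) \<le> (1 / 8) ^ n"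
  obtains g where "g \<in> borel_measurable M" "integrable M (\<lambda>x. (g x)\<^sup>2)"
    "AE x in M. 0 \<le> g x \<and> (\<forall>n. norm (d n x) \<le> g x * (1 / 2) ^ n)"
proof -
  define t where "t n x = 4 ^ n * (norm (d n x))\<^sup>2" for n x
  have [measurable]: "t n \<in> borel_measurable M" for n unfolding t_def by measurable
  have t0: "t n x \<ge> 0" for n x by (simp add: t_def)
  have it: "integrable M (t n)" for n unfolding t_def using int by simp
  have et: "(\<integral>x. t n x \<partial>M) \<le> (1 / 2) ^ n" for n
  proof -
    have "(\<integral>x. t n x \<partial>M) = 4 ^ n * (\<integral>x. (norm (d n x))\<^sup>2 \<partial>M)" unfolding t_def by simp
    also have "\<dots> \<le> 4 ^ n * (1 / 8) ^ n" by (rule mult_left_mono[OF le]) simp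
    also have "\<dots> = (1 / 2) ^ n" by (simp add: power_mult_distrib[symmetric])
    finally show ?thesis .
  qed
  have sum: "summable (\<lambda>n. \<integral>x. t n x \<partial>M)"
  proof (rule summable_comparison_test')
    show "summable (\<lambda>n. (1 / 2 :: real) ^ n)" by (rule summable_geometric) simp
    show "norm (\<integral>x. t n x \<partial>M) \<le> (1 / 2) ^ n" if "n \<ge> 0" for n
      using et[of n] t0 by simp
  qed
  have "(\<integral>\<^sup>+x. (\<Sum>n. ennreal (t n x)) \<partial>M) = (\<Sum>n. \<integral>\<^sup>+x. ennreal (t n x) \<partial>M)"
    by (rule nn_integral_suminf) measurable
  also have "\<dots> = (\<Sum>n. ennreal (\<integral>x. t n x \<partial>M))"
    by (intro suminf_cong nn_integral_eq_integral it) (use t0 in auto)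
  also have "\<dots> = ennreal (\<Sum>n. \<integral>x. t n x \<partial>M)"
    by (rule suminf_ennreal2[OF _ sum]) (use t0 in simp)
  finally have fin: "(\<integral>\<^sup>+x. (\<Sum>n. ennreal (t n x)) \<partial>M) \<noteq> \<infinity>" by simp
  have "AE x in M. (\<Sum>n. ennreal (t n x)) \<noteq> \<infinity>"
    by (rule nn_integral_noteq_infinite[OF _ fin]) measurable
  then have sm: "AE x in M. summable (\<lambda>n. t n x)"
    by eventually_elim (rule summable_suminf_not_top; use t0 in simp)
  define H where "H x = (\<Sum>n. t n x)" for x
  have [measurable]: "H \<in> borel_measurable M" unfolding H_def by measurable
  have iH: "integrable M H" unfolding H_def
    by (rule integrable_suminf[OF it]) (use sm sum t0 in auto)
  have H0: "AE x in M. H x \<ge> 0" using sm by eventually_elim (simp add: H_def suminf_nonneg t0)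
  show ?thesis
  proof
    show "(\<lambda>x. sqrt (H x)) \<in> borel_measurable M" by measurable
    show "integrable M (\<lambda>x. (sqrt (H x))\<^sup>2)"
      proof (rule integrable_cong_AE_imp[OF iH])
      show "AE x in M. H x = (sqrt (H x))\<^sup>2" using H0 by eventually_elim simp
    qed measurable
    show "AE x in M. 0 \<le> sqrt (H x) \<and> (\<forall>n. norm (d n x) \<le> sqrt (H x) * (1 / 2) ^ n)"
      using sm H0
    proof eventually_elim
      case (elim x)
      have "norm (d n x) \<le> sqrt (H x) * (1 / 2) ^ n" for n
      proof -
        have "t n x \<le> H x" unfolding H_def
          using sum_le_suminf[OF elim(1), of "{n}"] t0 by simp
        then have "sqrt (t n x) \<le> sqrt (H x)" by simp
        moreover have "sqrt (t n x) = 2 ^ n * norm (d n x)"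
        proof -
          have "(2::real) ^ n * 2 ^ n = 4 ^ n" by (simp add: power_mult_distrib[symmetric])
          then have "t n x = (2 ^ n * norm (d n x))\<^sup>2" by (simp add: t_def power2_eq_square algebra_simps)
          then show ?thesis by simp
        qed
        ultimately show ?thesis by (simp add: field_simps)
      qed
      with elim show ?case by simp
    qed
  qed
qed

lemma dominated_L2_limitI:
  fixes f :: "nat \<Rightarrow> 'a \<Rightarrow> 'b::euclidean_space"
  assumes [measurable]: "\<And>n. f n \<in> borel_measurable M" "F \<in> borel_measurable M"
    and F: "integrable M (\<lambda>x. (norm (F x))\<^sup>2)"
    and int: "\<And>n. integrable M (\<lambda>x. (norm (f n x - F x))\<^sup>2)"
    and le: "\<And>n. (\<integral>x. (norm (f n x - F x))\<^sup>2 \<partial>M) \<le> (1 / 8) ^ n"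
  shows "dominated_L2_limit M f F"
proof -
  obtain g where g: "g \<in> borel_measurable M" "integrable M (\<lambda>x. (g x)\<^sup>2)"
    "AE x in M. 0 \<le> g x \<and> (\<forall>n. norm (f n x - F x) \<le> g x * (1 / 2) ^ n)"
    by (rule fast_L2_bound[of "\<lambda>n x. f n x - F x" M]) (use int le in auto)
  note [measurable] = g(1)
  show ?thesis unfolding dominated_L2_limit_def
  proof (intro conjI allI exI[of _ "\<lambda>x. norm (F x) + g x"])
    have "integrable M (\<lambda>x. norm (F x) * g x)"
      by (rule integral_Cauchy_Schwarz(1)) (use F g in auto)
    then show "integrable M (\<lambda>x. (norm (F x) + g x)\<^sup>2)"
      using F g(2) by (simp add: power2_sum mult.assoc)
    show "AE x in M. (\<lambda>n. f n x) \<longlonglongrightarrow> F x"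
      using g(3)
    proof eventually_elim
      case (elim x)
      have "(\<lambda>n. g x * (1 / 2) ^ n) \<longlonglongrightarrow> g x * 0" by (intro tendsto_intros LIMSEQ_realpow_zero) auto
      then have "(\<lambda>n. f n x - F x) \<longlonglongrightarrow> 0"
        by (intro Lim_null_comparison[of "\<lambda>n. f n x - F x" "\<lambda>n. g x * (1 / 2) ^ n"]) (use elim in auto)
      then show ?case by (simp add: LIM_zero_iff)
    qed
    show "AE x in M. norm (f n x) \<le> norm (F x) + g x" for n
      using g(3)
    proof eventually_elim
      case (elim x)
      have "norm (f n x) \<le> norm (F x) + norm (f n x - F x)"
        using norm_triangle_ineq[of "F x" "f n x - F x"] by simp
      also have "norm (f n x - F x) \<le> g x * 1"
        by (rule order_trans[OF conjunct2[OF elim, rule_format] mult_left_mono])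
           (use elim in \<open>auto intro: power_le_one\<close>)
      finally show ?case by simp
    qed
  qed measurable
qed

text \<open>The Riesz-Fischer argument, keeping the majorant: the increments are dominated by a
  geometric series with sum \<open>2 * g\<close>. On the null set without convergence
  \<open>lim\<close> has arbitrary values, yet the function is measurable.\<close>

lemma fast_Cauchy_dominated_L2_limit:
  fixes f :: "nat \<Rightarrow> 'a \<Rightarrow> 'b::euclidean_space"
  assumes [measurable]: "\<And>n. f n \<in> borel_measurable M"
    and sq: "\<And>n. integrable M (\<lambda>x. (norm (f n x))\<^sup>2)"
    and int: "\<And>n. integrable M (\<lambda>x. (norm (f (Suc n) x - f n x))\<^sup>2)"
    and le: "\<And>n. (\<integral>x. (norm (f (Suc n) x - f n x))\<^sup>2 \<partial>M) \<le> (1 / 8) ^ n"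
  shows "\<exists>F. dominated_L2_limit M f F"
proof -
  obtain g where g: "g \<in> borel_measurable M" "integrable M (\<lambda>x. (g x)\<^sup>2)"
    "AE x in M. 0 \<le> g x \<and> (\<forall>n. norm (f (Suc n) x - f n x) \<le> g x * (1 / 2) ^ n)"
    by (rule fast_L2_bound[of "\<lambda>n x. f (Suc n) x - f n x" M]) (use int le in auto)
  note [measurable] = g(1)
  have "AE x in M. (\<lambda>n. f n x) \<longlonglongrightarrow> lim (\<lambda>n. f n x) \<and> (\<forall>n. norm (f n x) \<le> norm (f 0 x) + 2 * g x)"
    using g(3)
  proof eventually_elim
    case (elim x)
    have geo: "summable (\<lambda>n. g x * (1 / 2) ^ n)" by (intro summable_mult summable_geometric) auto
    have "summable (\<lambda>n. f (Suc n) x - f n x)"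
      by (rule summable_comparison_test'[OF geo, of 0]) (use elim in auto)
    then have "convergent (\<lambda>n. \<Sum>k<n. f (Suc k) x - f k x)" by (simp add: summable_iff_convergent)
    moreover have "(\<Sum>k<n. f (Suc k) x - f k x) = f n x - f 0 x" for n
      by (rule sum_lessThan_telescope)
    ultimately have "convergent (\<lambda>n. f n x - f 0 x)" by simp
    then have "convergent (\<lambda>n. f n x)" 
      using convergent_add[of "\<lambda>n. f n x - f 0 x" "\<lambda>n. f 0 x"] by (simp add: convergent_const)
    moreover have "norm (f n x) \<le> norm (f 0 x) + 2 * g x" for n
    proof -
      have "norm (f n x - f 0 x) = norm (\<Sum>k<n. f (Suc k) x - f k x)"
        by (subst sum_lessThan_telescope) simp
      also have "\<dots> \<le> (\<Sum>k<n. g x * (1 / 2) ^ k)" by (rule sum_norm_le) (use elim in auto)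
      also have "\<dots> \<le> (\<Sum>k. g x * (1 / 2) ^ k)"
        by (rule sum_le_suminf[OF geo]) (use elim in auto)
      also have "\<dots> = 2 * g x" using suminf_geometric[of "1 / 2 :: real"] by (simp add: suminf_mult)
      finally show ?thesis using norm_triangle_ineq[of "f 0 x" "f n x - f 0 x"] by simp
    qed
    ultimately show ?case by (simp add: convergent_LIMSEQ_iff)
  qed
  note AE' = this
  have AE: "AE x in M. (\<lambda>n. f n x) \<longlonglongrightarrow> lim (\<lambda>n. f n x)"
    using AE' by eventually_elim blast
  have AEb: "AE x in M. norm (f n x) \<le> norm (f 0 x) + 2 * g x" for n
    using AE' by eventually_elim blast
  have "integrable M (\<lambda>x. norm (f 0 x) * g x)"
    by (rule integral_Cauchy_Schwarz(1)) (use sq g in auto)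
  then have "integrable M (\<lambda>x. (norm (f 0 x) + 2 * g x)\<^sup>2)"
    using sq g(2) by (simp add: power2_sum power_mult_distrib mult.assoc mult.left_commute)
  moreover have "(\<lambda>x. lim (\<lambda>n. f n x)) \<in> borel_measurable M"
    by (rule borel_measurable_lim_metric) (rule assms(1))
  ultimately show ?thesis unfolding dominated_L2_limit_def
    using AE AEb assms(1) by (intro exI[of _ "\<lambda>x. lim (\<lambda>n. f n x)"] conjI exI[of _ "\<lambda>x. norm (f 0 x) + 2 * g x"]
        allI) simp_all
qed

subsection \<open>Weak gradients and the first eigenvalue\<close>

text \<open>Completeness of Lebesgue measure. It makes \<open>weak_gradient\<close>, an arbitrary
  choice, measurable as soon as one weak gradient is.\<close>

lemma borel_measurable_lebesgue_on_AE_eq: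
  fixes f g :: "'a::euclidean_space \<Rightarrow> 'b::euclidean_space"
  assumes "S \<in> sets lebesgue" "f \<in> borel_measurable (lebesgue_on S)" "AE x in lebesgue_on S. f x = g x"
  shows "g \<in> borel_measurable (lebesgue_on S)"
proof -
  obtain N where N: "{x \<in> space (lebesgue_on S). f x \<noteq> g x} \<subseteq> N"
    "emeasure (lebesgue_on S) N = 0" "N \<in> sets (lebesgue_on S)"
    using AE_E[OF assms(3)] by blast
  then have null: "N \<in> null_sets (lebesgue_on S)" by auto
  have "f \<in> borel_measurable (lebesgue_on (S - N))"
    using borel_measurable_diff_null[OF null assms(1), of f] assms(2) by simp
  moreover have "f x = g x" if "x \<in> space (lebesgue_on (S - N))" for x using N(1) that by auto
  ultimately have "g \<in> borel_measurable (lebesgue_on (S - N))" by (subst (asm) measurable_cong) auto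
  then show ?thesis using borel_measurable_diff_null[OF null assms(1), of g] by simp
qed

lemma test_lebesgue_on:
  assumes "open \<Omega>" "\<phi> \<in> test_functions \<Omega>"
  shows "\<phi> \<in> borel_measurable (lebesgue_on \<Omega>)" "grad \<phi> \<in> borel_measurable (lebesgue_on \<Omega>)"
    and "integrable (lebesgue_on \<Omega>) (\<lambda>x. (\<phi> x)\<^sup>2)" "integrable (lebesgue_on \<Omega>) (\<lambda>x. (norm (grad \<phi> x))\<^sup>2)"
    and "(\<integral>x. (\<phi> x)\<^sup>2 \<partial>lebesgue_on \<Omega>) = (\<integral>x. (\<phi> x)\<^sup>2 \<partial>lborel)"
    and "(\<integral>x. (norm (grad \<phi> x))\<^sup>2 \<partial>lebesgue_on \<Omega>) = (\<integral>x. (norm (grad \<phi> x))\<^sup>2 \<partial>lborel)"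
proof -
  note m = test_measurable[OF assms(2)]
  have z: "(\<phi> x)\<^sup>2 = 0" "(norm (grad \<phi> x))\<^sup>2 = 0" if "x \<notin> \<Omega>" for x
    using test_functions_eq_0[OF assms(2) that] grad_eq_0[OF assms(2) that] by simp_all
  show "\<phi> \<in> borel_measurable (lebesgue_on \<Omega>)" "grad \<phi> \<in> borel_measurable (lebesgue_on \<Omega>)"
    by (intro continuous_lebesgue_on_measurable assms test_continuous[OF assms(2)])+
  have m2: "(\<lambda>x. (\<phi> x)\<^sup>2) \<in> borel_measurable borel" "(\<lambda>x. (norm (grad \<phi> x))\<^sup>2) \<in> borel_measurable borel"
    using m by auto
  show "integrable (lebesgue_on \<Omega>) (\<lambda>x. (\<phi> x)\<^sup>2)" "integrable (lebesgue_on \<Omega>) (\<lambda>x. (norm (grad \<phi> x))\<^sup>2)"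
    "(\<integral>x. (\<phi> x)\<^sup>2 \<partial>lebesgue_on \<Omega>) = (\<integral>x. (\<phi> x)\<^sup>2 \<partial>lborel)"
    "(\<integral>x. (norm (grad \<phi> x))\<^sup>2 \<partial>lebesgue_on \<Omega>) = (\<integral>x. (norm (grad \<phi> x))\<^sup>2 \<partial>lborel)"
    using lebesgue_on_eq_lborel[OF assms(1) m2(1) z(1)] lebesgue_on_eq_lborel[OF assms(1) m2(2) z(2)]
      test_square_integrable[OF assms(2)] by auto
qed

lemma weak_gradient_AE:
  assumes "open \<Omega>" "has_weak_gradient \<Omega> u G"
  shows "AE x in lebesgue_on \<Omega>. G x = weak_gradient \<Omega> u x"
  unfolding weak_gradient_def
  by (rule has_weak_gradient_unique[OF assms]) (rule someI[of "has_weak_gradient \<Omega> u", OF assms(2)])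

lemma weak_gradient_square:
  assumes "open \<Omega>" "has_weak_gradient \<Omega> u G" "square_integrable \<Omega> G"
  shows "square_integrable \<Omega> (weak_gradient \<Omega> u)"
    and "(\<integral>x. (norm (weak_gradient \<Omega> u x))\<^sup>2 \<partial>lebesgue_on \<Omega>) = (\<integral>x. (norm (G x))\<^sup>2 \<partial>lebesgue_on \<Omega>)"
proof -
  note AE = weak_gradient_AE[OF assms(1,2)]
  have G: "G \<in> borel_measurable (lebesgue_on \<Omega>)" "integrable (lebesgue_on \<Omega>) (\<lambda>x. (norm (G x))\<^sup>2)"
    using assms(3) by (auto simp: square_integrable_def)
  have m: "weak_gradient \<Omega> u \<in> borel_measurable (lebesgue_on \<Omega>)"
    by (rule borel_measurable_lebesgue_on_AE_eq[OF _ G(1) AE]) (use assms(1) in auto)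
  have AE2: "AE x in lebesgue_on \<Omega>. (norm (G x))\<^sup>2 = (norm (weak_gradient \<Omega> u x))\<^sup>2"
    using AE by eventually_elim simp
  have m2: "(\<lambda>x. (norm (weak_gradient \<Omega> u x))\<^sup>2) \<in> borel_measurable (lebesgue_on \<Omega>)" using m by simp
  show "square_integrable \<Omega> (weak_gradient \<Omega> u)"
    using m integrable_cong_AE_imp[OF G(2) m2 AE2] by (simp add: square_integrable_def)
  show "(\<integral>x. (norm (weak_gradient \<Omega> u x))\<^sup>2 \<partial>lebesgue_on \<Omega>) = (\<integral>x. (norm (G x))\<^sup>2 \<partial>lebesgue_on \<Omega>)"
    by (rule integral_cong_AE[symmetric, OF borel_measurable_integrable[OF G(2)] m2 AE2])
qed

lemma H1_D:
  assumes "open \<Omega>" "u \<in> H1 \<Omega>"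
  shows "square_integrable \<Omega> u" "square_integrable \<Omega> (weak_gradient \<Omega> u)"
    "has_weak_gradient \<Omega> u (weak_gradient \<Omega> u)"
proof -
  obtain G where G: "has_weak_gradient \<Omega> u G" "square_integrable \<Omega> G" and "square_integrable \<Omega> u"
    using assms(2) by (auto simp: H1_def)
  then show "square_integrable \<Omega> u" "square_integrable \<Omega> (weak_gradient \<Omega> u)"
    using weak_gradient_square[OF assms(1)] by auto
  show "has_weak_gradient \<Omega> u (weak_gradient \<Omega> u)"
    unfolding weak_gradient_def by (rule someI[of "has_weak_gradient \<Omega> u", OF G(1)])
qed

lemma test_square_integrable_on:
  assumes "open \<Omega>" "\<phi> \<in> test_functions \<Omega>"
  shows "square_integrable \<Omega> \<phi>" "square_integrable \<Omega> (grad \<phi>)"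
  using test_lebesgue_on[OF assms] by (auto simp: square_integrable_def)

text \<open>The chosen weak gradient of 0 vanishes only almost everywhere, so the claim goes through
  the classical gradient.\<close>

lemma H1_norm_zero:
  fixes \<Omega> :: "'a::euclidean_space set"
  assumes "open \<Omega>"
  shows "H1_norm \<Omega> (\<lambda>x. 0) = 0"
proof -
  have z: "(\<lambda>x. 0) \<in> test_functions \<Omega>" by (rule test_functionsI[of _ "{}"]) (auto intro: smooth_const)
  have "grad (\<lambda>x. 0) = (\<lambda>x::'a. 0)" by (intro ext gradI) auto
  then show ?thesis
    using weak_gradient_square(2)[OF assms has_weak_gradient_test[OF assms z] test_square_integrable_on(2)[OF assms z]]
    by (simp add: H1_norm_def)
qed

lemma test_H1_0:
  assumes "open \<Omega>" "\<phi> \<in> test_functions \<Omega>"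
  shows "\<phi> \<in> H1_0 \<Omega>"
  unfolding H1_0_def H1_def
proof (intro CollectI conjI allI impI)
  show "square_integrable \<Omega> \<phi>" by (rule test_square_integrable_on[OF assms])
  show "\<exists>G. has_weak_gradient \<Omega> \<phi> G \<and> square_integrable \<Omega> G"
    using has_weak_gradient_test[OF assms] test_square_integrable_on[OF assms] by blast
  show "\<exists>\<eta>\<in>test_functions \<Omega>. H1_norm \<Omega> (\<lambda>x. \<phi> x - \<eta> x) < \<epsilon>" if "\<epsilon> > 0" for \<epsilon>
    by (rule bexI[OF _ assms(2)]) (use that H1_norm_zero[OF assms(1)] in simp)
qed

lemma has_weak_gradient_diff_test:
  assumes "open \<Omega>" "has_weak_gradient \<Omega> u G" and \<phi>: "\<phi> \<in> test_functions \<Omega>"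
  shows "has_weak_gradient \<Omega> (\<lambda>x. u x - \<phi> x) (\<lambda>x. G x - grad \<phi> x)"
proof -
  note wg = assms(2)[unfolded has_weak_gradient_def] has_weak_gradient_test[OF assms(1) \<phi>, unfolded has_weak_gradient_def]
  have li: "locally_integrable \<Omega> u" "locally_integrable \<Omega> G" "locally_integrable \<Omega> \<phi>" "locally_integrable \<Omega> (grad \<phi>)"
    using wg by auto
  show ?thesis unfolding has_weak_gradient_def
  proof (intro conjI ballI)
    show "locally_integrable \<Omega> (\<lambda>x. u x - \<phi> x)" "locally_integrable \<Omega> (\<lambda>x. G x - grad \<phi> x)"
      using li by (auto simp: locally_integrable_def)
  next
    fix \<eta> and b :: 'a assume \<eta>: "\<eta> \<in> test_functions \<Omega>" and b: "b \<in> Basis"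
    have pd: "(\<lambda>x. frechet_derivative \<eta> (at x) b) \<in> test_functions \<Omega>"
      unfolding frechet_derivative_eq_grad[OF test_functionsD(1)[OF \<eta>]] by (rule test_functions_pd[OF \<eta> b])
    have lib: "locally_integrable \<Omega> (\<lambda>x. G x \<bullet> b)" "locally_integrable \<Omega> (\<lambda>x. grad \<phi> x \<bullet> b)"
      using li by (auto simp: locally_integrable_def)
    have eqs: "(\<integral>x. u x * frechet_derivative \<eta> (at x) b \<partial>lebesgue_on \<Omega>) = - (\<integral>x. (G x \<bullet> b) * \<eta> x \<partial>lebesgue_on \<Omega>)"
      "(\<integral>x. \<phi> x * frechet_derivative \<eta> (at x) b \<partial>lebesgue_on \<Omega>) = - (\<integral>x. (grad \<phi> x \<bullet> b) * \<eta> x \<partial>lebesgue_on \<Omega>)"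
      using wg \<eta> b by auto
    show "(\<integral>x. (u x - \<phi> x) * frechet_derivative \<eta> (at x) b \<partial>lebesgue_on \<Omega>) =
        - (\<integral>x. ((G x - grad \<phi> x) \<bullet> b) * \<eta> x \<partial>lebesgue_on \<Omega>)"
      using locally_integrable_mult_test[OF assms(1) li(1) pd] locally_integrable_mult_test[OF assms(1) li(3) pd]
        locally_integrable_mult_test[OF assms(1) lib(1) \<eta>] locally_integrable_mult_test[OF assms(1) lib(2) \<eta>]
      by (simp add: left_diff_distrib inner_diff_left eqs)
  qed
qed

text \<open>The approximation error \<open>sqrt ((1 / 8) ^ n)\<close> is tailored to
  \<open>dominated_L2_limitI\<close>, so one sequence converges with majorants both for the
  functions and for the gradients. Everything later about functions in \<open>H1_0\<close> is drawn
  from this.\<close>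

lemma H1_0_approx:
  assumes "open \<Omega>" "u \<in> H1_0 \<Omega>"
  obtains \<phi> where "\<And>n. \<phi> n \<in> test_functions \<Omega>" "dominated_L2_limit (lebesgue_on \<Omega>) \<phi> u"
    "dominated_L2_limit (lebesgue_on \<Omega>) (\<lambda>n. grad (\<phi> n)) (weak_gradient \<Omega> u)"
proof -
  let ?M = "lebesgue_on \<Omega>" let ?G = "weak_gradient \<Omega> u"
  have H1: "u \<in> H1 \<Omega>" using assms(2) by (simp add: H1_0_def)
  note u = H1_D[OF assms(1) H1]
  have "\<exists>\<phi>\<in>test_functions \<Omega>. H1_norm \<Omega> (\<lambda>x. u x - \<phi> x) < sqrt ((1 / 8) ^ n)" for n :: nat
    using assms(2) by (simp add: H1_0_def)
  then obtain \<phi> where \<phi>: "\<And>n. \<phi> n \<in> test_functions \<Omega>"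
    and le: "\<And>n. H1_norm \<Omega> (\<lambda>x. u x - \<phi> n x) < sqrt ((1 / 8) ^ n)" by metis
  have mu: "u \<in> borel_measurable ?M" "integrable ?M (\<lambda>x. (norm (u x))\<^sup>2)"
    and mG: "?G \<in> borel_measurable ?M" "integrable ?M (\<lambda>x. (norm (?G x))\<^sup>2)"
    using u by (auto simp: square_integrable_def)
  note t = test_lebesgue_on[OF assms(1) \<phi>]
  have i: "integrable ?M (\<lambda>x. (norm (\<phi> n x - u x))\<^sup>2)" "integrable ?M (\<lambda>x. (norm (grad (\<phi> n) x - ?G x))\<^sup>2)" for n
    by (intro integrable_norm_diff_square mu mG t; use t in simp)+
  have both: "(\<integral>x. (norm (\<phi> n x - u x))\<^sup>2 \<partial>?M) + (\<integral>x. (norm (grad (\<phi> n) x - ?G x))\<^sup>2 \<partial>?M) \<le> (1 / 8) ^ n" for n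
  proof -
    have sq: "square_integrable \<Omega> (\<lambda>x. ?G x - grad (\<phi> n) x)"
      using i(2)[of n] mG t(2) by (simp add: square_integrable_def norm_minus_commute)
    have "H1_norm \<Omega> (\<lambda>x. u x - \<phi> n x) = sqrt ((\<integral>x. (u x - \<phi> n x)\<^sup>2 \<partial>?M) + (\<integral>x. (norm (?G x - grad (\<phi> n) x))\<^sup>2 \<partial>?M))"
      unfolding H1_norm_def
        weak_gradient_square(2)[OF assms(1) has_weak_gradient_diff_test[OF assms(1) u(3) \<phi>] sq] ..
    then have "(\<integral>x. (u x - \<phi> n x)\<^sup>2 \<partial>?M) + (\<integral>x. (norm (?G x - grad (\<phi> n) x))\<^sup>2 \<partial>?M) < (1 / 8) ^ n"
      using le[of n] by (simp only: real_sqrt_less_iff)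
    then show ?thesis by (simp add: norm_minus_commute power2_commute)
  qed
  show ?thesis
  proof (rule that[OF \<phi>])
    show "dominated_L2_limit ?M \<phi> u"
    proof (rule dominated_L2_limitI[OF t(1) mu i(1)])
      show "(\<integral>x. (norm (\<phi> n x - u x))\<^sup>2 \<partial>?M) \<le> (1 / 8) ^ n" for n
        using both[of n] by (smt (verit) integral_nonneg_AE AE_I2 zero_le_power2)
    qed
    show "dominated_L2_limit ?M (\<lambda>n. grad (\<phi> n)) ?G"
    proof (rule dominated_L2_limitI[OF t(2) mG i(2)])
      show "(\<integral>x. (norm (grad (\<phi> n) x - ?G x))\<^sup>2 \<partial>?M) \<le> (1 / 8) ^ n" for n
        using both[of n] by (smt (verit) integral_nonneg_AE AE_I2 zero_le_power2)
    qed
  qed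
qed

section \<open>Test functions as competitors for the first eigenvalue\<close>

lemma weak_gradient_test_integral:
  assumes "open \<Omega>" "\<phi> \<in> test_functions \<Omega>"
  shows "(\<integral>x. (norm (weak_gradient \<Omega> \<phi> x))\<^sup>2 \<partial>lebesgue_on \<Omega>) = (\<integral>x. (norm (grad \<phi> x))\<^sup>2 \<partial>lebesgue_on \<Omega>)"
  by (rule weak_gradient_square(2)[OF assms(1) has_weak_gradient_test[OF assms] test_square_integrable_on(2)[OF assms]])

lemma first_eigenvalue_le:
  assumes "open \<Omega>" "\<phi> \<in> test_functions \<Omega>"
  shows "first_eigenvalue \<Omega> * (\<integral>x. (\<phi> x)\<^sup>2 \<partial>lebesgue_on \<Omega>) \<le> (\<integral>x. (norm (grad \<phi> x))\<^sup>2 \<partial>lebesgue_on \<Omega>)"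
proof (cases "(\<integral>x. (\<phi> x)\<^sup>2 \<partial>lebesgue_on \<Omega>) = 0")
  case False
  let ?R = "\<lambda>u. (\<integral>x. (norm (weak_gradient \<Omega> u x))\<^sup>2 \<partial>lebesgue_on \<Omega>) / (\<integral>x. (u x)\<^sup>2 \<partial>lebesgue_on \<Omega>)"
  have pos: "(\<integral>x. (\<phi> x)\<^sup>2 \<partial>lebesgue_on \<Omega>) > 0" using False by (simp add: order_less_le)
  have "\<not> (AE x in lebesgue_on \<Omega>. \<phi> x = 0)"
  proof
    assume "AE x in lebesgue_on \<Omega>. \<phi> x = 0"
    then have "AE x in lebesgue_on \<Omega>. (\<phi> x)\<^sup>2 = 0" by eventually_elim simp
    then have "(\<integral>x. (\<phi> x)\<^sup>2 \<partial>lebesgue_on \<Omega>) = 0" by (rule integral_eq_zero_AE)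
    with False show False by simp
  qed
  then have mem: "\<phi> \<in> {u \<in> H1_0 \<Omega>. \<not> (AE x in lebesgue_on \<Omega>. u x = 0)}" using test_H1_0[OF assms] by simp
  have "first_eigenvalue \<Omega> \<le> ?R \<phi>"
    unfolding first_eigenvalue_def
  proof (rule cINF_lower[OF _ mem])
    show "bdd_below (?R ` {u \<in> H1_0 \<Omega>. \<not> (AE x in lebesgue_on \<Omega>. u x = 0)})"
      by (rule bdd_belowI2[of _ 0]) simp
  qed
  then show ?thesis using pos by (simp add: weak_gradient_test_integral[OF assms] field_simps)
qed simp

text \<open>Makes the set in \<open>first_eigenvalue\<close> nonempty, without which its infimum
  could not be approached.\<close>

lemma exists_nonzero_test:
  assumes "open \<Omega>" "\<Omega> \<noteq> {}"
  shows "\<exists>\<phi>\<in>test_functions \<Omega>. \<not> (AE x in lebesgue_on \<Omega>. \<phi> x = 0)"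
proof -
  obtain p where "p \<in> \<Omega>" using assms(2) by blast
  then obtain a b where ab: "p \<in> box a b" "cbox a b \<subseteq> \<Omega>"
    using open_contains_cbox[OF assms(1)] by metis
  obtain \<phi> :: "nat \<Rightarrow> 'a \<Rightarrow> real" where \<phi>: "\<And>n. smooth (\<phi> n)" "\<And>n x. 0 \<le> \<phi> n x \<and> \<phi> n x \<le> 1"
    "\<And>n x. x \<notin> box a b \<Longrightarrow> \<phi> n x = 0" "\<And>n x. x \<in> box a b \<Longrightarrow> \<phi> n x > 0"
    "\<And>x. (\<lambda>n. \<phi> n x) \<longlonglongrightarrow> indicator (box a b) x"
    by (rule box_test_approx[of a b]) blast
  have t: "\<phi> 0 \<in> test_functions \<Omega>"
    by (rule test_functionsI[of _ "cbox a b"])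
       (use \<phi>(1) \<phi>(3)[of _ 0] ab box_subset_cbox[of a b] in \<open>auto simp: subset_eq\<close>)
  have "\<not> (AE x in lebesgue_on \<Omega>. \<phi> 0 x = 0)"
  proof
    assume "AE x in lebesgue_on \<Omega>. \<phi> 0 x = 0"
    then have "AE x in lebesgue. x \<in> \<Omega> \<longrightarrow> \<phi> 0 x = 0"
      using assms(1) by (subst (asm) AE_restrict_space_iff) auto
    then have "AE x in lebesgue. x \<notin> box a b"
      by eventually_elim (use \<phi>(4)[of _ 0] ab box_subset_cbox[of a b] in force)
    then have "box a b \<in> null_sets lebesgue" by (subst AE_iff_null_sets) auto
    then have "negligible (box a b)" by (simp add: negligible_iff_null_sets)
    with ab(1) show False by (auto simp: negligible_interval)
  qed
  with t show ?thesis by blast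
qed

text \<open>With the quotient cleared, being a near minimizer is a strict inequality between
  quantities continuous along \<open>H1_0_approx\<close>, so it passes from a Sobolev function to a
  test function close to it.\<close>

lemma near_minimizer:
  assumes "open \<Omega>" "\<Omega> \<noteq> {}" "e > 0"
  shows "\<exists>\<phi>\<in>test_functions \<Omega>. (\<integral>x. (\<phi> x)\<^sup>2 \<partial>lebesgue_on \<Omega>) > 0 \<and>
    (\<integral>x. (norm (grad \<phi> x))\<^sup>2 \<partial>lebesgue_on \<Omega>) < (first_eigenvalue \<Omega> + e) * (\<integral>x. (\<phi> x)\<^sup>2 \<partial>lebesgue_on \<Omega>)"
proof -
  let ?M = "lebesgue_on \<Omega>" and ?l = "first_eigenvalue \<Omega>"
  let ?E = "\<lambda>w. \<integral>x. (norm (grad w x))\<^sup>2 \<partial>?M" and ?I = "\<lambda>w. \<integral>x. (w x)\<^sup>2 \<partial>?M"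
  let ?S = "{u \<in> H1_0 \<Omega>. \<not> (AE x in ?M. u x = 0)}"
  let ?R = "\<lambda>u. (\<integral>x. (norm (weak_gradient \<Omega> u x))\<^sup>2 \<partial>?M) / (\<integral>x. (u x)\<^sup>2 \<partial>?M)"
  have "?S \<noteq> {}" using exists_nonzero_test[OF assms(1,2)] test_H1_0[OF assms(1)] by blast
  moreover have "Inf (?R ` ?S) < ?l + e" using assms(3) by (simp add: first_eigenvalue_def)
  ultimately obtain w where w: "w \<in> H1_0 \<Omega>" "\<not> (AE x in ?M. w x = 0)" "?R w < ?l + e"
    using cInf_lessD[of "?R ` ?S" "?l + e"] by auto
  obtain \<phi> where \<phi>: "\<And>n. \<phi> n \<in> test_functions \<Omega>" "dominated_L2_limit ?M \<phi> w"
    "dominated_L2_limit ?M (\<lambda>n. grad (\<phi> n)) (weak_gradient \<Omega> w)"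
    by (rule H1_0_approx[OF assms(1) w(1)]) blast
  have wi: "integrable ?M (\<lambda>x. (w x)\<^sup>2)" using dominated_L2_limit_norm(1)[OF \<phi>(2)] by simp
  have "?I w \<noteq> 0"
    using w(2) integral_nonneg_eq_0_iff_AE[OF wi] by auto
  then have pos: "?I w > 0" by (simp add: order_less_le)
  have l1: "(\<lambda>n. \<integral>x. (\<phi> n x)\<^sup>2 \<partial>?M) \<longlonglongrightarrow> ?I w"
    using dominated_L2_limit_norm(2)[OF \<phi>(2)] by simp
  note l2 = dominated_L2_limit_norm(2)[OF \<phi>(3)]
  have "(\<integral>x. (norm (weak_gradient \<Omega> w x))\<^sup>2 \<partial>?M) < (?l + e) * ?I w"
    using w(3) pos by (simp add: divide_less_eq)
  moreover have "(\<lambda>n. (?l + e) * ?I (\<phi> n) - ?E (\<phi> n))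
      \<longlonglongrightarrow> (?l + e) * ?I w - (\<integral>x. (norm (weak_gradient \<Omega> w x))\<^sup>2 \<partial>?M)"
    by (intro tendsto_intros l1 l2)
  ultimately have "eventually (\<lambda>n. (?l + e) * ?I (\<phi> n) - ?E (\<phi> n) > 0) sequentially"
    by (intro order_tendstoD(1)) auto
  moreover have "eventually (\<lambda>n. ?I (\<phi> n) > 0) sequentially"
    using order_tendstoD(1)[OF l1 pos] .
  ultimately have "eventually (\<lambda>n. ?I (\<phi> n) > 0 \<and>
      ?E (\<phi> n) < (?l + e) * ?I (\<phi> n)) sequentially"
    by eventually_elim simp
  then show ?thesis using \<phi>(1) eventually_happens by fastforce
qed

lemma smoothed_abs_bounds:
  fixes t \<eta> :: real
  assumes "\<eta> > 0"
  shows "0 \<le> sqrt (t\<^sup>2 + \<eta>\<^sup>2) - \<eta>" "sqrt (t\<^sup>2 + \<eta>\<^sup>2) - \<eta> \<le> \<bar>t\<bar>" "\<bar>t\<bar> - \<eta> \<le> sqrt (t\<^sup>2 + \<eta>\<^sup>2) - \<eta>"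
proof -
  show "0 \<le> sqrt (t\<^sup>2 + \<eta>\<^sup>2) - \<eta>" using real_sqrt_le_mono[of "\<eta>\<^sup>2" "t\<^sup>2 + \<eta>\<^sup>2"] assms by simp
  show "sqrt (t\<^sup>2 + \<eta>\<^sup>2) - \<eta> \<le> \<bar>t\<bar>" using sqrt_sum_squares_le_sum_abs[of t \<eta>] assms by simp
  show "\<bar>t\<bar> - \<eta> \<le> sqrt (t\<^sup>2 + \<eta>\<^sup>2) - \<eta>" using real_sqrt_le_mono[of "t\<^sup>2" "t\<^sup>2 + \<eta>\<^sup>2"] by simp
qed

text \<open>A smooth substitute for the absolute value. Subtracting \<eta> makes it vanish at 0,
  which preserves compact support, and its derivative is at most 1 in modulus, so the Dirichlet
  integral does not grow.\<close>

lemma smoothed_abs_test: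
  assumes "\<phi> \<in> test_functions \<Omega>" "\<eta> > 0"
  shows "(\<lambda>x. sqrt ((\<phi> x)\<^sup>2 + \<eta>\<^sup>2) - \<eta>) \<in> test_functions \<Omega>"
    and "norm (grad (\<lambda>x. sqrt ((\<phi> x)\<^sup>2 + \<eta>\<^sup>2) - \<eta>) x) \<le> norm (grad \<phi> x)"
proof -
  note sm = test_functionsD(1)[OF assms(1)]
  obtain K where K: "compact K" "K \<subseteq> \<Omega>" "\<And>x. x \<notin> K \<Longrightarrow> \<phi> x = 0"
    using test_functionsD(2)[OF assms(1)] by metis
  have p: "t\<^sup>2 + \<eta>\<^sup>2 > 0" for t :: real using assms(2) by (simp add: add_nonneg_pos)
  have "smooth (\<lambda>x. sqrt ((\<phi> x)\<^sup>2 + \<eta>\<^sup>2) - \<eta>)"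
    unfolding power2_eq_square[of "\<phi> _"]
    by (intro smooth_diff smooth_sqrt smooth_add smooth_mult smooth_const sm)
       (use p in \<open>simp add: power2_eq_square\<close>)
  then show "(\<lambda>x. sqrt ((\<phi> x)\<^sup>2 + \<eta>\<^sup>2) - \<eta>) \<in> test_functions \<Omega>"
    by (rule test_functionsI[OF _ K(1,2)]) (use K(3) assms(2) in simp)
  have d: "((\<lambda>t. sqrt (t\<^sup>2 + \<eta>\<^sup>2) - \<eta>) has_real_derivative (\<phi> x / sqrt ((\<phi> x)\<^sup>2 + \<eta>\<^sup>2))) (at (\<phi> x))"
    using p[of "\<phi> x"] by (auto intro!: derivative_eq_intros simp: field_simps)
  have "\<bar>\<phi> x / sqrt ((\<phi> x)\<^sup>2 + \<eta>\<^sup>2)\<bar> \<le> 1"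
    using smoothed_abs_bounds(3)[OF assms(2), of "\<phi> x"] p[of "\<phi> x"] by (simp add: abs_divide)
  then show "norm (grad (\<lambda>x. sqrt ((\<phi> x)\<^sup>2 + \<eta>\<^sup>2) - \<eta>) x) \<le> norm (grad \<phi> x)"
    unfolding grad_comp[where F="\<lambda>t. sqrt (t\<^sup>2 + \<eta>\<^sup>2) - \<eta>", OF sm d]
    by (metis mult_left_le_one_le norm_ge_zero abs_ge_zero norm_scaleR)
qed

text \<open>Smoothing the absolute value of a near minimizer does not raise the gradient integral,
  while the mean square converges back as the smoothing parameter tends to 0. The strict inequality
  survives, and scaling normalises.\<close>

lemma nonneg_near_minimizer:
  assumes "open \<Omega>" "\<Omega> \<noteq> {}" "e > 0"
  shows "\<exists>\<phi>\<in>test_functions \<Omega>. (\<forall>x. \<phi> x \<ge> 0) \<and> (\<integral>x. (\<phi> x)\<^sup>2 \<partial>lebesgue_on \<Omega>) = 1 \<and>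
    (\<integral>x. (norm (grad \<phi> x))\<^sup>2 \<partial>lebesgue_on \<Omega>) \<le> first_eigenvalue \<Omega> + e"
proof -
  let ?M = "lebesgue_on \<Omega>" and ?l = "first_eigenvalue \<Omega>"
  let ?E = "\<lambda>w. \<integral>x. (norm (grad w x))\<^sup>2 \<partial>?M" and ?I = "\<lambda>w. \<integral>x. (w x)\<^sup>2 \<partial>?M"
  obtain \<phi> where \<phi>: "\<phi> \<in> test_functions \<Omega>" "?I \<phi> > 0"
    "?E \<phi> < (?l + e) * ?I \<phi>"
    using near_minimizer[OF assms] by blast
  define \<eta> where "\<eta> k = inverse (real (Suc k))" for k
  have \<eta>: "\<eta> k > 0" for k by (simp add: \<eta>_def)
  define w where "w k x = sqrt ((\<phi> x)\<^sup>2 + (\<eta> k)\<^sup>2) - \<eta> k" for k x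
  have w: "w k \<in> test_functions \<Omega>" "norm (grad (w k) x) \<le> norm (grad \<phi> x)" for k x
    using smoothed_abs_test[OF \<phi>(1) \<eta>] unfolding w_def by auto
  have wb: "0 \<le> w k x" "w k x \<le> \<bar>\<phi> x\<bar>" "\<bar>\<phi> x\<bar> - \<eta> k \<le> w k x" for k x
    unfolding w_def by (rule smoothed_abs_bounds[OF \<eta>])+
  have gw: "?E (w k) \<le> ?E \<phi>" for k
    by (rule integral_mono[OF test_lebesgue_on(4)[OF assms(1) w(1)] test_lebesgue_on(4)[OF assms(1) \<phi>(1)]])
       (simp add: power_mono w(2))
  have l: "(\<lambda>k. \<integral>x. (w k x)\<^sup>2 \<partial>?M) \<longlonglongrightarrow> ?I \<phi>"
  proof (rule integral_dominated_convergence)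
    show "AE x in ?M. (\<lambda>k. (w k x)\<^sup>2) \<longlonglongrightarrow> (\<phi> x)\<^sup>2"
    proof (rule AE_I2)
      fix x
      have "(\<lambda>k. \<bar>\<phi> x\<bar> - \<eta> k) \<longlonglongrightarrow> \<bar>\<phi> x\<bar> - 0"
        unfolding \<eta>_def by (intro tendsto_intros LIMSEQ_inverse_real_of_nat)
      then have "(\<lambda>k. w k x) \<longlonglongrightarrow> \<bar>\<phi> x\<bar>"
        using tendsto_sandwich[of "\<lambda>k. \<bar>\<phi> x\<bar> - \<eta> k" "\<lambda>k. w k x" sequentially "\<lambda>k. \<bar>\<phi> x\<bar>" "\<bar>\<phi> x\<bar>"] wb
        by simp
      then have "(\<lambda>k. (w k x)\<^sup>2) \<longlonglongrightarrow> \<bar>\<phi> x\<bar>\<^sup>2" by (rule tendsto_power)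
      then show "(\<lambda>k. (w k x)\<^sup>2) \<longlonglongrightarrow> (\<phi> x)\<^sup>2" by simp
    qed
    show "AE x in ?M. norm ((w k x)\<^sup>2) \<le> (\<phi> x)\<^sup>2" for k
    proof (rule AE_I2)
      show "norm ((w k x)\<^sup>2) \<le> (\<phi> x)\<^sup>2" for x
        using power_mono[OF wb(2)[of k x] wb(1)[of k x], of 2] by simp
    qed
    show "integrable ?M (\<lambda>x. (\<phi> x)\<^sup>2)" by (rule test_lebesgue_on(3)[OF assms(1) \<phi>(1)])
    then show "(\<lambda>x. (\<phi> x)\<^sup>2) \<in> borel_measurable ?M" by simp
    show "(\<lambda>x. (w k x)\<^sup>2) \<in> borel_measurable ?M" for k
      using test_lebesgue_on(3)[OF assms(1) w(1)] by simp
  qed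
  have "(\<lambda>k. (?l + e) * ?I (w k)) \<longlonglongrightarrow> (?l + e) * ?I \<phi>"
    by (intro tendsto_intros l)
  from order_tendstoD(1)[OF this \<phi>(3)] order_tendstoD(1)[OF l \<phi>(2)]
  have "eventually (\<lambda>k. ?E \<phi> < (?l + e) * ?I (w k)
     \<and> 0 < ?I (w k)) sequentially"
    by eventually_elim simp
  then obtain k where k: "?E \<phi> < (?l + e) * ?I (w k)"
    and I: "0 < ?I (w k)"
    using eventually_happens by fastforce
  define I where "I = ?I (w k)"
  define c where "c = 1 / sqrt I"
  have c: "c > 0" "c\<^sup>2 * I = 1" using I by (simp_all add: c_def I_def power_divide)
  define v where "v x = c * w k x" for x
  have "v = (\<lambda>x. w k x * c)" by (simp add: v_def fun_eq_iff)
  then have "v \<in> test_functions \<Omega>" using test_functions_mult[OF w(1) smooth_const] by simp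
  moreover have "\<forall>x. v x \<ge> 0" using wb(1) c by (simp add: v_def)
  moreover have "?I v = 1" using c by (simp add: v_def power_mult_distrib I_def)
  moreover have "?E v \<le> ?l + e"
  proof -
    have "grad v x = c *\<^sub>R grad (w k) x" for x
      unfolding v_def by (rule grad_cmult[OF test_functionsD(1)[OF w(1)]])
    then have "?E v = c\<^sup>2 * ?E (w k)"
      by (simp add: power_mult_distrib)
    also have "\<dots> \<le> c\<^sup>2 * ((?l + e) * I)"
      by (rule mult_left_mono) (use gw[of k] k in \<open>auto simp: I_def\<close>)
    also have "\<dots> = ?l + e" using c(2) by (simp add: mult.left_commute)
    finally show ?thesis .
  qed
  ultimately show ?thesis by blast
qed

text \<open>\<open>poincare\<close> for normalised near minimizers gives the lower bound
  \<open>1 / (4 * R\<^sup>2)\<close>. Strict positivity is used when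
  \<open>\<integral> V = 0\<close> is concluded from
  \<open>\<lambda>\<^sub>1 \<Phi>(s\<^sub>0) \<integral> V = 0\<close>.\<close>

lemma first_eigenvalue_pos:
  assumes "open \<Omega>" "\<Omega> \<noteq> {}" "bounded \<Omega>"
  shows "first_eigenvalue \<Omega> > 0"
proof -
  obtain R where R: "R > 0" "\<And>x. x \<in> \<Omega> \<Longrightarrow> norm x \<le> R"
    using assms(3) unfolding bounded_pos by blast
  have "inverse (4 * R\<^sup>2) \<le> first_eigenvalue \<Omega>"
  proof (rule field_le_epsilon)
    fix e :: real assume "e > 0"
    obtain \<phi> where \<phi>: "\<phi> \<in> test_functions \<Omega>" "(\<integral>x. (\<phi> x)\<^sup>2 \<partial>lebesgue_on \<Omega>) = 1"
      "(\<integral>x. (norm (grad \<phi> x))\<^sup>2 \<partial>lebesgue_on \<Omega>) \<le> first_eigenvalue \<Omega> + e"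
      using nonneg_near_minimizer[OF assms(1,2) \<open>e > 0\<close>] by blast
    have "1 \<le> 4 * R\<^sup>2 * (\<integral>x. (norm (grad \<phi> x))\<^sup>2 \<partial>lebesgue_on \<Omega>)"
      using poincare[OF \<phi>(1) R(2)] \<phi>(2) by (simp add: test_lebesgue_on(5,6)[OF assms(1) \<phi>(1)])
    also have "\<dots> \<le> 4 * R\<^sup>2 * (first_eigenvalue \<Omega> + e)" by (rule mult_left_mono[OF \<phi>(3)]) simp
    finally show "inverse (4 * R\<^sup>2) \<le> first_eigenvalue \<Omega> + e"
      using R(1) by (simp add: field_simps)
  qed
  moreover have "inverse (4 * R\<^sup>2) > 0" using R(1) by simp
  ultimately show ?thesis by linarith
qed

subsection \<open>A minimizing sequence for the first eigenvalue\<close>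

definition eigen_form :: "'a::euclidean_space set \<Rightarrow> ('a \<Rightarrow> real) \<Rightarrow> ('a \<Rightarrow> real) \<Rightarrow> real" where
  "eigen_form \<Omega> \<phi> \<eta> = (\<integral>x. grad \<phi> x \<bullet> grad \<eta> x \<partial>lebesgue_on \<Omega>) -
     first_eigenvalue \<Omega> * (\<integral>x. \<phi> x * \<eta> x \<partial>lebesgue_on \<Omega>)"

lemma eigen_form_self:
  "eigen_form \<Omega> \<phi> \<phi> = (\<integral>x. (norm (grad \<phi> x))\<^sup>2 \<partial>lebesgue_on \<Omega>) -
     first_eigenvalue \<Omega> * (\<integral>x. (\<phi> x)\<^sup>2 \<partial>lebesgue_on \<Omega>)"
  by (simp add: eigen_form_def power2_norm_eq_inner power2_eq_square[of "\<phi> _"])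

lemma eigen_form_nonneg:
  "open \<Omega> \<Longrightarrow> \<phi> \<in> test_functions \<Omega> \<Longrightarrow> eigen_form \<Omega> \<phi> \<phi> \<ge> 0"
  using first_eigenvalue_le by (simp add: eigen_form_self)

lemma test_products_integrable:
  assumes "open \<Omega>" "\<phi> \<in> test_functions \<Omega>" "\<eta> \<in> test_functions \<Omega>"
  shows "integrable (lebesgue_on \<Omega>) (\<lambda>x. \<phi> x * \<eta> x)"
    and "integrable (lebesgue_on \<Omega>) (\<lambda>x. grad \<phi> x \<bullet> grad \<eta> x)"
proof -
  note \<phi> = test_lebesgue_on[OF assms(1,2)] and \<eta> = test_lebesgue_on[OF assms(1,3)]
  show "integrable (lebesgue_on \<Omega>) (\<lambda>x. \<phi> x * \<eta> x)"
    by (rule integral_Cauchy_Schwarz(1)[OF \<phi>(1) \<eta>(1) \<phi>(3) \<eta>(3)])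
  show "integrable (lebesgue_on \<Omega>) (\<lambda>x. grad \<phi> x \<bullet> grad \<eta> x)"
    by (rule dominated_L2_limit_inner(1)[OF dominated_L2_limit_const[OF \<phi>(2,4)] dominated_L2_limit_const[OF \<eta>(2,4)]])
qed

lemma eigen_form_combination:
  assumes "open \<Omega>" "\<phi> \<in> test_functions \<Omega>" "\<eta> \<in> test_functions \<Omega>"
  shows "(\<lambda>x. s * \<phi> x + t * \<eta> x) \<in> test_functions \<Omega>"
    and "eigen_form \<Omega> (\<lambda>x. s * \<phi> x + t * \<eta> x) (\<lambda>x. s * \<phi> x + t * \<eta> x) =
      s\<^sup>2 * eigen_form \<Omega> \<phi> \<phi> + 2 * s * t * eigen_form \<Omega> \<phi> \<eta> + t\<^sup>2 * eigen_form \<Omega> \<eta> \<eta>"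
proof -
  have c: "(\<lambda>x. s * \<phi> x) \<in> test_functions \<Omega>" "(\<lambda>x. t * \<eta> x) \<in> test_functions \<Omega>"
    using test_functions_mult[OF assms(2) smooth_const, of s] test_functions_mult[OF assms(3) smooth_const, of t]
    by (simp_all add: mult.commute)
  show "(\<lambda>x. s * \<phi> x + t * \<eta> x) \<in> test_functions \<Omega>" by (rule test_functions_add[OF c])
  have g: "grad (\<lambda>x. s * \<phi> x + t * \<eta> x) x = s *\<^sub>R grad \<phi> x + t *\<^sub>R grad \<eta> x" for x
    by (simp add: grad_add[OF test_functionsD(1)[OF c(1)] test_functionsD(1)[OF c(2)]]
        grad_cmult[OF test_functionsD(1)[OF assms(2)]] grad_cmult[OF test_functionsD(1)[OF assms(3)]])
  note i = test_products_integrable[OF assms(1,2,2)] test_products_integrable[OF assms(1,2,3)]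
    test_products_integrable[OF assms(1,3,3)]
  have e1: "(s * \<phi> x + t * \<eta> x) * (s * \<phi> x + t * \<eta> x) =
      s\<^sup>2 * (\<phi> x * \<phi> x) + 2 * s * t * (\<phi> x * \<eta> x) + t\<^sup>2 * (\<eta> x * \<eta> x)" for x
    by (simp add: power2_eq_square algebra_simps)
  have e2: "(s *\<^sub>R grad \<phi> x + t *\<^sub>R grad \<eta> x) \<bullet> (s *\<^sub>R grad \<phi> x + t *\<^sub>R grad \<eta> x) =
      s\<^sup>2 * (grad \<phi> x \<bullet> grad \<phi> x) + 2 * s * t * (grad \<phi> x \<bullet> grad \<eta> x) + t\<^sup>2 * (grad \<eta> x \<bullet> grad \<eta> x)" for x
    by (simp add: power2_eq_square algebra_simps inner_add_left inner_add_right inner_commute)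
  show "eigen_form \<Omega> (\<lambda>x. s * \<phi> x + t * \<eta> x) (\<lambda>x. s * \<phi> x + t * \<eta> x) =
      s\<^sup>2 * eigen_form \<Omega> \<phi> \<phi> + 2 * s * t * eigen_form \<Omega> \<phi> \<eta> + t\<^sup>2 * eigen_form \<Omega> \<eta> \<eta>"
    unfolding eigen_form_def g e1 e2 using i by simp (simp add: algebra_simps)
qed

lemma eigen_form_Cauchy_Schwarz:
  assumes "open \<Omega>" "\<phi> \<in> test_functions \<Omega>" "\<eta> \<in> test_functions \<Omega>"
  shows "(eigen_form \<Omega> \<phi> \<eta>)\<^sup>2 \<le> eigen_form \<Omega> \<phi> \<phi> * eigen_form \<Omega> \<eta> \<eta>"
proof (rule nonneg_quadratic_form)
  show "0 \<le> s\<^sup>2 * eigen_form \<Omega> \<phi> \<phi> + 2 * s * t * eigen_form \<Omega> \<phi> \<eta> + t\<^sup>2 * eigen_form \<Omega> \<eta> \<eta>" for s t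
    unfolding eigen_form_combination(2)[OF assms, symmetric]
    by (rule eigen_form_nonneg[OF assms(1) eigen_form_combination(1)[OF assms]])
qed

text \<open>The parallelogram law, with the nonnegative value at the sum dropped. For a minimizing
  sequence the right side is small, so closeness in mean square implies closeness of the
  gradients.\<close>

lemma eigen_form_diff:
  assumes "open \<Omega>" "\<phi> \<in> test_functions \<Omega>" "\<eta> \<in> test_functions \<Omega>"
  shows "eigen_form \<Omega> (\<lambda>x. \<phi> x - \<eta> x) (\<lambda>x. \<phi> x - \<eta> x) \<le> 2 * eigen_form \<Omega> \<phi> \<phi> + 2 * eigen_form \<Omega> \<eta> \<eta>"
proof -
  have "0 \<le> 1\<^sup>2 * eigen_form \<Omega> \<phi> \<phi> + 2 * 1 * 1 * eigen_form \<Omega> \<phi> \<eta> + 1\<^sup>2 * eigen_form \<Omega> \<eta> \<eta>"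
    unfolding eigen_form_combination(2)[OF assms, symmetric]
    by (rule eigen_form_nonneg[OF assms(1) eigen_form_combination(1)[OF assms]])
  then show ?thesis using eigen_form_combination(2)[OF assms, of 1 "-1"] by simp
qed

text \<open>\<open>rellich\<close> makes a minimizing sequence Cauchy in mean square, and
  \<open>eigen_form_diff\<close> then makes its gradients Cauchy; a thinner subsequence converges
  fast enough to have majorants. \<open>V\<close> is the first eigenfunction and \<open>G\<close>
  its gradient, but only their being limits is recorded.\<close>

lemma eigen_sequence:
  fixes \<Omega> :: "'a::euclidean_space set"
  assumes "open \<Omega>" "bounded \<Omega>" "\<Omega> \<noteq> {}"
  obtains v V G where "\<And>n. v n \<in> test_functions \<Omega>" "\<And>n x. v n x \<ge> 0"
    "\<And>n. (\<integral>x. (v n x)\<^sup>2 \<partial>lebesgue_on \<Omega>) = 1" "(\<lambda>n. eigen_form \<Omega> (v n) (v n)) \<longlonglongrightarrow> 0"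
    "dominated_L2_limit (lebesgue_on \<Omega>) v V" "dominated_L2_limit (lebesgue_on \<Omega>) (\<lambda>n. grad (v n)) G"
proof -
  let ?M = "lebesgue_on \<Omega>" and ?l = "first_eigenvalue \<Omega>"
  let ?E = "\<lambda>w. \<integral>x. (norm (grad w x))\<^sup>2 \<partial>?M" and ?I = "\<lambda>w. \<integral>x. (w x)\<^sup>2 \<partial>?M"
  have "\<exists>\<phi>\<in>test_functions \<Omega>. (\<forall>x. \<phi> x \<ge> 0) \<and> ?I \<phi> = 1 \<and>
    ?E \<phi> \<le> ?l + inverse (real (Suc n))" for n
    by (rule nonneg_near_minimizer[OF assms(1,3)]) simp
  then obtain w where w: "\<And>n. w n \<in> test_functions \<Omega>" "\<And>n x. w n x \<ge> 0"
    "\<And>n. ?I (w n) = 1" "\<And>n. ?E (w n) \<le> ?l + inverse (real (Suc n))"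
    by metis
  have l0: "?l > 0" by (rule first_eigenvalue_pos[OF assms(1,3,2)])
  have qw: "eigen_form \<Omega> (w n) (w n) \<le> inverse (real (Suc n))" for n
    using w(4)[of n] by (simp add: eigen_form_self w(3))
  have qw0: "eigen_form \<Omega> (w n) (w n) \<ge> 0" for n by (rule eigen_form_nonneg[OF assms(1) w(1)])
  have ql: "(\<lambda>n. eigen_form \<Omega> (w n) (w n)) \<longlonglongrightarrow> 0"
    by (rule tendsto_sandwich[OF _ _ tendsto_const LIMSEQ_inverse_real_of_nat]) (use qw qw0 in auto)
  note tw = test_lebesgue_on[OF assms(1) w(1)]
  have w2: "(\<integral>x. (w n x)\<^sup>2 \<partial>lborel) \<le> ?l + 1" for n
    using w(3)[of n] l0 by (simp add: tw(5))
  have w4: "(\<integral>x. (norm (grad (w n) x))\<^sup>2 \<partial>lborel) \<le> ?l + 1" for n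
  proof -
    have "inverse (real (Suc n)) \<le> 1" by (simp add: inverse_le_1_iff)
    then have "?l + inverse (real (Suc n)) \<le> ?l + 1" by (rule add_left_mono)
    with w(4)[of n] show ?thesis unfolding tw(6) by (rule order_trans)
  qed
  obtain r :: "nat \<Rightarrow> nat" where r: "strict_mono r"
    "\<And>e. e > 0 \<Longrightarrow> \<exists>N. \<forall>m\<ge>N. \<forall>n\<ge>N. (\<integral>x. (w (r m) x - w (r n) x)\<^sup>2 \<partial>lborel) < e"
    using rellich[where v=w and K="?l + 1", OF assms(1,2) w(1) w2 w4] by blast
  define y where "y n = w (r n)" for n
  have y: "y n \<in> test_functions \<Omega>" "y n x \<ge> 0" "?I (y n) = 1" for n x
    using w by (auto simp: y_def)
  have qy: "(\<lambda>n. eigen_form \<Omega> (y n) (y n)) \<longlonglongrightarrow> 0"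
    using LIMSEQ_subseq_LIMSEQ[OF ql r(1)] by (simp add: y_def comp_def)
  have dy: "(\<lambda>x. y m x - y n x) \<in> test_functions \<Omega>" for m n by (rule test_functions_diff[OF y(1) y(1)])
  have gdy: "grad (\<lambda>x. y m x - y n x) x = grad (y m) x - grad (y n) x" for m n x
    by (rule grad_diff[OF test_functionsD(1)[OF y(1)] test_functionsD(1)[OF y(1)]])
  have Cauchy: "\<exists>N. \<forall>m\<ge>N. \<forall>n\<ge>N. (\<integral>x. (y m x - y n x)\<^sup>2 \<partial>?M) \<le> e \<and>
      (\<integral>x. (norm (grad (y m) x - grad (y n) x))\<^sup>2 \<partial>?M) \<le> e" if "e > 0" for e
  proof -
    \<comment> \<open>The gradient integral is the form of the difference plus \<open>?l\<close>
      times its mean square. The latter is at most \<open>?l * d \<le> e / 2\<close>, the former at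
      most \<open>2 * e / 8 + 2 * e / 8\<close>.\<close>
    define d where "d = e / (2 * (?l + 1))"
    have d: "d > 0" "?l * d \<le> e / 2" "d \<le> e"
      using that l0 by (auto simp: d_def field_simps intro: add_increasing)
    obtain N1 where N1: "\<And>m n. m \<ge> N1 \<Longrightarrow> n \<ge> N1 \<Longrightarrow> (\<integral>x. (y m x - y n x)\<^sup>2 \<partial>?M) < d"
      using r(2)[OF d(1)] unfolding y_def[symmetric] test_lebesgue_on(5)[OF assms(1) dy, symmetric] by blast
    have "eventually (\<lambda>n. eigen_form \<Omega> (y n) (y n) < e / 8) sequentially"
      using order_tendstoD(2)[OF qy, of "e / 8"] that by simp
    then obtain N2 where N2: "\<And>n. n \<ge> N2 \<Longrightarrow> eigen_form \<Omega> (y n) (y n) < e / 8"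
      unfolding eventually_sequentially by blast
    have "(\<integral>x. (y m x - y n x)\<^sup>2 \<partial>?M) \<le> e \<and> (\<integral>x. (norm (grad (y m) x - grad (y n) x))\<^sup>2 \<partial>?M) \<le> e"
      if mn: "m \<ge> max N1 N2" "n \<ge> max N1 N2" for m n
    proof -
      have a: "(\<integral>x. (y m x - y n x)\<^sup>2 \<partial>?M) < d" using N1 mn by simp
      then have "?l * (\<integral>x. (y m x - y n x)\<^sup>2 \<partial>?M) \<le> ?l * d"
        by (intro mult_left_mono) (use l0 in auto)
      moreover have "eigen_form \<Omega> (\<lambda>x. y m x - y n x) (\<lambda>x. y m x - y n x) \<le> e / 2"
        using eigen_form_diff[OF assms(1) y(1)[of m] y(1)[of n]] N2[of m] N2[of n] mn by simp
      ultimately show ?thesis using a d by (simp add: eigen_form_self gdy)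
    qed
    then show ?thesis by blast
  qed
  have "\<exists>N. \<forall>m\<ge>N. \<forall>n\<ge>N. (\<integral>x. (y m x - y n x)\<^sup>2 \<partial>?M) \<le> (1 / 8) ^ k \<and>
      (\<integral>x. (norm (grad (y m) x - grad (y n) x))\<^sup>2 \<partial>?M) \<le> (1 / 8) ^ k" for k :: nat
    by (rule Cauchy) simp
  then have "\<exists>N. \<forall>k. \<forall>m\<ge>N k. \<forall>n\<ge>N k. (\<integral>x. (y m x - y n x)\<^sup>2 \<partial>?M) \<le> (1 / 8) ^ k \<and>
      (\<integral>x. (norm (grad (y m) x - grad (y n) x))\<^sup>2 \<partial>?M) \<le> (1 / 8) ^ k"
    by (intro choice allI)
  then obtain N where N: "\<And>k m n. m \<ge> N k \<Longrightarrow> n \<ge> N k \<Longrightarrow> (\<integral>x. (y m x - y n x)\<^sup>2 \<partial>?M) \<le> (1 / 8) ^ k \<and>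
      (\<integral>x. (norm (grad (y m) x - grad (y n) x))\<^sup>2 \<partial>?M) \<le> (1 / 8) ^ k" by blast
  \<comment> \<open>The partial sums dominate every \<open>N k\<close>, and the summand
    \<open>k\<close> makes the indices strictly increasing.\<close>
  define i where "i k = k + (\<Sum>j\<le>k. N j)" for k
  have i: "i k \<ge> N k" "i (Suc k) \<ge> N k" for k
    using member_le_sum[of k "{..k}" N] by (auto simp: i_def)
  have sm: "strict_mono i" by (rule strict_mono_Suc_iff[THEN iffD2]) (simp add: i_def)
  define v where "v k = y (i k)" for k
  have v: "v n \<in> test_functions \<Omega>" "v n x \<ge> 0" "?I (v n) = 1" for n x
    using y by (auto simp: v_def)
  have qv: "(\<lambda>n. eigen_form \<Omega> (v n) (v n)) \<longlonglongrightarrow> 0"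
    using LIMSEQ_subseq_LIMSEQ[OF qy sm] by (simp add: v_def comp_def)
  note tv = test_lebesgue_on[OF assms(1) v(1)]
  have tv3: "integrable ?M (\<lambda>x. (norm (v n x))\<^sup>2)" for n using tv(3) by simp
  have "\<exists>V. dominated_L2_limit ?M v V"
  proof (rule fast_Cauchy_dominated_L2_limit[OF tv(1) tv3 integrable_norm_diff_square[OF tv(1) tv(1) tv3 tv3]])
    show "(\<integral>x. (norm (v (Suc n) x - v n x))\<^sup>2 \<partial>?M) \<le> (1 / 8) ^ n" for n
      using N[OF i(2) i(1), of n] by (simp add: v_def)
  qed
  moreover have "\<exists>G. dominated_L2_limit ?M (\<lambda>n. grad (v n)) G"
  proof (rule fast_Cauchy_dominated_L2_limit[OF tv(2) tv(4) integrable_norm_diff_square[OF tv(2) tv(2) tv(4) tv(4)]])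
    show "(\<integral>x. (norm (grad (v (Suc n)) x - grad (v n) x))\<^sup>2 \<partial>?M) \<le> (1 / 8) ^ n" for n
      using N[OF i(2) i(1), of n] by (simp add: v_def)
  qed
  ultimately show ?thesis using that v qv by blast
qed

subsection \<open>Nonexistence\<close>

lemma arctan_less_self:
  assumes "0 < x"
  shows "arctan x < x"
proof -
  have "(\<lambda>t. t - arctan t) 0 < (\<lambda>t. t - arctan t) x"
  proof (rule DERIV_pos_imp_increasing_open[OF assms])
    fix t :: real assume "0 < t" "t < x"
    then have "inverse (1 + t\<^sup>2) < 1" by (simp add: inverse_less_1_iff)
    then show "\<exists>y. ((\<lambda>t. t - arctan t) has_real_derivative y) (at t) \<and> 0 < y"
      by (intro exI[of _ "1 - inverse (1 + t\<^sup>2)"]) (auto intro!: derivative_eq_intros)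
  qed (auto intro!: continuous_intros)
  then show ?thesis by simp
qed

text \<open>The definition of a weak solution pairs with the chosen weak gradient of the test
  function; product and chain rules need the classical one.\<close>

lemma weak_solution_test:
  assumes "open \<Omega>" "weak_solution \<Omega> f u" "\<eta> \<in> test_functions \<Omega>"
  shows "integrable (lebesgue_on \<Omega>) (\<lambda>x. f (u x) * \<eta> x)"
    and "(\<integral>x. weak_gradient \<Omega> u x \<bullet> grad \<eta> x \<partial>lebesgue_on \<Omega>) = (\<integral>x. f (u x) * \<eta> x \<partial>lebesgue_on \<Omega>)"
proof -
  let ?M = "lebesgue_on \<Omega>"
  have u: "u \<in> H1 \<Omega>" using assms(2) by (simp add: weak_solution_def H1_0_def)
  have mz: "weak_gradient \<Omega> u \<in> borel_measurable ?M"
    using H1_D(2)[OF assms(1) u] by (simp add: square_integrable_def)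
  note t = test_lebesgue_on[OF assms(1,3)]
  note AE = weak_gradient_AE[OF assms(1) has_weak_gradient_test[OF assms(1,3)]]
  have mw: "weak_gradient \<Omega> \<eta> \<in> borel_measurable ?M"
    by (rule borel_measurable_lebesgue_on_AE_eq[OF _ t(2) AE]) (use assms(1) in auto)
  note ws = assms(2)[unfolded weak_solution_def, THEN conjunct2, rule_format, OF test_H1_0[OF assms(1,3)]]
  show "integrable ?M (\<lambda>x. f (u x) * \<eta> x)" using ws by blast
  have "(\<integral>x. weak_gradient \<Omega> u x \<bullet> grad \<eta> x \<partial>?M) = (\<integral>x. weak_gradient \<Omega> u x \<bullet> weak_gradient \<Omega> \<eta> x \<partial>?M)"
  proof (rule integral_cong_AE)
    show "AE x in ?M. weak_gradient \<Omega> u x \<bullet> grad \<eta> x = weak_gradient \<Omega> u x \<bullet> weak_gradient \<Omega> \<eta> x"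
      using AE by eventually_elim simp
  qed (use mz mw t in auto)
  with ws show "(\<integral>x. weak_gradient \<Omega> u x \<bullet> grad \<eta> x \<partial>?M) = (\<integral>x. f (u x) * \<eta> x \<partial>?M)" by simp
qed

text \<open>In a semidefinite form, vectors of vanishing energy become orthogonal to all vectors of
  bounded energy. This replaces the eigenvalue equation for \<open>V\<close>, with test functions
  that may vary with \<open>n\<close>.\<close>

lemma eigen_form_tendsto_0:
  assumes "open \<Omega>" "\<And>n. v n \<in> test_functions \<Omega>" "\<And>n. \<eta> n \<in> test_functions \<Omega>"
    and "(\<lambda>n. eigen_form \<Omega> (v n) (v n)) \<longlonglongrightarrow> 0" "\<And>n. eigen_form \<Omega> (\<eta> n) (\<eta> n) \<le> C"
  shows "(\<lambda>n. eigen_form \<Omega> (v n) (\<eta> n)) \<longlonglongrightarrow> 0"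
proof (rule Lim_null_comparison)
  show "eventually (\<lambda>n. norm (eigen_form \<Omega> (v n) (\<eta> n)) \<le> sqrt (eigen_form \<Omega> (v n) (v n) * C)) sequentially"
  proof (rule always_eventually, rule allI)
    fix n
    have "(eigen_form \<Omega> (v n) (\<eta> n))\<^sup>2 \<le> eigen_form \<Omega> (v n) (v n) * eigen_form \<Omega> (\<eta> n) (\<eta> n)"
      by (rule eigen_form_Cauchy_Schwarz[OF assms(1-3)])
    also have "\<dots> \<le> eigen_form \<Omega> (v n) (v n) * C"
      by (rule mult_left_mono[OF assms(5) eigen_form_nonneg[OF assms(1,2)]])
    finally show "norm (eigen_form \<Omega> (v n) (\<eta> n)) \<le> sqrt (eigen_form \<Omega> (v n) (v n) * C)"
      by (simp add: real_le_rsqrt)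
  qed
  have "(\<lambda>n. sqrt (eigen_form \<Omega> (v n) (v n) * C)) \<longlonglongrightarrow> sqrt (0 * C)"
    by (intro tendsto_intros assms)
  then show "(\<lambda>n. sqrt (eigen_form \<Omega> (v n) (v n) * C)) \<longlonglongrightarrow> 0" by simp
qed

lemma has_derivative_scaled_arctan:
  assumes "k > 0"
  shows "((\<lambda>s. k * arctan (s / k)) has_real_derivative inverse (1 + (t / k)\<^sup>2)) (at t)"
  using DERIV_cmult[OF DERIV_chain2[OF DERIV_arctan DERIV_cdivide[OF DERIV_ident, of k]], of k t] assms by simp

lemma abs_scaled_arctan_le:
  assumes "k > 0"
  shows "\<bar>k * arctan (s / k)\<bar> \<le> \<bar>s\<bar>" "\<bar>k * arctan (s / k)\<bar> \<le> 2 * k"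
proof -
  have "\<bar>arctan (s / k)\<bar> \<le> \<bar>s / k\<bar>" by (rule abs_arctan_le)
  then show "\<bar>k * arctan (s / k)\<bar> \<le> \<bar>s\<bar>" using assms by (simp add: abs_mult field_simps)
  have "\<bar>arctan (s / k)\<bar> \<le> 2"
    using arctan_bounded[of "s / k"] pi_less_4 by linarith
  then show "\<bar>k * arctan (s / k)\<bar> \<le> 2 * k" using assms by (simp add: abs_mult)
qed

text \<open>The bound on \<open>f\<close> near 0 serves to make \<open>f (u x)\<close> integrable.
  The point \<open>s0\<close> is not claimed to give equality: if the inequality is strict
  throughout, every positive \<open>s0\<close> qualifies, so both cases are treated at once.\<close>

theorem no_positive_solution:
  fixes \<Omega> :: "'a::euclidean_space set" and f :: "real \<Rightarrow> real"
  assumes "open \<Omega>" "bounded \<Omega>" "\<Omega> \<noteq> {}"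
    and f_meas: "f \<in> borel_measurable borel"
    and f_bdd: "\<And>s. 0 < s \<Longrightarrow> s \<le> 1 \<Longrightarrow> \<bar>f s\<bar> \<le> B"
    and super: "\<And>s. 0 < s \<Longrightarrow> first_eigenvalue \<Omega> * s \<le> f s"
    and s0: "0 < s0" "\<And>s. 0 < s \<Longrightarrow> f s = first_eigenvalue \<Omega> * s \<Longrightarrow> s = s0"
  shows "\<not> positive_solution \<Omega> f u"
proof
  assume "positive_solution \<Omega> f u"
  then have ws: "weak_solution \<Omega> f u" and upos: "AE x in lebesgue_on \<Omega>. u x > 0"
    by (auto simp: positive_solution_def)
  define M where "M = lebesgue_on \<Omega>"
  define z where "z = weak_gradient \<Omega> u"
  define l where "l = first_eigenvalue \<Omega>"
  have l: "l > 0" unfolding l_def by (rule first_eigenvalue_pos[OF assms(1,3,2)])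
  have uH: "u \<in> H1_0 \<Omega>" using ws by (simp add: weak_solution_def)
  have fin: "finite_measure M" unfolding M_def
    by (rule finite_measure_lebesgue_on) (use assms(1,2) in \<open>simp add: bounded_set_imp_lmeasurable\<close>)
  obtain \<phi> where \<phi>: "\<And>n. \<phi> n \<in> test_functions \<Omega>" and du: "dominated_L2_limit M \<phi> u"
    and dz: "dominated_L2_limit M (\<lambda>n. grad (\<phi> n)) z"
    unfolding M_def z_def by (rule H1_0_approx[OF assms(1) uH]) blast
  obtain v V G where v: "\<And>n. v n \<in> test_functions \<Omega>" "\<And>n x. v n x \<ge> 0"
    and v1: "\<And>n. (\<integral>x. (v n x)\<^sup>2 \<partial>M) = 1" and qv: "(\<lambda>n. eigen_form \<Omega> (v n) (v n)) \<longlonglongrightarrow> 0"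
    and dV: "dominated_L2_limit M v V" and dG: "dominated_L2_limit M (\<lambda>n. grad (v n)) G"
    unfolding M_def by (rule eigen_sequence[OF assms(1-3)]) blast
  note t\<phi> = test_lebesgue_on[OF assms(1) \<phi>, folded M_def] and tv = test_lebesgue_on[OF assms(1) v(1), folded M_def]
  note sm\<phi> = test_functionsD(1)[OF \<phi>] and smv = test_functionsD(1)[OF v(1)]
  note wst = weak_solution_test[OF assms(1) ws, folded M_def z_def]
  have [measurable]: "u \<in> borel_measurable M" "V \<in> borel_measurable M" "z \<in> borel_measurable M" "G \<in> borel_measurable M"
    using du dV dz dG by (simp_all add: dominated_L2_limit_def)
  have [measurable]: "\<phi> n \<in> borel_measurable M" "v n \<in> borel_measurable M"
    "grad (\<phi> n) \<in> borel_measurable M" "grad (v n) \<in> borel_measurable M" for n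
    by (fact t\<phi>(1) tv(1) t\<phi>(2) tv(2))+
  note [measurable] = f_meas
  have du': "dominated_L2_limit M (\<lambda>n. u) u"
    using dominated_L2_limit_norm(1)[OF du] by (intro dominated_L2_limit_const) auto
  have dz': "dominated_L2_limit M (\<lambda>n. z) z"
    using dominated_L2_limit_norm(1)[OF dz] by (intro dominated_L2_limit_const) auto
  have dG': "dominated_L2_limit M (\<lambda>n. G) G"
    using dominated_L2_limit_norm(1)[OF dG] by (intro dominated_L2_limit_const) auto
  have iu: "integrable M (\<lambda>x. u x * v n x)" for n
    by (rule integral_Cauchy_Schwarz(1)) (use dominated_L2_limit_norm(1)[OF du] tv(3) in auto)
  have lu: "AE x in M. (\<lambda>n. \<phi> n x) \<longlonglongrightarrow> u x" and lV: "AE x in M. (\<lambda>n. v n x) \<longlonglongrightarrow> V x"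
    using du dV by (auto simp: dominated_L2_limit_def)
  have upos: "AE x in M. u x > 0" unfolding M_def by (rule upos)
  have V0: "AE x in M. V x \<ge> 0"
    using lV by eventually_elim (rule LIMSEQ_le_const, use v(2) in auto)
  \<comment> \<open>Testing with \<open>u\<close> itself makes \<open>f (u x) * u x\<close>
    integrable, which controls \<open>f (u x)\<close> where \<open>u x > 1\<close>; elsewhere
    \<open>f_bdd\<close> does.\<close>
  have F: "integrable M (\<lambda>x. f (u x))"
  proof -
    have "integrable M (\<lambda>x. f (u x) * u x)" using ws uH by (auto simp: weak_solution_def M_def)
    then have i: "integrable M (\<lambda>x. B + \<bar>f (u x) * u x\<bar>)"
      using finite_measure.integrable_const[OF fin] by (intro Bochner_Integration.integrable_add integrable_abs)
    show ?thesis
    proof (rule Bochner_Integration.integrable_bound[OF i])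
      show "AE x in M. norm (f (u x)) \<le> norm (B + \<bar>f (u x) * u x\<bar>)"
        using upos
      proof eventually_elim
        case (elim x)
        have B0: "B \<ge> 0" using order_trans[OF abs_ge_zero f_bdd[of 1]] by simp
        show ?case
        proof (cases "u x \<le> 1")
          case True
          then have "\<bar>f (u x)\<bar> \<le> B" using f_bdd elim by blast
          then show ?thesis using B0 by (simp add: add_increasing2)
        next
          case False
          then have "\<bar>f (u x)\<bar> * 1 \<le> \<bar>f (u x)\<bar> * \<bar>u x\<bar>" by (intro mult_left_mono) auto
          then show ?thesis using B0 by (simp add: abs_mult)
        qed
      qed
    qed measurable
  qed
  obtain C where C: "\<And>n. (\<integral>x. (norm (grad (\<phi> n) x))\<^sup>2 \<partial>M) \<le> C"
  proof -
    have "Bseq (\<lambda>n. \<integral>x. (norm (grad (\<phi> n) x))\<^sup>2 \<partial>M)"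
      using dominated_L2_limit_norm(2)[OF dz] convergentI convergent_imp_Bseq by blast
    then show ?thesis using that by (auto simp: Bseq_def)
  qed
  \<comment> \<open>Used twice: for the approximations of \<open>u\<close> themselves and for their
    images under \<Phi>, whose derivative lies between 0 and 1.\<close>
  have form0: "(\<lambda>n. eigen_form \<Omega> (v n) (\<eta> n)) \<longlonglongrightarrow> 0"
    if "\<And>n. \<eta> n \<in> test_functions \<Omega>" "\<And>n x. norm (grad (\<eta> n) x) \<le> norm (grad (\<phi> n) x)" for \<eta>
  proof (rule eigen_form_tendsto_0[OF assms(1) v(1) that(1) qv])
    fix n
    have "(\<integral>x. (norm (grad (\<eta> n) x))\<^sup>2 \<partial>M) \<le> (\<integral>x. (norm (grad (\<phi> n) x))\<^sup>2 \<partial>M)"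
      by (rule integral_mono[OF _ t\<phi>(4)])
         (use test_lebesgue_on(4)[OF assms(1) that(1)] power_mono[OF that(2) norm_ge_zero] in \<open>auto simp: M_def\<close>)
    moreover have "0 \<le> l * (\<integral>x. (\<eta> n x)\<^sup>2 \<partial>M)" using l by simp
    ultimately show "eigen_form \<Omega> (\<eta> n) (\<eta> n) \<le> C"
      using C[of n] unfolding eigen_form_self M_def[symmetric] l_def[symmetric] by linarith
  qed
  have IV: "integrable M V"
  proof -
    have "integrable M (\<lambda>x. 1 * V x)"
      by (rule integral_Cauchy_Schwarz(1))
         (use dominated_L2_limit_norm(1)[OF dV] finite_measure.integrable_const[OF fin] in auto)
    then show ?thesis by simp
  qed

  have "AE x in M. (f (u x) - l * u x) * V x = 0"
  proof -
    have lim: "(\<lambda>n. \<integral>x. (f (u x) - l * u x) * v n x \<partial>M) \<longlonglongrightarrow> 0"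
    proof -
      have "(\<lambda>n. (\<integral>x. grad (v n) x \<bullet> grad (\<phi> n) x \<partial>M) - l * (\<integral>x. v n x \<bullet> \<phi> n x \<partial>M))
          \<longlonglongrightarrow> (\<integral>x. G x \<bullet> z x \<partial>M) - l * (\<integral>x. V x \<bullet> u x \<partial>M)"
        by (intro tendsto_intros dominated_L2_limit_inner(2) dG dz dV du)
      moreover have "(\<lambda>n. (\<integral>x. grad (v n) x \<bullet> grad (\<phi> n) x \<partial>M) - l * (\<integral>x. v n x \<bullet> \<phi> n x \<partial>M)) \<longlonglongrightarrow> 0"
        using form0[OF \<phi> order_refl] by (simp add: eigen_form_def M_def l_def)
      ultimately have eq: "(\<integral>x. G x \<bullet> z x \<partial>M) - l * (\<integral>x. V x \<bullet> u x \<partial>M) = 0"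
        using LIMSEQ_unique by blast
      \<comment> \<open>Replacing the approximations by \<open>u\<close> leaves the limit unchanged,
        and now the equation of \<open>u\<close> can be tested with \<open>v n\<close>.\<close>
      have "(\<lambda>n. (\<integral>x. grad (v n) x \<bullet> z x \<partial>M) - l * (\<integral>x. v n x \<bullet> u x \<partial>M))
          \<longlonglongrightarrow> (\<integral>x. G x \<bullet> z x \<partial>M) - l * (\<integral>x. V x \<bullet> u x \<partial>M)"
        by (intro tendsto_intros dominated_L2_limit_inner(2) dG dz' dV du')
      moreover have "(\<integral>x. grad (v n) x \<bullet> z x \<partial>M) - l * (\<integral>x. v n x \<bullet> u x \<partial>M) = (\<integral>x. (f (u x) - l * u x) * v n x \<partial>M)" for n
      proof -
        have "(\<integral>x. (f (u x) - l * u x) * v n x \<partial>M) = (\<integral>x. f (u x) * v n x - l * (u x * v n x) \<partial>M)"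
          by (simp add: algebra_simps)
        also have "\<dots> = (\<integral>x. z x \<bullet> grad (v n) x \<partial>M) - l * (\<integral>x. u x * v n x \<partial>M)"
          using wst[OF v(1)] iu by simp
        finally show ?thesis by (simp add: inner_commute mult.commute)
      qed
      ultimately show ?thesis using eq by simp
    qed
    have hn: "AE x in M. 0 \<le> (f (u x) - l * u x) * v n x" for n
      using upos by eventually_elim (use super v(2) in \<open>simp add: l_def\<close>)
    have ih: "integrable M (\<lambda>x. (f (u x) - l * u x) * v n x)" for n
    proof -
      have "integrable M (\<lambda>x. f (u x) * v n x - l * (u x * v n x))"
        using wst(1)[OF v(1)] iu by simp
      then show ?thesis by (simp add: algebra_simps)
    qed
    have "(\<integral>\<^sup>+x. ennreal ((f (u x) - l * u x) * V x) \<partial>M) =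
        (\<integral>\<^sup>+x. liminf (\<lambda>n. ennreal ((f (u x) - l * u x) * v n x)) \<partial>M)"
    proof (rule nn_integral_cong_AE)
      show "AE x in M. ennreal ((f (u x) - l * u x) * V x) = liminf (\<lambda>n. ennreal ((f (u x) - l * u x) * v n x))"
        using lV
      proof eventually_elim
        case (elim x)
        have "(\<lambda>n. ennreal ((f (u x) - l * u x) * v n x)) \<longlonglongrightarrow> ennreal ((f (u x) - l * u x) * V x)"
          by (intro tendsto_intros elim)
        then show ?case by (simp add: lim_imp_Liminf)
      qed
    qed
    \<comment> \<open>Fatou's lemma, because no integrable majorant for
      \<open>f (u x) * v n x\<close> is at hand; the sign of \<open>f s - l * s\<close> makes it
      applicable.\<close>
    also have "\<dots> \<le> liminf (\<lambda>n. \<integral>\<^sup>+x. ennreal ((f (u x) - l * u x) * v n x) \<partial>M)"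
      by (rule nn_integral_liminf) measurable
    also have "\<dots> = liminf (\<lambda>n. ennreal (\<integral>x. (f (u x) - l * u x) * v n x \<partial>M))"
      by (simp add: nn_integral_eq_integral[OF ih hn])
    also have "\<dots> = ennreal 0"
      by (intro lim_imp_Liminf tendsto_ennrealI lim) simp
    finally have "(\<integral>\<^sup>+x. ennreal ((f (u x) - l * u x) * V x) \<partial>M) = 0" by simp
    then have "AE x in M. ennreal ((f (u x) - l * u x) * V x) = 0"
      by (subst (asm) nn_integral_0_iff_AE) measurable
    with upos V0 show ?thesis
    proof eventually_elim
      case (elim x)
      have "0 \<le> (f (u x) - l * u x) * V x" using super[of "u x"] elim by (simp add: l_def)
      moreover have "(f (u x) - l * u x) * V x \<le> 0" using elim(3) by (simp add: ennreal_eq_0_iff)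
      ultimately show ?case by simp
    qed
  qed
  with upos have dich: "AE x in M. V x = 0 \<or> u x = s0"
    by eventually_elim (use s0(2) in \<open>auto simp: l_def\<close>)

  \<comment> \<open>The derivative is \<open>(s - s0)\<^sup>2 / (1 + (s - s0)\<^sup>2)\<close>, with
    a double zero at \<open>s0\<close>. The constant \<open>arctan s0\<close> gives
    \<open>\<Phi> 0 = 0\<close>, so composition with \<Phi> preserves test functions; and
    \<open>\<Phi> s0 = s0 - arctan s0\<close> is positive.\<close>
  define \<Phi> where "\<Phi> s = s - arctan (s - s0) - arctan s0" for s
  define \<psi> where "\<psi> s = 1 - inverse (1 + (s - s0) * (s - s0))" for s
  have pos1: "1 + t * t > 0" for t :: real by (simp add: add_pos_nonneg)
  have \<Phi>': "(\<Phi> has_real_derivative \<psi> s) (at s)" for s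
    unfolding \<Phi>_def \<psi>_def by (auto intro!: derivative_eq_intros simp: power2_eq_square)
  have \<psi>b: "0 \<le> \<psi> s" "\<psi> s \<le> 1" for s
    using pos1[of "s - s0"] by (simp_all add: \<psi>_def inverse_le_1_iff)
  have \<Phi>le: "\<bar>\<Phi> s\<bar> \<le> \<bar>s\<bar>" for s
  proof -
    have "norm (\<Phi> s - \<Phi> 0) \<le> 1 * norm (s - 0)"
      by (rule field_differentiable_bound[of UNIV \<Phi> \<psi>])
         (use \<Phi>' \<psi>b in \<open>auto intro: has_field_derivative_at_within\<close>)
    then show ?thesis by (simp add: \<Phi>_def arctan_minus)
  qed
  have c\<psi>: "continuous_on UNIV \<psi>" unfolding \<psi>_def using pos1 by (intro continuous_intros) (metis less_irrefl)
  note [measurable] = borel_measurable_continuous_onI[OF c\<psi>]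
  have c\<Phi>: "continuous_on UNIV \<Phi>" unfolding \<Phi>_def by (intro continuous_intros)
  have s\<Phi>: "smooth (\<lambda>x. \<Phi> (\<phi> n x))" and s\<psi>: "smooth (\<lambda>x. \<psi> (\<phi> n x))" for n
    unfolding \<Phi>_def \<psi>_def
    by (intro smooth_diff smooth_arctan smooth_const smooth_inverse smooth_add smooth_mult sm\<phi> less_imp_neq[OF pos1, symmetric])+
  have t\<Phi>: "(\<lambda>x. \<Phi> (\<phi> n x)) \<in> test_functions \<Omega>" for n
  proof -
    obtain K where K: "compact K" "K \<subseteq> \<Omega>" "\<And>x. x \<notin> K \<Longrightarrow> \<phi> n x = 0"
      using test_functionsD(2)[OF \<phi>] by metis
    show ?thesis
      by (rule test_functionsI[OF s\<Phi> K(1,2)]) (use K(3) \<Phi>le[of 0] in simp)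
  qed
  have g\<Phi>: "grad (\<lambda>x. \<Phi> (\<phi> n x)) x = \<psi> (\<phi> n x) *\<^sub>R grad (\<phi> n) x" for n x
    by (rule grad_comp[OF sm\<phi> \<Phi>'])
  have d\<psi>z: "dominated_L2_limit M (\<lambda>n x. \<psi> (\<phi> n x) *\<^sub>R grad (\<phi> n) x) (\<lambda>x. \<psi> (u x) *\<^sub>R z x)"
  proof (rule dominated_L2_limit_scaleR[OF dz, where B=1])
    show "AE x in M. (\<lambda>n. \<psi> (\<phi> n x)) \<longlonglongrightarrow> \<psi> (u x)"
      using lu by eventually_elim (rule continuous_on_tendsto_compose[OF c\<psi>], auto)
    show "\<bar>\<psi> (\<phi> n x)\<bar> \<le> 1" for n x using \<psi>b[of "\<phi> n x"] by simp
  qed measurable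
  have first: "(\<integral>x. G x \<bullet> (\<psi> (u x) *\<^sub>R z x) \<partial>M) = l * (\<Phi> s0 * (\<integral>x. V x \<partial>M))"
  proof -
    have "(\<lambda>n. eigen_form \<Omega> (v n) (\<lambda>x. \<Phi> (\<phi> n x))) \<longlonglongrightarrow> 0"
    proof (rule form0[OF t\<Phi>])
      show "norm (grad (\<lambda>x. \<Phi> (\<phi> n x)) x) \<le> norm (grad (\<phi> n) x)" for n x
        unfolding g\<Phi> norm_scaleR using \<psi>b[of "\<phi> n x"] by (intro mult_left_le_one_le) auto
    qed
    then have "(\<lambda>n. (\<integral>x. grad (v n) x \<bullet> (\<psi> (\<phi> n x) *\<^sub>R grad (\<phi> n) x) \<partial>M) - l * (\<integral>x. v n x \<bullet> \<Phi> (\<phi> n x) \<partial>M)) \<longlonglongrightarrow> 0"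
      by (simp only: eigen_form_def g\<Phi> M_def l_def inner_real_def)
    moreover have "(\<lambda>n. (\<integral>x. grad (v n) x \<bullet> (\<psi> (\<phi> n x) *\<^sub>R grad (\<phi> n) x) \<partial>M) - l * (\<integral>x. v n x \<bullet> \<Phi> (\<phi> n x) \<partial>M))
        \<longlonglongrightarrow> (\<integral>x. G x \<bullet> (\<psi> (u x) *\<^sub>R z x) \<partial>M) - l * (\<integral>x. V x \<bullet> \<Phi> (u x) \<partial>M)"
      by (intro tendsto_intros dominated_L2_limit_inner(2) dG d\<psi>z dV dominated_L2_limit_compose[OF du c\<Phi> \<Phi>le])
    ultimately have "(\<integral>x. G x \<bullet> (\<psi> (u x) *\<^sub>R z x) \<partial>M) - l * (\<integral>x. V x \<bullet> \<Phi> (u x) \<partial>M) = 0"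
      using LIMSEQ_unique by blast
    \<comment> \<open>By \<open>dich\<close>, \<open>u x = s0\<close> wherever \<open>V x\<close>
      does not vanish.\<close>
    moreover have "(\<integral>x. V x \<bullet> \<Phi> (u x) \<partial>M) = (\<integral>x. \<Phi> s0 * V x \<partial>M)"
    proof (rule integral_cong_AE)
      show "AE x in M. V x \<bullet> \<Phi> (u x) = \<Phi> s0 * V x" using dich by eventually_elim auto
    qed (use borel_measurable_continuous_onI[OF c\<Phi>] in measurable)
    ultimately show ?thesis by simp
  qed

  define \<psi>' where "\<psi>' s = 2 * (s - s0) * (inverse (1 + (s - s0) * (s - s0)) * inverse (1 + (s - s0) * (s - s0)))" for s
  have d\<psi>: "(\<psi> has_real_derivative \<psi>' s) (at s)" for s
  proof -
    have d: "((\<lambda>s. 1 + (s - s0) * (s - s0)) has_real_derivative 2 * (s - s0)) (at s)"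
      by (auto intro!: derivative_eq_intros)
    have "1 + (s - s0) * (s - s0) \<noteq> 0" using pos1[of "s - s0"] by simp
    from DERIV_diff[OF DERIV_const[of 1] DERIV_inverse'[OF d this]] show ?thesis
      unfolding \<psi>_def \<psi>'_def by (simp only: diff_0 minus_minus ac_simps)
  qed
  have \<psi>'b: "\<bar>\<psi>' s\<bar> \<le> 1" for s
  proof -
    define r where "r = s - s0"
    have "0 \<le> (1 - \<bar>r\<bar>)\<^sup>2" by simp
    then have "2 * \<bar>r\<bar> \<le> 1 + r * r" by (simp add: power2_eq_square algebra_simps)
    moreover have "1 + r * r \<le> (1 + r * r) * (1 + r * r)" using pos1[of r] by (simp add: mult_le_cancel_left1)
    ultimately have "2 * \<bar>r\<bar> \<le> (1 + r * r) * (1 + r * r)" by linarith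
    then show ?thesis using pos1[of r] by (simp add: \<psi>'_def r_def[symmetric] abs_mult divide_simps)
  qed
  have c\<psi>': "continuous_on UNIV \<psi>'" unfolding \<psi>'_def using pos1 by (intro continuous_intros) (metis less_irrefl)+
  note [measurable] = borel_measurable_continuous_onI[OF c\<psi>']

  have second: "(\<integral>x. z x \<bullet> ((\<psi> (u x) * inverse (1 + (V x / k)\<^sup>2)) *\<^sub>R G x) \<partial>M) = 0" if k: "k > 0" for k :: real
  proof -
    \<comment> \<open>A smooth truncation at height of order \<open>k\<close>: it vanishes at 0, is
      bounded by \<open>2 * k\<close>, and its derivative lies in \<open>[0, 1]\<close> and tends to
      1 as \<open>k\<close> grows.\<close>
    define T where "T s = k * arctan (s / k)" for s
    define T' where "T' s = inverse (1 + (s / k)\<^sup>2)" for s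
    have dT: "(T has_real_derivative T' s) (at s)" for s
      unfolding T_def T'_def by (rule has_derivative_scaled_arctan[OF k])
    have T: "\<bar>T s\<bar> \<le> \<bar>s\<bar>" "\<bar>T s\<bar> \<le> 2 * k" for s
      unfolding T_def by (rule abs_scaled_arctan_le[OF k])+
    have cT: "continuous_on UNIV T" unfolding T_def using k by (intro continuous_intros) auto
    have p: "1 + (s / k)\<^sup>2 \<noteq> 0" for s using pos1[of "s / k"] by (simp add: power2_eq_square)
    have cT': "continuous_on UNIV T'" unfolding T'_def using k p by (intro continuous_intros) auto
    note [measurable] = borel_measurable_continuous_onI[OF cT] borel_measurable_continuous_onI[OF cT']
    have T'b: "0 \<le> T' s" "T' s \<le> 1" for s by (simp_all add: T'_def inverse_le_1_iff)
    have sT: "smooth (\<lambda>x. T (v n x))" for n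
      unfolding T_def divide_inverse
      by (intro smooth_mult smooth_arctan smooth_const smv)
    have tT: "(\<lambda>x. T (v n x)) \<in> test_functions \<Omega>" for n
    proof -
      obtain K where K: "compact K" "K \<subseteq> \<Omega>" "\<And>x. x \<notin> K \<Longrightarrow> v n x = 0"
        using test_functionsD(2)[OF v(1)] by metis
      show ?thesis
        by (rule test_functionsI[OF sT K(1,2)]) (use K(3) T(1)[of 0] in simp)
    qed
    \<comment> \<open>The compact support comes from the first factor; the second one does not
      vanish at 0.\<close>
    define \<zeta> where "\<zeta> n x = T (v n x) * \<psi> (\<phi> n x)" for n x
    have t\<zeta>: "\<zeta> n \<in> test_functions \<Omega>" for n
      unfolding \<zeta>_def by (rule test_functions_mult[OF tT s\<psi>])
    have g\<zeta>: "grad (\<zeta> n) x = (T (v n x) * \<psi>' (\<phi> n x)) *\<^sub>R grad (\<phi> n) x + (\<psi> (\<phi> n x) * T' (v n x)) *\<^sub>R grad (v n) x" for n x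
      unfolding \<zeta>_def grad_mult[OF sT s\<psi>] grad_comp[OF sm\<phi> d\<psi>] grad_comp[OF smv dT] by simp
    have B1: "\<bar>T (v n x) * \<psi>' (\<phi> n x)\<bar> \<le> 2 * k * 1" for n x
      unfolding abs_mult by (intro mult_mono T(2) \<psi>'b) (use k in auto)
    have B2: "\<bar>\<psi> (\<phi> n x) * T' (v n x)\<bar> \<le> 1 * 1" for n x
      unfolding abs_mult using \<psi>b[of "\<phi> n x"] T'b[of "v n x"] by (intro mult_mono) auto
    have scaled: "integrable M (\<lambda>x. z x \<bullet> (c x *\<^sub>R grad \<eta> x))"
      if \<eta>: "\<eta> \<in> test_functions \<Omega>" and [measurable]: "c \<in> borel_measurable M" and c: "\<And>x. \<bar>c x\<bar> \<le> D" for \<eta> c D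
    proof -
      note t = test_lebesgue_on[OF assms(1) \<eta>, folded M_def]
      have "dominated_L2_limit M (\<lambda>n x. c x *\<^sub>R grad \<eta> x) (\<lambda>x. c x *\<^sub>R grad \<eta> x)"
        by (rule dominated_L2_limit_scaleR[OF dominated_L2_limit_const[OF t(2,4)] _ _ _ c]) auto
      from dominated_L2_limit_inner(1)[OF dz' this] show ?thesis .
    qed
    have d1: "dominated_L2_limit M (\<lambda>n x. (T (v n x) * \<psi>' (\<phi> n x)) *\<^sub>R grad (\<phi> n) x) (\<lambda>x. (T (V x) * \<psi>' (u x)) *\<^sub>R z x)"
    proof (rule dominated_L2_limit_scaleR[OF dz, where B="2 * k * 1"])
      show "AE x in M. (\<lambda>n. T (v n x) * \<psi>' (\<phi> n x)) \<longlonglongrightarrow> T (V x) * \<psi>' (u x)"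
        using lu lV
        by eventually_elim (intro tendsto_mult continuous_on_tendsto_compose[OF c\<psi>'] continuous_on_tendsto_compose[OF cT]; simp)
      show "\<bar>T (v n x) * \<psi>' (\<phi> n x)\<bar> \<le> 2 * k * 1" for n x by (rule B1)
    qed measurable
    have d2: "dominated_L2_limit M (\<lambda>n x. (\<psi> (\<phi> n x) * T' (v n x)) *\<^sub>R grad (v n) x) (\<lambda>x. (\<psi> (u x) * T' (V x)) *\<^sub>R G x)"
    proof (rule dominated_L2_limit_scaleR[OF dG, where B="1 * 1"])
      show "AE x in M. (\<lambda>n. \<psi> (\<phi> n x) * T' (v n x)) \<longlonglongrightarrow> \<psi> (u x) * T' (V x)"
        using lu lV
        by eventually_elim (intro tendsto_mult continuous_on_tendsto_compose[OF c\<psi>] continuous_on_tendsto_compose[OF cT']; simp)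
      show "\<bar>\<psi> (\<phi> n x) * T' (v n x)\<bar> \<le> 1 * 1" for n x by (rule B2)
    qed measurable
    have "(\<lambda>n. (\<integral>x. z x \<bullet> ((T (v n x) * \<psi>' (\<phi> n x)) *\<^sub>R grad (\<phi> n) x) \<partial>M) + (\<integral>x. z x \<bullet> ((\<psi> (\<phi> n x) * T' (v n x)) *\<^sub>R grad (v n) x) \<partial>M))
       \<longlonglongrightarrow> (\<integral>x. z x \<bullet> ((T (V x) * \<psi>' (u x)) *\<^sub>R z x) \<partial>M) + (\<integral>x. z x \<bullet> ((\<psi> (u x) * T' (V x)) *\<^sub>R G x) \<partial>M)"
      by (intro tendsto_add dominated_L2_limit_inner(2) dz' d1 d2)
    moreover have "(\<integral>x. z x \<bullet> ((T (v n x) * \<psi>' (\<phi> n x)) *\<^sub>R grad (\<phi> n) x) \<partial>M) + (\<integral>x. z x \<bullet> ((\<psi> (\<phi> n x) * T' (v n x)) *\<^sub>R grad (v n) x) \<partial>M)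
        = (\<integral>x. f (u x) * \<zeta> n x \<partial>M)" for n
    proof -
      have i1: "integrable M (\<lambda>x. z x \<bullet> ((T (v n x) * \<psi>' (\<phi> n x)) *\<^sub>R grad (\<phi> n) x))"
        and i2: "integrable M (\<lambda>x. z x \<bullet> ((\<psi> (\<phi> n x) * T' (v n x)) *\<^sub>R grad (v n) x))"
        using scaled[OF \<phi>, of "\<lambda>x. T (v n x) * \<psi>' (\<phi> n x)" "2 * k * 1"]
          scaled[OF v(1), of "\<lambda>x. \<psi> (\<phi> n x) * T' (v n x)" "1 * 1"] B1 B2 by simp_all
      show ?thesis
        unfolding wst(2)[OF t\<zeta>, symmetric] g\<zeta> inner_add_right using i1 i2 by simp
    qed
    \<comment> \<open>Here the truncation pays off: \<zeta> is bounded by \<open>2 * k\<close>, so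
      integrability of \<open>f (u x)\<close> suffices for the majorant.\<close>
    moreover have "(\<lambda>n. \<integral>x. f (u x) * \<zeta> n x \<partial>M) \<longlonglongrightarrow> (\<integral>x. f (u x) * (T (V x) * \<psi> (u x)) \<partial>M)"
    proof (rule integral_dominated_convergence)
      show "integrable M (\<lambda>x. (2 * k) * \<bar>f (u x)\<bar>)" using F by simp
      show "AE x in M. (\<lambda>n. f (u x) * \<zeta> n x) \<longlonglongrightarrow> f (u x) * (T (V x) * \<psi> (u x))"
        unfolding \<zeta>_def using lu lV
        by eventually_elim (intro tendsto_mult tendsto_const continuous_on_tendsto_compose[OF c\<psi>] continuous_on_tendsto_compose[OF cT]; simp)
      show "AE x in M. norm (f (u x) * \<zeta> n x) \<le> (2 * k) * \<bar>f (u x)\<bar>" for n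
      proof (rule AE_I2)
        fix x
        have "\<bar>\<zeta> n x\<bar> \<le> (2 * k) * 1"
          unfolding \<zeta>_def abs_mult using \<psi>b[of "\<phi> n x"] k by (intro mult_mono T(2)) auto
        then have "\<bar>\<zeta> n x\<bar> * \<bar>f (u x)\<bar> \<le> (2 * k) * \<bar>f (u x)\<bar>" by (intro mult_right_mono) auto
        then show "norm (f (u x) * \<zeta> n x) \<le> (2 * k) * \<bar>f (u x)\<bar>" by (simp add: abs_mult mult.commute)
      qed
      show "(\<lambda>x. f (u x) * \<zeta> n x) \<in> borel_measurable M" for n unfolding \<zeta>_def by measurable
    qed measurable
    ultimately have "(\<integral>x. z x \<bullet> ((T (V x) * \<psi>' (u x)) *\<^sub>R z x) \<partial>M) + (\<integral>x. z x \<bullet> ((\<psi> (u x) * T' (V x)) *\<^sub>R G x) \<partial>M)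
        = (\<integral>x. f (u x) * (T (V x) * \<psi> (u x)) \<partial>M)"
      using LIMSEQ_unique by fastforce
    \<comment> \<open>This and the next integrand vanish by \<open>dich\<close>: either
      \<open>T (V x) = T 0 = 0\<close>, or \<open>u x = s0\<close>, a common zero of
      \<open>\<psi>\<close> and \<open>\<psi>'\<close>.\<close>
    moreover have "(\<integral>x. z x \<bullet> ((T (V x) * \<psi>' (u x)) *\<^sub>R z x) \<partial>M) = 0"
      by (rule integral_eq_zero_AE) (use dich in \<open>eventually_elim, auto simp: T_def \<psi>'_def\<close>)
    moreover have "(\<integral>x. f (u x) * (T (V x) * \<psi> (u x)) \<partial>M) = 0"
      by (rule integral_eq_zero_AE) (use dich in \<open>eventually_elim, auto simp: T_def \<psi>_def\<close>)
    ultimately show ?thesis by (simp add: T'_def)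
  qed

  \<comment> \<open>The truncation is removed by \<open>k = n + 1\<close> tending to infinity in
    \<open>second\<close>.\<close>
  have third: "(\<integral>x. z x \<bullet> (\<psi> (u x) *\<^sub>R G x) \<partial>M) = 0"
  proof -
    have "dominated_L2_limit M (\<lambda>n x. (\<psi> (u x) * inverse (1 + (V x / real (Suc n))\<^sup>2)) *\<^sub>R G x) (\<lambda>x. (\<psi> (u x) * 1) *\<^sub>R G x)"
    proof (rule dominated_L2_limit_scaleR[OF dG', where B="1 * 1"])
      show "AE x in M. (\<lambda>n. \<psi> (u x) * inverse (1 + (V x / real (Suc n))\<^sup>2)) \<longlonglongrightarrow> \<psi> (u x) * 1"
      proof (rule AE_I2)
        fix x
        have "(\<lambda>n. \<psi> (u x) * inverse (1 + (V x * inverse (real (Suc n)))\<^sup>2)) \<longlonglongrightarrow> \<psi> (u x) * inverse (1 + (V x * 0)\<^sup>2)"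
          by (intro tendsto_intros LIMSEQ_inverse_real_of_nat) simp
        then show "(\<lambda>n. \<psi> (u x) * inverse (1 + (V x / real (Suc n))\<^sup>2)) \<longlonglongrightarrow> \<psi> (u x) * 1"
          by (simp add: divide_inverse)
      qed
      show "\<bar>\<psi> (u x) * inverse (1 + (V x / real (Suc n))\<^sup>2)\<bar> \<le> 1 * 1" for n x
        unfolding abs_mult using \<psi>b[of "u x"] by (intro mult_mono) (auto simp: inverse_le_1_iff)
    qed measurable
    from dominated_L2_limit_inner(2)[OF dz' this]
    have "(\<lambda>n::nat. 0::real) \<longlonglongrightarrow> (\<integral>x. z x \<bullet> ((\<psi> (u x) * 1) *\<^sub>R G x) \<partial>M)"
      by (subst (asm) second) simp_all
    then show ?thesis by (simp add: LIMSEQ_const_iff)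
  qed

  have "\<Phi> s0 > 0" using arctan_less_self[OF s0(1)] by (simp add: \<Phi>_def)
  with first third l have "(\<integral>x. V x \<partial>M) = 0" by (simp add: inner_commute)
  then have "AE x in M. V x = 0"
    using integral_nonneg_eq_0_iff_AE[OF IV V0] by simp
  then have "AE x in M. (norm (V x))\<^sup>2 = 0" by eventually_elim simp
  then have "(\<integral>x. (norm (V x))\<^sup>2 \<partial>M) = 0" by (rule integral_eq_zero_AE)
  \<comment> \<open>The normalisation of the \<open>v n\<close> passes to the limit, so
    \<open>V\<close> cannot vanish almost everywhere.\<close>
  moreover have "(\<lambda>n::nat. 1::real) \<longlonglongrightarrow> (\<integral>x. (norm (V x))\<^sup>2 \<partial>M)"
    using dominated_L2_limit_norm(2)[OF dV] v1 by simp
  ultimately show False by (simp add: LIMSEQ_const_iff)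
qed

text \<open>With \<open>a = - (N - 2) \<mu> / 2\<close> and \<open>t = s powr (2\<^sup>* - 2)\<close> one has \<open>f s / s = t - a ln t + \<Lambda>\<close>,
  which is smallest at \<open>t = a\<close>.\<close>

lemma log_critical_nonlinearity_pos:
  fixes N :: nat and \<Lambda> \<mu> s :: real
  assumes "N \<ge> 3" "\<mu> < 0" "s > 0"
  defines "a \<equiv> - ((real N - 2) * \<mu> / 2)" and "p \<equiv> critical_exponent N - 2"
  shows "log_critical_nonlinearity N \<Lambda> \<mu> s = s * (s powr p - a * ln (s powr p) + \<Lambda>)"
    and "p > 0" "a > 0"
proof -
  have N: "real N - 2 > 0" using assms(1) by simp
  have p: "p = 4 / (real N - 2)" using N by (simp add: p_def critical_exponent_def field_simps)
  then show "p > 0" using N by simp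
  show "a > 0" using N assms(2) by (simp add: a_def mult_pos_neg)
  \<comment> \<open>This relation is the origin of \<open>a\<close>: it turns
    \<open>\<mu> * ln (s\<^sup>2)\<close> into \<open>- a * ln (s powr p)\<close>.\<close>
  have ap: "a * p = - 2 * \<mu>" using N by (simp add: a_def p)
  have "\<mu> * ln (s\<^sup>2) = 2 * \<mu> * ln s" using assms(3) by (simp add: ln_realpow)
  also have "\<dots> = - (a * p) * ln s" by (simp add: ap)
  also have "\<dots> = - (a * ln (s powr p))" using assms(3) by (simp add: ln_powr)
  finally have *: "\<mu> * ln (s\<^sup>2) = - (a * ln (s powr p))" .
  have "log_critical_nonlinearity N \<Lambda> \<mu> s = s * (s powr p + \<Lambda> + \<mu> * ln (s\<^sup>2))"
    using assms(3) by (simp add: log_critical_nonlinearity_def p_def algebra_simps)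
  then show "log_critical_nonlinearity N \<Lambda> \<mu> s = s * (s powr p - a * ln (s powr p) + \<Lambda>)"
    by (simp add: * algebra_simps)
qed

text \<open>After scaling by \<open>a\<close>, this is \<open>ln y \<le> y - 1\<close> at
  \<open>y = t / a\<close>, where equality holds only for \<open>y = 1\<close>.\<close>

lemma minus_ln_ge:
  fixes a t :: real
  assumes "a > 0" "t > 0"
  shows "a - a * ln a \<le> t - a * ln t" and "t - a * ln t = a - a * ln a \<Longrightarrow> t = a"
proof -
  have eq: "t - a * ln t - (a - a * ln a) = a * (t / a - 1 - ln (t / a))"
    using assms by (simp add: ln_div algebra_simps)
  have "ln (t / a) \<le> t / a - 1" using assms by (intro ln_le_minus_one) simp
  then have "0 \<le> a * (t / a - 1 - ln (t / a))" using assms by (intro mult_nonneg_nonneg) auto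
  then show "a - a * ln a \<le> t - a * ln t" using eq by linarith
  assume "t - a * ln t = a - a * ln a"
  then have "ln (t / a) = t / a - 1" using eq assms by simp
  then have "t / a = 1" using assms by (intro ln_eq_minus_one) simp_all
  then show "t = a" using assms by simp
qed

lemma log_critical_nonlinearity_bounded:
  fixes N :: nat and \<Lambda> \<mu> s :: real
  assumes "N \<ge> 3" "0 < s" "s \<le> 1"
  shows "\<bar>log_critical_nonlinearity N \<Lambda> \<mu> s\<bar> \<le> 1 + \<bar>\<Lambda>\<bar> + 2 * \<bar>\<mu>\<bar>"
proof -
  have p: "0 \<le> critical_exponent N - 2" using assms(1) by (simp add: critical_exponent_def field_simps)
  have "s powr (critical_exponent N - 2) * s \<le> 1 * 1"
    by (rule mult_mono) (use assms p in \<open>auto intro: powr_le1\<close>)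
  then have 1: "\<bar>\<bar>s\<bar> powr (critical_exponent N - 2) * s\<bar> \<le> 1" using assms by (simp add: abs_mult)
  have 2: "\<bar>\<Lambda> * s\<bar> \<le> \<bar>\<Lambda>\<bar>" using assms by (simp add: abs_mult mult_left_le)
  \<comment> \<open>Multiplied by \<open>s\<close>, this bounds \<open>s * ln s\<close> by 1 on the
    unit interval; the factor 2 in the claim comes from
    \<open>ln (s\<^sup>2) = 2 * ln s\<close>.\<close>
  have "- ln s \<le> inverse s - 1" using ln_le_minus_one[of "inverse s"] assms by (simp add: ln_inverse)
  then have "s * (- ln s) \<le> s * (inverse s - 1)" using assms by (intro mult_left_mono) auto
  also have "\<dots> \<le> 1" using assms by (simp add: right_diff_distrib)
  finally have "\<bar>s * ln s\<bar> \<le> 1" using assms by (simp add: abs_mult)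
  then have "\<bar>2 * \<mu>\<bar> * \<bar>s * ln s\<bar> \<le> \<bar>2 * \<mu>\<bar> * 1" by (rule mult_left_mono) simp
  moreover have "\<mu> * s * ln (s\<^sup>2) = 2 * \<mu> * (s * ln s)" using assms by (simp add: ln_realpow)
  ultimately have 3: "\<bar>\<mu> * s * ln (s\<^sup>2)\<bar> \<le> 2 * \<bar>\<mu>\<bar>" by (simp only: abs_mult) simp
  show ?thesis unfolding log_critical_nonlinearity_def using 1 2 3 by linarith
qed

theorem theorem1p4:
  fixes \<Omega> :: "(real ^ 'n) set" and N :: nat and \<Lambda> \<mu> :: real
  assumes "N = CARD('n)" and "N \<ge> 3"
    and "bounded_smooth_domain \<Omega>"
    and "\<mu> < 0"
    and "- ((real N - 2) * \<mu> / 2)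
         + (real N - 2) * \<mu> / 2 * ln (- ((real N - 2) * \<mu> / 2))
         + \<Lambda> - first_eigenvalue \<Omega> \<ge> 0"
  shows "\<not> (\<exists>u. positive_solution \<Omega> (log_critical_nonlinearity N \<Lambda> \<mu>) u)"
proof -
  let ?f = "log_critical_nonlinearity N \<Lambda> \<mu>"
  define a where "a = - ((real N - 2) * \<mu> / 2)"
  define p where "p = critical_exponent N - 2"
  note f = log_critical_nonlinearity_pos[OF assms(2,4), folded a_def p_def]
  have p: "p > 0" and a: "a > 0" using f(2,3)[OF zero_less_one] by simp_all
  have hyp: "first_eigenvalue \<Omega> \<le> a - a * ln a + \<Lambda>" using assms(5) by (simp add: a_def)
  have "\<not> positive_solution \<Omega> ?f u" for u
  \<comment> \<open>The point where \<open>s powr p = a\<close>, at which the quotient of the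
    nonlinearity by \<open>s\<close> has its minimum
    \<open>a - a * ln a + \<Lambda>\<close>.\<close>
  proof (rule no_positive_solution[where ?s0.0 = "a powr (1 / p)"])
    show "open \<Omega>" "bounded \<Omega>" "\<Omega> \<noteq> {}" using assms(3) by (simp_all add: bounded_smooth_domain_def)
    show "?f \<in> borel_measurable borel" unfolding log_critical_nonlinearity_def by measurable
    show "\<bar>?f s\<bar> \<le> 1 + \<bar>\<Lambda>\<bar> + 2 * \<bar>\<mu>\<bar>" if "0 < s" "s \<le> 1" for s
      by (rule log_critical_nonlinearity_bounded[OF assms(2) that])
    show "0 < a powr (1 / p)" using a by simp
    fix s :: real assume s: "0 < s"
    define t where "t = s powr p"
    have t: "t > 0" using s by (simp add: t_def)
    have fs: "?f s = s * (t - a * ln t + \<Lambda>)" using f(1)[OF s] by (simp add: t_def)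
    have ge: "first_eigenvalue \<Omega> \<le> t - a * ln t + \<Lambda>" using minus_ln_ge(1)[OF a t] hyp by linarith
    then show "first_eigenvalue \<Omega> * s \<le> ?f s" unfolding fs using s by (simp add: mult.commute)
    assume "?f s = first_eigenvalue \<Omega> * s"
    then have "t - a * ln t + \<Lambda> = first_eigenvalue \<Omega>" unfolding fs using s by simp
    then have "t = a" using minus_ln_ge[OF a t] hyp by linarith
    then have "a powr (1 / p) = (s powr p) powr (1 / p)" by (simp add: t_def)
    also have "\<dots> = s" using s p by (simp add: powr_powr)
    finally show "s = a powr (1 / p)" by simp
  qed
  then show ?thesis by blast
qed

end
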